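(* Let $(\mathcal{C},R)$ be an optimization domain such that $\mathrm{Lin}(\mathcal{C})$ has finite limits. Then there is an identity-on-objects hypergraph functor $\mathsf{GD}_{\mathcal{C}}\colon\mathbf{Opt}_{\mathcal{C}}^R\to\mathbf{Dynam}_{\mathcal{C}}$ which takes an open objective $(X\xleftarrow{l}N\xrightarrow{r}Y,\ f\colon N\to R)$ to the open dynamical system (open optimizer) $(X\xleftarrow{l}N\xrightarrow{r}Y,\ -\mathbf{R}[f]_1\colon N\to N)$, where $\mathbf{R}[f]_1:=\mathbf{R}[f]\circ\langle\mathrm{id}_N,1_{N,R}\rangle$ is the generalized gradient of $f$.
   Context: Composition is written in classical order: $(g\circ f)(x)=g(f(x))$. A Cartesian left-additive category is a category $\mathcal{C}$ with finite products ($\times$, terminal object $*$, unique maps $!_X\colon X\to *$) in which every hom-set $\mathcal{C}(X,Y)$ is a commutative monoid with operation $+$ and identity $0_{X,Y}$, such that (LA.1) $(f+g)\circ h=f\circ h+g\circ h$ and $0_{Y,Z}\circ h=0_{X,Z}$ for all $h\colon X\to Y$, $f,g\colon Y\to Z$; (LA.2) for every projection $\pi_i\colon Y\to Z$ and $f,g\colon X\to Y$, $\pi_i\circ(f+g)=\pi_i\circ f+\pi_i\circ g$ and $\pi_i\circ 0_{X,Y}=0_{X,Z}$. Write $0_X$ for the additive identity of $\mathcal{C}( *,X)$, and $\iota_0:=\langle\mathrm{id},0\rangle$, $\iota_1:=\langle 0,\mathrm{id}\rangle$ for the injections into a product. A Cartesian reverse derivative category (CRDC) is a Cartesian left-additive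 category with a combinator $\mathbf{R}$ sending each $f\colon X\to Y$ to $\mathbf{R}[f]\colon X\times Y\to X$ such that, writing $\mathbf{D}[f]:=\pi_1\circ\mathbf{R}[\mathbf{R}[f]]\circ(\langle\mathrm{id}_X,0_{X,Y}\rangle\times\mathrm{id}_X)\colon X\times X\to Y$: (RD.1) $\mathbf{R}[f+g]=\mathbf{R}[f]+\mathbf{R}[g]$, $\mathbf{R}[0]=0$; (RD.2) $\mathbf{R}[f]\circ\langle a,b+c\rangle=\mathbf{R}[f]\circ\langle a,b\rangle+\mathbf{R}[f]\circ\langle a,c\rangle$ and $\mathbf{R}[f]\circ\langle a,0\rangle=0$; (RD.3) $\mathbf{R}[\mathrm{id}]=\pi_1$, $\mathbf{R}[\pi_0]=\iota_0\circ\pi_1$, $\mathbf{R}[\pi_1]=\iota_1\circ\pi_1$; (RD.4) $\mathbf{R}[\langle f,g\rangle]=\mathbf{R}[f]\circ(\mathrm{id}\times\pi_0)+\mathbf{R}[g]\circ(\mathrm{id}\times\pi_1)$ and $\mathbf{R}[!_X]=0$; (RD.5) $\mathbf{R}[g\circ f]=\mathbf{R}[f]\circ(\mathrm{id}\times\mathbf{R}[g])\circ\langle\pi_0,\langle f\circ\pi_0,\pi_1\rangle\rangle$; (RD.6) $\mathbf{D}[\mathbf{R}[f]]\circ\langle\mathrm{id}\times\pi_0,0\times\pi_1\rangle=\mathbf{R}[f]\circ(\mathrm{id}\times\pi_1)$ as maps $X\times(Y\times Y)\to X$; (RD.7) $\mathbf{D}[\mathbf{D}[f]]=\mathbf{D}[\mathbf{D}[f]]\circ\langle\pi_0\times\pi_0,\pi_1\times\pi_1\rangle$.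 A morphism $f$ of a CRDC is a linear map if $\mathbf{D}[f]=f\circ\pi_1$. $\mathrm{Lin}(\mathcal{C})$ is the subcategory with the same objects as $\mathcal{C}$ and the linear maps as morphisms; its monoidal product $\times$ is the product of $\mathcal{C}$. For linear $f\colon X\to Y$, $f^\dagger:=\mathbf{R}[f]\circ\langle 0_{Y,X},\mathrm{id}_Y\rangle\colon Y\to X$. It is known (Cockett et al., Proposition 24 of "Reverse derivative categories") that with this operation $\mathrm{Lin}(\mathcal{C})$ is a $\dagger$-category with finite $\dagger$-biproducts, that $\mathbf{R}[f]=f^\dagger\circ\pi_1$ for linear $f$, and that $(f+g)^\dagger=f^\dagger+g^\dagger$. An optimization domain $(\mathcal{C},R)$ is a CRDC $\mathcal{C}$ with an object $R$ such that: every morphism $f$ of $\mathcal{C}$ has an additive inverse $-f$; each $\mathcal{C}( *,X)$ is equipped with a multiplication and a multiplicative identity $1_X\colon *\to X$ making it, with the left-additive structure, a commutative ring; and $\mathcal{C}( *,R)$ is equipped with a total order making it an ordered commutative ring. Write $1_{X,Y}:=1_Y\circ !_X\colon X\to Y$. Two lax symmetric monoidal functors $(\mathrm{Lin}(\mathcal{C})^{\mathrm{op}},\times)\to(\mathbf{Set},\times)$ are used. $O$: $O(X)=\mathcal{C}(X,R)$; $O(\phi)(f)=f\circ\phi$; product comparison $\varphi_{X,Y}(f,g)=f\circ\pi_0+g\circ\pi_1$; unit comparison $\varphi_0\colon\{*\}\to O( * )$ selecting $0_R$. $D$: $D(X)=\mathcal{C}(X,X)$; $D(\phi)(v)=\phi^\dagger\circ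 v\circ\phi$; product comparison $\varphi_{X,Y}(v,w)=\pi_0^\dagger\circ v\circ\pi_0+\pi_1^\dagger\circ w\circ\pi_1$; unit comparison $\varphi_0$ the unique map $\{*\}\to D( * )$. For $F\in\{O,D\}$, define a hypergraph category as follows; it is called $\mathbf{Opt}_{\mathcal{C}}^R$ for $F=O$ and $\mathbf{Dynam}_{\mathcal{C}}$ for $F=D$. Objects are those of $\mathcal{C}$. Morphisms $X\to Y$ are isomorphism classes of pairs $(X\xleftarrow{l}N\xrightarrow{r}Y,\ s\in F(N))$ with the span in $\mathrm{Lin}(\mathcal{C})$ (called open objectives for $F=O$, open dynamical systems for $F=D$); an isomorphism from $(X\leftarrow N\to Y,s)$ to $(X\leftarrow N'\to Y,s')$ is an isomorphism $n\colon N\to N'$ in $\mathrm{Lin}(\mathcal{C})$ commuting with the legs with $F(n)(s')=s$. The composite of $(X\xleftarrow{l_1}N\xrightarrow{r_1}Y,s)$ and $(Y\xleftarrow{l_2}M\xrightarrow{r_2}Z,t)$ is the pullback span $X\xleftarrow{l_1\circ b_0}N\times_YM\xrightarrow{r_2\circ b_1}Z$ (pullback of $r_1,l_2$ in $\mathrm{Lin}(\mathcal{C})$ with projections $b_0,b_1$) with decoration $F(\langle b_0,b_1\rangle)(\varphi_{N,M}(s,t))$, where $\langle b_0,b_1\rangle\colon N\times_YM\to N\times M$. The identity decoration on an apex $N$ is $\{*\}\xrightarrow{\varphi_0}F( * )\xrightarrow{F(!)}F(N)$; the identity on $X$ is $X=X=X$ with the identity decoration. The monoidal product is the product of $\mathcal{C}$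 on objects, and $(X\leftarrow N\to Y,s)\otimes(W\leftarrow M\to Z,t)=(X\times W\leftarrow N\times M\to Y\times Z,\ \varphi_{N,M}(s,t))$. The Frobenius maps on $X$ are the spans $\mu=(X\times X\xleftarrow{\Delta}X=X)$, $\eta=( *\xleftarrow{!}X=X)$, $\delta=(X=X\xrightarrow{\Delta}X\times X)$, $\epsilon=(X=X\xrightarrow{!}* )$, $\Delta=\langle\mathrm{id},\mathrm{id}\rangle$, with the identity decoration. A hypergraph category is a symmetric monoidal category in which every object is equipped with a special commutative Frobenius monoid structure, compatibly with the monoidal product. A hypergraph functor is a strong symmetric monoidal functor that preserves the Frobenius structure maps (up to the monoidal coherence isomorphisms of the functor). *)

theory Defs
  imports "HOL-Algebra.Ring"
begin

section \<open>Categories, functors, finite limits\<close>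

text \<open>
  A category is given by a set of objects and a set of arrows with domain and codomain;
  composition \<open>g \<cdot> f\<close> is in classical order and is meaningful only for composable arrows.
\<close>

record ('o, 'm) cat =
  ob :: "'o set"
  ar :: "'m set"
  dm :: "'m \<Rightarrow> 'o"
  cd :: "'m \<Rightarrow> 'o"
  ide :: "'o \<Rightarrow> 'm"
  cmp :: "'m \<Rightarrow> 'm \<Rightarrow> 'm"  (infixr \<open>\<cdot>\<index>\<close> 75)

definition Hom :: "('o, 'm, 'z) cat_scheme \<Rightarrow> 'o \<Rightarrow> 'o \<Rightarrow> 'm set" where
  "Hom C X Y = {f \<in> ar C. dm C f = X \<and> cd C f = Y}"

locale category =
  fixes C :: "('o, 'm, 'z) cat_scheme" (structure)
  assumes dm_ob: "f \<in> ar C \<Longrightarrow> dm C f \<in> ob C"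
    and cd_ob: "f \<in> ar C \<Longrightarrow> cd C f \<in> ob C"
    and ide_Hom: "X \<in> ob C \<Longrightarrow> ide C X \<in> Hom C X X"
    and cmp_Hom: "\<lbrakk>f \<in> Hom C X Y; g \<in> Hom C Y Z\<rbrakk> \<Longrightarrow> g \<cdot> f \<in> Hom C X Z"
    and ide_right: "f \<in> Hom C X Y \<Longrightarrow> f \<cdot> ide C X = f"
    and ide_left: "f \<in> Hom C X Y \<Longrightarrow> ide C Y \<cdot> f = f"
    and cmp_assoc: "\<lbrakk>f \<in> Hom C W X; g \<in> Hom C X Y; h \<in> Hom C Y Z\<rbrakk>
      \<Longrightarrow> (h \<cdot> g) \<cdot> f = h \<cdot> (g \<cdot> f)"

definition inverse_arrows ::
    "('o, 'm, 'z) cat_scheme \<Rightarrow> 'o \<Rightarrow> 'o \<Rightarrow> 'm \<Rightarrow> 'm \<Rightarrow> bool" where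
  "inverse_arrows C X Y f g \<longleftrightarrow> f \<in> Hom C X Y \<and> g \<in> Hom C Y X \<and>
     g \<cdot>\<^bsub>C\<^esub> f = ide C X \<and> f \<cdot>\<^bsub>C\<^esub> g = ide C Y"

definition Iso :: "('o, 'm, 'z) cat_scheme \<Rightarrow> 'o \<Rightarrow> 'o \<Rightarrow> 'm set" where
  "Iso C X Y = {f. \<exists>g. inverse_arrows C X Y f g}"

definition inv_arr :: "('o, 'm, 'z) cat_scheme \<Rightarrow> 'm \<Rightarrow> 'm" where
  "inv_arr C f = (THE g. inverse_arrows C (dm C f) (cd C f) f g)"

locale category_functor = A: category A + B: category B
  for A :: "('a, 'b, 'y) cat_scheme" and B :: "('c, 'd, 'z) cat_scheme" +
  fixes Fo :: "'a \<Rightarrow> 'c" and Fm :: "'b \<Rightarrow> 'd"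
  assumes Fo_ob: "X \<in> ob A \<Longrightarrow> Fo X \<in> ob B"
    and Fm_Hom: "f \<in> Hom A X Y \<Longrightarrow> Fm f \<in> Hom B (Fo X) (Fo Y)"
    and Fm_ide: "X \<in> ob A \<Longrightarrow> Fm (ide A X) = ide B (Fo X)"
    and Fm_cmp: "\<lbrakk>f \<in> Hom A X Y; g \<in> Hom A Y Z\<rbrakk>
      \<Longrightarrow> Fm (g \<cdot>\<^bsub>A\<^esub> f) = Fm g \<cdot>\<^bsub>B\<^esub> Fm f"

definition cone :: "('j, 'k, 'y) cat_scheme \<Rightarrow> ('o, 'm, 'z) cat_scheme
    \<Rightarrow> ('j \<Rightarrow> 'o) \<Rightarrow> ('k \<Rightarrow> 'm) \<Rightarrow> 'o \<Rightarrow> ('j \<Rightarrow> 'm) \<Rightarrow> bool" where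
  "cone J C Do Da L p \<longleftrightarrow> L \<in> ob C \<and> (\<forall>j \<in> ob J. p j \<in> Hom C L (Do j)) \<and>
     (\<forall>u \<in> ar J. Da u \<cdot>\<^bsub>C\<^esub> p (dm J u) = p (cd J u))"

definition limit_cone :: "('j, 'k, 'y) cat_scheme \<Rightarrow> ('o, 'm, 'z) cat_scheme
    \<Rightarrow> ('j \<Rightarrow> 'o) \<Rightarrow> ('k \<Rightarrow> 'm) \<Rightarrow> 'o \<Rightarrow> ('j \<Rightarrow> 'm) \<Rightarrow> bool" where
  "limit_cone J C Do Da L p \<longleftrightarrow> cone J C Do Da L p \<and>
     (\<forall>M q. cone J C Do Da M q \<longrightarrow>
        (\<exists>!h. h \<in> Hom C M L \<and> (\<forall>j \<in> ob J. p j \<cdot>\<^bsub>C\<^esub> h = q j)))"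

text \<open>
  Every finite category is isomorphic to one whose objects and arrows are natural numbers,
  so it is enough to let the diagram shapes range over the latter.
\<close>

definition has_finite_limits :: "('o, 'm, 'z) cat_scheme \<Rightarrow> bool" where
  "has_finite_limits C \<longleftrightarrow>
     (\<forall>(J :: (nat, nat) cat) Do Da.
        category_functor J C Do Da \<and> finite (ob J) \<and> finite (ar J) \<longrightarrow>
        (\<exists>L p. limit_cone J C Do Da L p))"

definition is_pullback ::
    "('o, 'm, 'z) cat_scheme \<Rightarrow> 'm \<Rightarrow> 'm \<Rightarrow> 'm \<Rightarrow> 'm \<Rightarrow> bool" where
  "is_pullback C f g b\<^sub>0 b\<^sub>1 \<longleftrightarrow> f \<in> ar C \<and> g \<in> ar C \<and> cd C f = cd C g \<and>
     (\<exists>P. b\<^sub>0 \<in> Hom C P (dm C f) \<and> b\<^sub>1 \<in> Hom C P (dm C g) \<and>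
        f \<cdot>\<^bsub>C\<^esub> b\<^sub>0 = g \<cdot>\<^bsub>C\<^esub> b\<^sub>1 \<and>
        (\<forall>Q a\<^sub>0 a\<^sub>1. a\<^sub>0 \<in> Hom C Q (dm C f) \<longrightarrow> a\<^sub>1 \<in> Hom C Q (dm C g) \<longrightarrow>
           f \<cdot>\<^bsub>C\<^esub> a\<^sub>0 = g \<cdot>\<^bsub>C\<^esub> a\<^sub>1 \<longrightarrow>
           (\<exists>!h. h \<in> Hom C Q P \<and> b\<^sub>0 \<cdot>\<^bsub>C\<^esub> h = a\<^sub>0 \<and> b\<^sub>1 \<cdot>\<^bsub>C\<^esub> h = a\<^sub>1)))"


section \<open>Symmetric monoidal and hypergraph categories\<close>

text \<open>
  The tensor product is \<open>\<odot>\<close> on objects and \<open>\<star>\<close> on arrows. The associator goes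
  \<open>(X \<odot> Y) \<odot> Z \<rightarrow> X \<odot> (Y \<odot> Z)\<close>, the unitors \<open>I \<odot> X \<rightarrow> X\<close> and \<open>X \<odot> I \<rightarrow> X\<close>.
\<close>

record ('o, 'm) smcat = "('o, 'm) cat" +
  tob :: "'o \<Rightarrow> 'o \<Rightarrow> 'o"  (infixr \<open>\<odot>\<index>\<close> 80)
  tar :: "'m \<Rightarrow> 'm \<Rightarrow> 'm"  (infixr \<open>\<star>\<index>\<close> 80)
  unit :: "'o"
  assoc :: "'o \<Rightarrow> 'o \<Rightarrow> 'o \<Rightarrow> 'm"
  lunit :: "'o \<Rightarrow> 'm"
  runit :: "'o \<Rightarrow> 'm"
  swap :: "'o \<Rightarrow> 'o \<Rightarrow> 'm"

locale monoidal_category = category H for H :: "('o, 'm, 'z) smcat_scheme" (structure) +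
  assumes unit_ob: "unit H \<in> ob H"
    and tob_ob: "\<lbrakk>X \<in> ob H; Y \<in> ob H\<rbrakk> \<Longrightarrow> X \<odot> Y \<in> ob H"
    and tar_Hom: "\<lbrakk>f \<in> Hom H X Y; g \<in> Hom H Z W\<rbrakk> \<Longrightarrow> f \<star> g \<in> Hom H (X \<odot> Z) (Y \<odot> W)"
    and tar_ide: "\<lbrakk>X \<in> ob H; Y \<in> ob H\<rbrakk> \<Longrightarrow> ide H X \<star> ide H Y = ide H (X \<odot> Y)"
    and tar_cmp: "\<lbrakk>f \<in> Hom H X Y; g \<in> Hom H Y Z; f' \<in> Hom H X' Y'; g' \<in> Hom H Y' Z'\<rbrakk>
      \<Longrightarrow> (g \<cdot> f) \<star> (g' \<cdot> f') = (g \<star> g') \<cdot> (f \<star> f')"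
    and assoc_Iso: "\<lbrakk>X \<in> ob H; Y \<in> ob H; Z \<in> ob H\<rbrakk>
      \<Longrightarrow> assoc H X Y Z \<in> Iso H ((X \<odot> Y) \<odot> Z) (X \<odot> (Y \<odot> Z))"
    and lunit_Iso: "X \<in> ob H \<Longrightarrow> lunit H X \<in> Iso H (unit H \<odot> X) X"
    and runit_Iso: "X \<in> ob H \<Longrightarrow> runit H X \<in> Iso H (X \<odot> unit H) X"
    and assoc_natural: "\<lbrakk>f \<in> Hom H X X'; g \<in> Hom H Y Y'; h \<in> Hom H Z Z'\<rbrakk>
      \<Longrightarrow> assoc H X' Y' Z' \<cdot> ((f \<star> g) \<star> h) = (f \<star> (g \<star> h)) \<cdot> assoc H X Y Z"
    and lunit_natural: "f \<in> Hom H X X' \<Longrightarrow> lunit H X' \<cdot> (ide H (unit H) \<star> f) = f \<cdot> lunit H X"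
    and runit_natural: "f \<in> Hom H X X' \<Longrightarrow> runit H X' \<cdot> (f \<star> ide H (unit H)) = f \<cdot> runit H X"
    and pentagon: "\<lbrakk>W \<in> ob H; X \<in> ob H; Y \<in> ob H; Z \<in> ob H\<rbrakk>
      \<Longrightarrow> (ide H W \<star> assoc H X Y Z) \<cdot> assoc H W (X \<odot> Y) Z \<cdot> (assoc H W X Y \<star> ide H Z)
        = assoc H W X (Y \<odot> Z) \<cdot> assoc H (W \<odot> X) Y Z"
    and triangle: "\<lbrakk>X \<in> ob H; Y \<in> ob H\<rbrakk>
      \<Longrightarrow> (ide H X \<star> lunit H Y) \<cdot> assoc H X (unit H) Y = runit H X \<star> ide H Y"

locale symmetric_monoidal_category = monoidal_category +
  assumes swap_Hom: "\<lbrakk>X \<in> ob H; Y \<in> ob H\<rbrakk> \<Longrightarrow> swap H X Y \<in> Hom H (X \<odot> Y) (Y \<odot> X)"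
    and swap_natural: "\<lbrakk>f \<in> Hom H X X'; g \<in> Hom H Y Y'\<rbrakk>
      \<Longrightarrow> swap H X' Y' \<cdot> (f \<star> g) = (g \<star> f) \<cdot> swap H X Y"
    and swap_swap: "\<lbrakk>X \<in> ob H; Y \<in> ob H\<rbrakk> \<Longrightarrow> swap H Y X \<cdot> swap H X Y = ide H (X \<odot> Y)"
    and hexagon: "\<lbrakk>X \<in> ob H; Y \<in> ob H; Z \<in> ob H\<rbrakk>
      \<Longrightarrow> (ide H Y \<star> swap H X Z) \<cdot> assoc H Y X Z \<cdot> (swap H X Y \<star> ide H Z)
        = assoc H Y Z X \<cdot> swap H X (Y \<odot> Z) \<cdot> assoc H X Y Z"

text \<open>The canonical isomorphism \<open>(A \<odot> B) \<odot> (C \<odot> D) \<rightarrow> (A \<odot> C) \<odot> (B \<odot> D)\<close>.\<close>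

definition mid_swap :: "('o, 'm, 'z) smcat_scheme \<Rightarrow> 'o \<Rightarrow> 'o \<Rightarrow> 'o \<Rightarrow> 'o \<Rightarrow> 'm" where
  "mid_swap H A B C D =
     inv_arr H (assoc H A C (B \<odot>\<^bsub>H\<^esub> D)) \<cdot>\<^bsub>H\<^esub>
     (ide H A \<star>\<^bsub>H\<^esub>
        (assoc H C B D \<cdot>\<^bsub>H\<^esub> (swap H B C \<star>\<^bsub>H\<^esub> ide H D) \<cdot>\<^bsub>H\<^esub>
         inv_arr H (assoc H B C D))) \<cdot>\<^bsub>H\<^esub>
     assoc H A B (C \<odot>\<^bsub>H\<^esub> D)"

record ('o, 'm) hypcat = "('o, 'm) smcat" +
  mu :: "'o \<Rightarrow> 'm"
  eta :: "'o \<Rightarrow> 'm"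
  delta :: "'o \<Rightarrow> 'm"
  eps :: "'o \<Rightarrow> 'm"

locale hypergraph_category = symmetric_monoidal_category H
  for H :: "('o, 'm, 'z) hypcat_scheme" (structure) +
  assumes mu_Hom: "X \<in> ob H \<Longrightarrow> mu H X \<in> Hom H (X \<odot> X) X"
    and eta_Hom: "X \<in> ob H \<Longrightarrow> eta H X \<in> Hom H (unit H) X"
    and delta_Hom: "X \<in> ob H \<Longrightarrow> delta H X \<in> Hom H X (X \<odot> X)"
    and eps_Hom: "X \<in> ob H \<Longrightarrow> eps H X \<in> Hom H X (unit H)"
    and mu_assoc: "X \<in> ob H \<Longrightarrow>
      mu H X \<cdot> (mu H X \<star> ide H X) = mu H X \<cdot> (ide H X \<star> mu H X) \<cdot> assoc H X X X"
    and mu_lunit: "X \<in> ob H \<Longrightarrow> mu H X \<cdot> (eta H X \<star> ide H X) = lunit H X"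
    and mu_runit: "X \<in> ob H \<Longrightarrow> mu H X \<cdot> (ide H X \<star> eta H X) = runit H X"
    and mu_commute: "X \<in> ob H \<Longrightarrow> mu H X \<cdot> swap H X X = mu H X"
    and delta_coassoc: "X \<in> ob H \<Longrightarrow>
      assoc H X X X \<cdot> (delta H X \<star> ide H X) \<cdot> delta H X = (ide H X \<star> delta H X) \<cdot> delta H X"
    and delta_lcounit: "X \<in> ob H \<Longrightarrow>
      lunit H X \<cdot> (eps H X \<star> ide H X) \<cdot> delta H X = ide H X"
    and delta_rcounit: "X \<in> ob H \<Longrightarrow>
      runit H X \<cdot> (ide H X \<star> eps H X) \<cdot> delta H X = ide H X"
    and delta_cocommute: "X \<in> ob H \<Longrightarrow> swap H X X \<cdot> delta H X = delta H X"
    and frobenius_left: "X \<in> ob H \<Longrightarrow>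
      (ide H X \<star> mu H X) \<cdot> assoc H X X X \<cdot> (delta H X \<star> ide H X) = delta H X \<cdot> mu H X"
    and frobenius_right: "X \<in> ob H \<Longrightarrow>
      (mu H X \<star> ide H X) \<cdot> inv_arr H (assoc H X X X) \<cdot> (ide H X \<star> delta H X) = delta H X \<cdot> mu H X"
    and special: "X \<in> ob H \<Longrightarrow> mu H X \<cdot> delta H X = ide H X"
    and mu_tensor: "\<lbrakk>X \<in> ob H; Y \<in> ob H\<rbrakk> \<Longrightarrow>
      mu H (X \<odot> Y) = (mu H X \<star> mu H Y) \<cdot> mid_swap H X Y X Y"
    and eta_tensor: "\<lbrakk>X \<in> ob H; Y \<in> ob H\<rbrakk> \<Longrightarrow>
      eta H (X \<odot> Y) = (eta H X \<star> eta H Y) \<cdot> inv_arr H (lunit H (unit H))"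
    and delta_tensor: "\<lbrakk>X \<in> ob H; Y \<in> ob H\<rbrakk> \<Longrightarrow>
      delta H (X \<odot> Y) = mid_swap H X X Y Y \<cdot> (delta H X \<star> delta H Y)"
    and eps_tensor: "\<lbrakk>X \<in> ob H; Y \<in> ob H\<rbrakk> \<Longrightarrow>
      eps H (X \<odot> Y) = lunit H (unit H) \<cdot> (eps H X \<star> eps H Y)"
    and eta_unit: "eta H (unit H) = ide H (unit H)"
    and eps_unit: "eps H (unit H) = ide H (unit H)"

text \<open>
  The coherence isomorphisms of the strong monoidal functor are
  \<open>\<Phi> X Y : F X \<odot> F Y \<rightarrow> F (X \<odot> Y)\<close> and \<open>\<Phi>\<^sub>0 : I \<rightarrow> F I\<close>.
\<close>

locale hypergraph_functor =
  A: hypergraph_category A + B: hypergraph_category B + category_functor A B Fo Fm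
  for A :: "('a, 'b, 'y) hypcat_scheme" and B :: "('c, 'd, 'z) hypcat_scheme"
    and Fo :: "'a \<Rightarrow> 'c" and Fm :: "'b \<Rightarrow> 'd" +
  fixes \<Phi> :: "'a \<Rightarrow> 'a \<Rightarrow> 'd" and \<Phi>\<^sub>0 :: "'d"
  assumes Phi_Iso: "\<lbrakk>X \<in> ob A; Y \<in> ob A\<rbrakk> \<Longrightarrow> \<Phi> X Y \<in> Iso B (Fo X \<odot>\<^bsub>B\<^esub> Fo Y) (Fo (X \<odot>\<^bsub>A\<^esub> Y))"
    and Phi0_Iso: "\<Phi>\<^sub>0 \<in> Iso B (unit B) (Fo (unit A))"
    and Phi_natural: "\<lbrakk>f \<in> Hom A X X'; g \<in> Hom A Y Y'\<rbrakk> \<Longrightarrow>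
      \<Phi> X' Y' \<cdot>\<^bsub>B\<^esub> (Fm f \<star>\<^bsub>B\<^esub> Fm g) = Fm (f \<star>\<^bsub>A\<^esub> g) \<cdot>\<^bsub>B\<^esub> \<Phi> X Y"
    and Phi_assoc: "\<lbrakk>X \<in> ob A; Y \<in> ob A; Z \<in> ob A\<rbrakk> \<Longrightarrow>
      Fm (assoc A X Y Z) \<cdot>\<^bsub>B\<^esub> \<Phi> (X \<odot>\<^bsub>A\<^esub> Y) Z \<cdot>\<^bsub>B\<^esub> (\<Phi> X Y \<star>\<^bsub>B\<^esub> ide B (Fo Z))
      = \<Phi> X (Y \<odot>\<^bsub>A\<^esub> Z) \<cdot>\<^bsub>B\<^esub> (ide B (Fo X) \<star>\<^bsub>B\<^esub> \<Phi> Y Z) \<cdot>\<^bsub>B\<^esub> assoc B (Fo X) (Fo Y) (Fo Z)"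
    and Phi_lunit: "X \<in> ob A \<Longrightarrow>
      Fm (lunit A X) \<cdot>\<^bsub>B\<^esub> \<Phi> (unit A) X \<cdot>\<^bsub>B\<^esub> (\<Phi>\<^sub>0 \<star>\<^bsub>B\<^esub> ide B (Fo X)) = lunit B (Fo X)"
    and Phi_runit: "X \<in> ob A \<Longrightarrow>
      Fm (runit A X) \<cdot>\<^bsub>B\<^esub> \<Phi> X (unit A) \<cdot>\<^bsub>B\<^esub> (ide B (Fo X) \<star>\<^bsub>B\<^esub> \<Phi>\<^sub>0) = runit B (Fo X)"
    and Phi_swap: "\<lbrakk>X \<in> ob A; Y \<in> ob A\<rbrakk> \<Longrightarrow>
      Fm (swap A X Y) \<cdot>\<^bsub>B\<^esub> \<Phi> X Y = \<Phi> Y X \<cdot>\<^bsub>B\<^esub> swap B (Fo X) (Fo Y)"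
    and Fm_mu: "X \<in> ob A \<Longrightarrow> Fm (mu A X) \<cdot>\<^bsub>B\<^esub> \<Phi> X X = mu B (Fo X)"
    and Fm_eta: "X \<in> ob A \<Longrightarrow> Fm (eta A X) \<cdot>\<^bsub>B\<^esub> \<Phi>\<^sub>0 = eta B (Fo X)"
    and Fm_delta: "X \<in> ob A \<Longrightarrow> Fm (delta A X) = \<Phi> X X \<cdot>\<^bsub>B\<^esub> delta B (Fo X)"
    and Fm_eps: "X \<in> ob A \<Longrightarrow> Fm (eps A X) = \<Phi>\<^sub>0 \<cdot>\<^bsub>B\<^esub> eps B (Fo X)"


section \<open>Cartesian left-additive categories\<close>

record ('o, 'm) clacat = "('o, 'm) cat" +
  trm :: "'o"
  bang :: "'o \<Rightarrow> 'm"
  prd :: "'o \<Rightarrow> 'o \<Rightarrow> 'o"  (infixr \<open>\<^bold>\<times>\<index>\<close> 80)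
  pr\<^sub>0 :: "'o \<Rightarrow> 'o \<Rightarrow> 'm"
  pr\<^sub>1 :: "'o \<Rightarrow> 'o \<Rightarrow> 'm"
  pair :: "'m \<Rightarrow> 'm \<Rightarrow> 'm"  (\<open>\<langle>_,/ _\<rangle>\<index>\<close>)
  pls :: "'m \<Rightarrow> 'm \<Rightarrow> 'm"  (infixl \<open>\<^bold>+\<index>\<close> 65)
  nul :: "'o \<Rightarrow> 'o \<Rightarrow> 'm"

locale cartesian_category = category C for C :: "('o, 'm, 'z) clacat_scheme" (structure) +
  assumes trm_ob: "trm C \<in> ob C"
    and bang_Hom: "X \<in> ob C \<Longrightarrow> bang C X \<in> Hom C X (trm C)"
    and bang_unique: "f \<in> Hom C X (trm C) \<Longrightarrow> f = bang C X"
    and prd_ob: "\<lbrakk>X \<in> ob C; Y \<in> ob C\<rbrakk> \<Longrightarrow> X \<^bold>\<times> Y \<in> ob C"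
    and pr0_Hom: "\<lbrakk>X \<in> ob C; Y \<in> ob C\<rbrakk> \<Longrightarrow> pr\<^sub>0 C X Y \<in> Hom C (X \<^bold>\<times> Y) X"
    and pr1_Hom: "\<lbrakk>X \<in> ob C; Y \<in> ob C\<rbrakk> \<Longrightarrow> pr\<^sub>1 C X Y \<in> Hom C (X \<^bold>\<times> Y) Y"
    and pair_Hom: "\<lbrakk>f \<in> Hom C Z X; g \<in> Hom C Z Y\<rbrakk> \<Longrightarrow> \<langle>f, g\<rangle> \<in> Hom C Z (X \<^bold>\<times> Y)"
    and pr0_pair: "\<lbrakk>f \<in> Hom C Z X; g \<in> Hom C Z Y\<rbrakk> \<Longrightarrow> pr\<^sub>0 C X Y \<cdot> \<langle>f, g\<rangle> = f"
    and pr1_pair: "\<lbrakk>f \<in> Hom C Z X; g \<in> Hom C Z Y\<rbrakk> \<Longrightarrow> pr\<^sub>1 C X Y \<cdot> \<langle>f, g\<rangle> = g"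
    and pair_unique: "\<lbrakk>X \<in> ob C; Y \<in> ob C; h \<in> Hom C Z (X \<^bold>\<times> Y)\<rbrakk>
      \<Longrightarrow> \<langle>pr\<^sub>0 C X Y \<cdot> h, pr\<^sub>1 C X Y \<cdot> h\<rangle> = h"

definition prd_arr :: "('o, 'm, 'z) clacat_scheme \<Rightarrow> 'm \<Rightarrow> 'm \<Rightarrow> 'm"
    (infixr \<open>\<diamondop>\<index>\<close> 80) where
  "f \<diamondop>\<^bsub>C\<^esub> g =
     \<langle>f \<cdot>\<^bsub>C\<^esub> pr\<^sub>0 C (dm C f) (dm C g), g \<cdot>\<^bsub>C\<^esub> pr\<^sub>1 C (dm C f) (dm C g)\<rangle>\<^bsub>C\<^esub>"

locale left_additive_category = cartesian_category +
  assumes comm_monoid_Hom: "\<lbrakk>X \<in> ob C; Y \<in> ob C\<rbrakk> \<Longrightarrow>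
      comm_monoid \<lparr>carrier = Hom C X Y, mult = pls C, one = nul C X Y\<rparr>"
    and LA1_plus: "\<lbrakk>h \<in> Hom C X Y; f \<in> Hom C Y Z; g \<in> Hom C Y Z\<rbrakk>
      \<Longrightarrow> (f \<^bold>+ g) \<cdot> h = f \<cdot> h \<^bold>+ g \<cdot> h"
    and LA1_zero: "\<lbrakk>h \<in> Hom C X Y; Z \<in> ob C\<rbrakk> \<Longrightarrow> nul C Y Z \<cdot> h = nul C X Z"
    and LA2_pr0_plus: "\<lbrakk>Y \<in> ob C; Z \<in> ob C; f \<in> Hom C X (Y \<^bold>\<times> Z); g \<in> Hom C X (Y \<^bold>\<times> Z)\<rbrakk>
      \<Longrightarrow> pr\<^sub>0 C Y Z \<cdot> (f \<^bold>+ g) = pr\<^sub>0 C Y Z \<cdot> f \<^bold>+ pr\<^sub>0 C Y Z \<cdot> g"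
    and LA2_pr1_plus: "\<lbrakk>Y \<in> ob C; Z \<in> ob C; f \<in> Hom C X (Y \<^bold>\<times> Z); g \<in> Hom C X (Y \<^bold>\<times> Z)\<rbrakk>
      \<Longrightarrow> pr\<^sub>1 C Y Z \<cdot> (f \<^bold>+ g) = pr\<^sub>1 C Y Z \<cdot> f \<^bold>+ pr\<^sub>1 C Y Z \<cdot> g"
    and LA2_pr0_zero: "\<lbrakk>X \<in> ob C; Y \<in> ob C; Z \<in> ob C\<rbrakk>
      \<Longrightarrow> pr\<^sub>0 C Y Z \<cdot> nul C X (Y \<^bold>\<times> Z) = nul C X Y"
    and LA2_pr1_zero: "\<lbrakk>X \<in> ob C; Y \<in> ob C; Z \<in> ob C\<rbrakk>
      \<Longrightarrow> pr\<^sub>1 C Y Z \<cdot> nul C X (Y \<^bold>\<times> Z) = nul C X Z"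


section \<open>Cartesian reverse derivative categories\<close>

record ('o, 'm) crdcat = "('o, 'm) clacat" +
  rev_d :: "'m \<Rightarrow> 'm"  (\<open>\<R>\<index>\<close>)

definition fwd_d :: "('o, 'm, 'z) crdcat_scheme \<Rightarrow> 'm \<Rightarrow> 'm"  (\<open>\<D>\<index>\<close>) where
  "fwd_d C f = (let X = dm C f; Y = cd C f in
     pr\<^sub>1 C X Y \<cdot>\<^bsub>C\<^esub> rev_d C (rev_d C f) \<cdot>\<^bsub>C\<^esub> (\<langle>ide C X, nul C X Y\<rangle>\<^bsub>C\<^esub> \<diamondop>\<^bsub>C\<^esub> ide C X))"

locale reverse_derivative_category = left_additive_category C
  for C :: "('o, 'm, 'z) crdcat_scheme" (structure) +
  assumes R_Hom: "f \<in> Hom C X Y \<Longrightarrow> \<R> f \<in> Hom C (X \<^bold>\<times> Y) X"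
    and RD1_plus: "\<lbrakk>f \<in> Hom C X Y; g \<in> Hom C X Y\<rbrakk> \<Longrightarrow> \<R> (f \<^bold>+ g) = \<R> f \<^bold>+ \<R> g"
    and RD1_zero: "\<lbrakk>X \<in> ob C; Y \<in> ob C\<rbrakk> \<Longrightarrow> \<R> (nul C X Y) = nul C (X \<^bold>\<times> Y) X"
    and RD2_plus: "\<lbrakk>f \<in> Hom C X Y; a \<in> Hom C Z X; b \<in> Hom C Z Y; c \<in> Hom C Z Y\<rbrakk>
      \<Longrightarrow> \<R> f \<cdot> \<langle>a, b \<^bold>+ c\<rangle> = \<R> f \<cdot> \<langle>a, b\<rangle> \<^bold>+ \<R> f \<cdot> \<langle>a, c\<rangle>"
    and RD2_zero: "\<lbrakk>f \<in> Hom C X Y; a \<in> Hom C Z X\<rbrakk> \<Longrightarrow> \<R> f \<cdot> \<langle>a, nul C Z Y\<rangle> = nul C Z X"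
    and RD3_ide: "X \<in> ob C \<Longrightarrow> \<R> (ide C X) = pr\<^sub>1 C X X"
    and RD3_pr0: "\<lbrakk>X \<in> ob C; Y \<in> ob C\<rbrakk>
      \<Longrightarrow> \<R> (pr\<^sub>0 C X Y) = \<langle>ide C X, nul C X Y\<rangle> \<cdot> pr\<^sub>1 C (X \<^bold>\<times> Y) X"
    and RD3_pr1: "\<lbrakk>X \<in> ob C; Y \<in> ob C\<rbrakk>
      \<Longrightarrow> \<R> (pr\<^sub>1 C X Y) = \<langle>nul C Y X, ide C Y\<rangle> \<cdot> pr\<^sub>1 C (X \<^bold>\<times> Y) Y"
    and RD4_pair: "\<lbrakk>f \<in> Hom C X Y; g \<in> Hom C X Z\<rbrakk>
      \<Longrightarrow> \<R> \<langle>f, g\<rangle> = \<R> f \<cdot> (ide C X \<diamondop> pr\<^sub>0 C Y Z) \<^bold>+ \<R> g \<cdot> (ide C X \<diamondop> pr\<^sub>1 C Y Z)"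
    and RD4_bang: "X \<in> ob C \<Longrightarrow> \<R> (bang C X) = nul C (X \<^bold>\<times> trm C) X"
    and RD5: "\<lbrakk>f \<in> Hom C X Y; g \<in> Hom C Y Z\<rbrakk>
      \<Longrightarrow> \<R> (g \<cdot> f) =
        \<R> f \<cdot> (ide C X \<diamondop> \<R> g) \<cdot> \<langle>pr\<^sub>0 C X Z, \<langle>f \<cdot> pr\<^sub>0 C X Z, pr\<^sub>1 C X Z\<rangle>\<rangle>"
    and RD6: "f \<in> Hom C X Y
      \<Longrightarrow> \<D> (\<R> f) \<cdot> \<langle>ide C X \<diamondop> pr\<^sub>0 C Y Y, nul C X X \<diamondop> pr\<^sub>1 C Y Y\<rangle>
        = \<R> f \<cdot> (ide C X \<diamondop> pr\<^sub>1 C Y Y)"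
    and RD7: "f \<in> Hom C X Y
      \<Longrightarrow> \<D> (\<D> f) = \<D> (\<D> f) \<cdot> \<langle>pr\<^sub>0 C X X \<diamondop> pr\<^sub>0 C X X, pr\<^sub>1 C X X \<diamondop> pr\<^sub>1 C X X\<rangle>"

definition linear :: "('o, 'm, 'z) crdcat_scheme \<Rightarrow> 'm \<Rightarrow> bool" where
  "linear C f \<longleftrightarrow> fwd_d C f = f \<cdot>\<^bsub>C\<^esub> pr\<^sub>1 C (dm C f) (dm C f)"

definition Lin :: "('o, 'm, 'z) crdcat_scheme \<Rightarrow> ('o, 'm) cat" where
  "Lin C = \<lparr>ob = ob C, ar = {f \<in> ar C. linear C f}, dm = dm C, cd = cd C,
            ide = ide C, cmp = cmp C\<rparr>"

definition dagger :: "('o, 'm, 'z) crdcat_scheme \<Rightarrow> 'm \<Rightarrow> 'm"  (\<open>_\<^bold>\<dagger>\<index>\<close> [1000] 999) where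
  "dagger C f = (let X = dm C f; Y = cd C f in
     rev_d C f \<cdot>\<^bsub>C\<^esub> \<langle>nul C Y X, ide C Y\<rangle>\<^bsub>C\<^esub>)"


section \<open>Optimization domains\<close>

text \<open>\<open>mul X\<close> and \<open>uno X\<close> are the multiplication and its identity \<open>1\<^sub>X\<close> on the points
  of \<open>X\<close>; \<open>le\<close> is the order on the points of the distinguished object \<open>R\<close>.\<close>

record ('o, 'm) optdom = "('o, 'm) crdcat" +
  robj :: "'o"
  mul :: "'o \<Rightarrow> 'm \<Rightarrow> 'm \<Rightarrow> 'm"
  uno :: "'o \<Rightarrow> 'm"
  le :: "'m rel"

locale optimization_domain = reverse_derivative_category C
  for C :: "('o, 'm, 'z) optdom_scheme" (structure) +
  assumes robj_ob: "robj C \<in> ob C"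
    and additive_inverse: "f \<in> Hom C X Y \<Longrightarrow> \<exists>g \<in> Hom C X Y. f \<^bold>+ g = nul C X Y"
    and cring_points: "X \<in> ob C \<Longrightarrow>
      cring \<lparr>carrier = Hom C (trm C) X, mult = mul C X, one = uno C X,
             zero = nul C (trm C) X, add = pls C\<rparr>"
    and le_linear: "linear_order_on (Hom C (trm C) (robj C)) (le C)"
    and le_plus: "\<lbrakk>(a, b) \<in> le C; c \<in> Hom C (trm C) (robj C)\<rbrakk> \<Longrightarrow> (a \<^bold>+ c, b \<^bold>+ c) \<in> le C"
    and le_mul: "\<lbrakk>(nul C (trm C) (robj C), a) \<in> le C; (nul C (trm C) (robj C), b) \<in> le C\<rbrakk>
      \<Longrightarrow> (nul C (trm C) (robj C), mul C (robj C) a b) \<in> le C"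

definition neg :: "('o, 'm, 'z) clacat_scheme \<Rightarrow> 'm \<Rightarrow> 'm"  (\<open>\<^bold>-\<index> _\<close> [81] 80) where
  "neg C f = (THE g. g \<in> Hom C (dm C f) (cd C f) \<and> f \<^bold>+\<^bsub>C\<^esub> g = nul C (dm C f) (cd C f))"

definition one_arr :: "('o, 'm, 'z) optdom_scheme \<Rightarrow> 'o \<Rightarrow> 'o \<Rightarrow> 'm" where
  "one_arr C X Y = uno C Y \<cdot>\<^bsub>C\<^esub> bang C X"

text \<open>The generalized gradient \<open>\<R>[f]\<^sub>1\<close>.\<close>

definition gradient :: "('o, 'm, 'z) optdom_scheme \<Rightarrow> 'm \<Rightarrow> 'm" where
  "gradient C f = rev_d C f \<cdot>\<^bsub>C\<^esub> \<langle>ide C (dm C f), one_arr C (dm C f) (robj C)\<rangle>\<^bsub>C\<^esub>"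


section \<open>Decorated spans of linear maps\<close>

text \<open>
  Data of a lax monoidal functor \<open>F : Lin(C)\<^sup>o\<^sup>p \<rightarrow> Set\<close>: the sets \<open>F(X)\<close>, the maps
  \<open>F(\<phi>)\<close>, the comparison \<open>F(X) \<times> F(Y) \<rightarrow> F(X \<times> Y)\<close>, and the element of
  \<open>F(*)\<close> selected by the unit comparison.
\<close>

record ('o, 'm, 's) decoration =
  dob :: "'o \<Rightarrow> 's set"
  dar :: "'m \<Rightarrow> 's \<Rightarrow> 's"
  dprd :: "'o \<Rightarrow> 'o \<Rightarrow> 's \<Rightarrow> 's \<Rightarrow> 's"
  dunit :: "'s"

definition obj_decoration :: "('o, 'm, 'z) optdom_scheme \<Rightarrow> ('o, 'm, 'm) decoration" where
  "obj_decoration C =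
     \<lparr>dob = (\<lambda>X. Hom C X (robj C)),
      dar = (\<lambda>\<phi> f. f \<cdot>\<^bsub>C\<^esub> \<phi>),
      dprd = (\<lambda>X Y f g. f \<cdot>\<^bsub>C\<^esub> pr\<^sub>0 C X Y \<^bold>+\<^bsub>C\<^esub> g \<cdot>\<^bsub>C\<^esub> pr\<^sub>1 C X Y),
      dunit = nul C (trm C) (robj C)\<rparr>"

text \<open>The only element of \<open>D(*)\<close> is the identity of the terminal object.\<close>

definition dyn_decoration :: "('o, 'm, 'z) crdcat_scheme \<Rightarrow> ('o, 'm, 'm) decoration" where
  "dyn_decoration C =
     \<lparr>dob = (\<lambda>X. Hom C X X),
      dar = (\<lambda>\<phi> v. \<phi>\<^bold>\<dagger>\<^bsub>C\<^esub> \<cdot>\<^bsub>C\<^esub> v \<cdot>\<^bsub>C\<^esub> \<phi>),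
      dprd = (\<lambda>X Y v w.
        (pr\<^sub>0 C X Y)\<^bold>\<dagger>\<^bsub>C\<^esub> \<cdot>\<^bsub>C\<^esub> v \<cdot>\<^bsub>C\<^esub> pr\<^sub>0 C X Y \<^bold>+\<^bsub>C\<^esub>
        (pr\<^sub>1 C X Y)\<^bold>\<dagger>\<^bsub>C\<^esub> \<cdot>\<^bsub>C\<^esub> w \<cdot>\<^bsub>C\<^esub> pr\<^sub>1 C X Y),
      dunit = ide C (trm C)\<rparr>"

text \<open>A decorated span \<open>X \<leftarrow> N \<rightarrow> Y\<close> is stored as \<open>(l, r, s)\<close>; its apex is the common domain
  of \<open>l\<close> and \<open>r\<close>.\<close>

type_synonym ('m, 's) dspan = "'m \<times> 'm \<times> 's"

definition dspans :: "('o, 'm, 'z) crdcat_scheme \<Rightarrow> ('o, 'm, 's) decoration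
    \<Rightarrow> 'o \<Rightarrow> 'o \<Rightarrow> ('m, 's) dspan set" where
  "dspans C F X Y =
     {(l, r, s). \<exists>N. l \<in> Hom (Lin C) N X \<and> r \<in> Hom (Lin C) N Y \<and> s \<in> dob F N}"

definition dspan_iso :: "('o, 'm, 'z) crdcat_scheme \<Rightarrow> ('o, 'm, 's) decoration
    \<Rightarrow> ('m, 's) dspan rel" where
  "dspan_iso C F =
     {((l, r, s), (l', r', s')).
        (\<exists>X Y. (l, r, s) \<in> dspans C F X Y \<and> (l', r', s') \<in> dspans C F X Y) \<and>
        (\<exists>n \<in> Iso (Lin C) (dm C l) (dm C l').
           l' \<cdot>\<^bsub>C\<^esub> n = l \<and> r' \<cdot>\<^bsub>C\<^esub> n = r \<and> dar F n s' = s)}"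

definition dspan_class :: "('o, 'm, 'z) crdcat_scheme \<Rightarrow> ('o, 'm, 's) decoration
    \<Rightarrow> 'm \<Rightarrow> 'm \<Rightarrow> 's \<Rightarrow> ('m, 's) dspan set" where
  "dspan_class C F l r s = dspan_iso C F `` {(l, r, s)}"

definition ide_dec :: "('o, 'm, 'z) crdcat_scheme \<Rightarrow> ('o, 'm, 's) decoration \<Rightarrow> 'o \<Rightarrow> 's" where
  "ide_dec C F N = dar F (bang C N) (dunit F)"

definition plain_class :: "('o, 'm, 'z) crdcat_scheme \<Rightarrow> ('o, 'm, 's) decoration
    \<Rightarrow> 'm \<Rightarrow> 'm \<Rightarrow> ('m, 's) dspan set" where
  "plain_class C F l r = dspan_class C F l r (ide_dec C F (dm C l))"

text \<open>
  Operations on isomorphism classes are given on representatives and collected by unions,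
  as usual for quotients; composition also ranges over all choices of a pullback.
\<close>

definition dspan_cmp :: "('o, 'm, 'z) crdcat_scheme \<Rightarrow> ('o, 'm, 's) decoration
    \<Rightarrow> ('m, 's) dspan set \<Rightarrow> ('m, 's) dspan set \<Rightarrow> ('m, 's) dspan set" where
  "dspan_cmp C F T S =
     (\<Union>(l\<^sub>1, r\<^sub>1, s) \<in> S. \<Union>(l\<^sub>2, r\<^sub>2, t) \<in> T.
      \<Union>(b\<^sub>0, b\<^sub>1) \<in> {(b\<^sub>0, b\<^sub>1). is_pullback (Lin C) r\<^sub>1 l\<^sub>2 b\<^sub>0 b\<^sub>1}.
        dspan_class C F (l\<^sub>1 \<cdot>\<^bsub>C\<^esub> b\<^sub>0) (r\<^sub>2 \<cdot>\<^bsub>C\<^esub> b\<^sub>1)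
          (dar F \<langle>b\<^sub>0, b\<^sub>1\<rangle>\<^bsub>C\<^esub> (dprd F (dm C l\<^sub>1) (dm C l\<^sub>2) s t)))"

definition dspan_tensor :: "('o, 'm, 'z) crdcat_scheme \<Rightarrow> ('o, 'm, 's) decoration
    \<Rightarrow> ('m, 's) dspan set \<Rightarrow> ('m, 's) dspan set \<Rightarrow> ('m, 's) dspan set" where
  "dspan_tensor C F S T =
     (\<Union>(l\<^sub>1, r\<^sub>1, s) \<in> S. \<Union>(l\<^sub>2, r\<^sub>2, t) \<in> T.
        dspan_class C F (l\<^sub>1 \<diamondop>\<^bsub>C\<^esub> l\<^sub>2) (r\<^sub>1 \<diamondop>\<^bsub>C\<^esub> r\<^sub>2) (dprd F (dm C l\<^sub>1) (dm C l\<^sub>2) s t))"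

text \<open>
  The coherence arrows are the spans whose left leg is an identity and whose right leg is the
  corresponding coherence arrow of the cartesian product, with the identity decoration.
\<close>

definition dspan_hypcat :: "('o, 'm, 'z) crdcat_scheme \<Rightarrow> ('o, 'm, 's) decoration
    \<Rightarrow> ('o, ('m, 's) dspan set) hypcat" where
  "dspan_hypcat C F =
     \<lparr>ob = ob C,
      ar = (\<Union>X \<in> ob C. \<Union>Y \<in> ob C. dspans C F X Y // dspan_iso C F),
      dm = (\<lambda>S. THE X. \<exists>Y. S \<in> dspans C F X Y // dspan_iso C F),
      cd = (\<lambda>S. THE Y. \<exists>X. S \<in> dspans C F X Y // dspan_iso C F),
      ide = (\<lambda>X. plain_class C F (ide C X) (ide C X)),
      cmp = dspan_cmp C F,
      tob = prd C,
      tar = dspan_tensor C F,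
      unit = trm C,
      assoc = (\<lambda>X Y Z. plain_class C F (ide C ((X \<^bold>\<times>\<^bsub>C\<^esub> Y) \<^bold>\<times>\<^bsub>C\<^esub> Z))
        \<langle>pr\<^sub>0 C X Y \<cdot>\<^bsub>C\<^esub> pr\<^sub>0 C (X \<^bold>\<times>\<^bsub>C\<^esub> Y) Z,
         \<langle>pr\<^sub>1 C X Y \<cdot>\<^bsub>C\<^esub> pr\<^sub>0 C (X \<^bold>\<times>\<^bsub>C\<^esub> Y) Z, pr\<^sub>1 C (X \<^bold>\<times>\<^bsub>C\<^esub> Y) Z\<rangle>\<^bsub>C\<^esub>\<rangle>\<^bsub>C\<^esub>),
      lunit = (\<lambda>X. plain_class C F (ide C (trm C \<^bold>\<times>\<^bsub>C\<^esub> X)) (pr\<^sub>1 C (trm C) X)),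
      runit = (\<lambda>X. plain_class C F (ide C (X \<^bold>\<times>\<^bsub>C\<^esub> trm C)) (pr\<^sub>0 C X (trm C))),
      swap = (\<lambda>X Y. plain_class C F (ide C (X \<^bold>\<times>\<^bsub>C\<^esub> Y)) \<langle>pr\<^sub>1 C X Y, pr\<^sub>0 C X Y\<rangle>\<^bsub>C\<^esub>),
      mu = (\<lambda>X. plain_class C F \<langle>ide C X, ide C X\<rangle>\<^bsub>C\<^esub> (ide C X)),
      eta = (\<lambda>X. plain_class C F (bang C X) (ide C X)),
      delta = (\<lambda>X. plain_class C F (ide C X) \<langle>ide C X, ide C X\<rangle>\<^bsub>C\<^esub>),
      eps = (\<lambda>X. plain_class C F (ide C X) (bang C X))\<rparr>"

definition Opt :: "('o, 'm, 'z) optdom_scheme \<Rightarrow> ('o, ('m, 'm) dspan set) hypcat" where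
  "Opt C = dspan_hypcat C (obj_decoration C)"

definition Dynam :: "('o, 'm, 'z) crdcat_scheme \<Rightarrow> ('o, ('m, 'm) dspan set) hypcat" where
  "Dynam C = dspan_hypcat C (dyn_decoration C)"

definition open_objective ::
    "('o, 'm, 'z) optdom_scheme \<Rightarrow> 'm \<Rightarrow> 'm \<Rightarrow> 'm \<Rightarrow> ('m, 'm) dspan set" where
  "open_objective C l r f = dspan_class C (obj_decoration C) l r f"

definition open_dynamical_system ::
    "('o, 'm, 'z) crdcat_scheme \<Rightarrow> 'm \<Rightarrow> 'm \<Rightarrow> 'm \<Rightarrow> ('m, 'm) dspan set" where
  "open_dynamical_system C l r v = dspan_class C (dyn_decoration C) l r v"

end

theory Submission
  imports Defs
begin

text \<open>
  Both categories are built from a contravariant functor \<open>F\<close> on linear maps, and in both cases \<open>F\<close>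
  takes values in commutative monoids: reindexing of maps \<open>N \<rightarrow> R\<close> is additive by left additivity,
  and \<open>v \<mapsto> \<phi>\<^bold>\<dagger> \<cdot> v \<cdot> \<phi>\<close> is additive because \<open>\<phi>\<^bold>\<dagger>\<close> is linear. The comparison map of the lax
  structure is then \<open>(s, t) \<mapsto> F(\<pi>\<^sub>0) s + F(\<pi>\<^sub>1) t\<close>, so the composite of two decorated spans over a
  pullback \<open>b\<^sub>0, b\<^sub>1\<close> is decorated by \<open>F(b\<^sub>0) s + F(b\<^sub>1) t\<close>. The locale \<open>additive_decoration\<close>
  develops decorated spans at this level; \<open>cls_cmp\<close> and \<open>cls_tensor\<close> compute the two operations on
  isomorphism classes from any representatives, and associativity and interchange follow from the
  pasting of pullbacks (\<open>pullback_paste\<close>) and from their stability under products (\<open>pullback_prd\<close>).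

  Every structural arrow of the hypergraph category is the graph \<open>N = N \<rightarrow> Y\<close> or the cograph
  \<open>X \<leftarrow> N = N\<close> of a linear map, with zero decoration. Graphs are covariant, cographs contravariant,
  both respect products strictly, and they agree on mutually inverse isomorphisms (\<open>graph_iso\<close>).
  This turns the coherence, monoid and comonoid laws into equations between linear maps in a category
  with products. The laws that mix the two variances are cases of a Beck-Chevalley rule
  (\<open>cograph_cmp_graph\<close>): specialness says that a diagonal is monic, and the Frobenius law is the
  pullback square \<open>frobenius_pullback\<close>.

  A natural transformation \<open>\<alpha> : F \<Rightarrow> G\<close> of functors to commutative monoids preserves all of this, and
  \<open>(l, r, s) \<mapsto> (l, r, \<alpha> s)\<close> is a strict monoidal functor (locale \<open>additive_decoration_map\<close>). It
  remains to see that \<open>f \<mapsto> - \<R>[f]\<^sub>1\<close> is natural. For linear \<open>h\<close> the chain rule gives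
  \<open>\<R>[f \<cdot> h](a, 1) = \<R>[h](a, \<R>[f](h a, 1))\<close>, which is \<open>h\<^bold>\<dagger> (\<R>[f](h a, 1))\<close> because the reverse derivative
  of a linear map does not depend on the base point (\<open>R_lin_at\<close>). This independence
  comes from higher derivatives: by RD6, \<open>\<R>[f](a, b)\<close> can be recovered from \<open>\<R>[\<D>[f]]\<close> at
  \<open>((a, 0), b)\<close>, and \<open>\<D>[f] = f \<cdot> \<pi>\<^sub>1\<close> does not see \<open>a\<close>.
\<close>

section \<open>Equational reasoning in categories with products\<close>

text \<open>A premise \<open>f \<in> Hom C X Y\<close> whose indices do not occur in the conclusion blocks conditional
  rewriting. The axioms are therefore
  restated with the typing conditions spelled out by \<open>ar\<close>, \<open>dm\<close> and \<open>cd\<close>, and the resulting rules bring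
  composites of pairs and projections into a normal form: right-nested, with pairs outermost.\<close>

lemma Hom_iff: "f \<in> Hom C X Y \<longleftrightarrow> f \<in> ar C \<and> dm C f = X \<and> cd C f = Y"
  by (auto simp: Hom_def)

context category
begin

lemma cmp_typing:
  assumes "f \<in> ar C" "g \<in> ar C" "cd C f = dm C g"
  shows "g \<cdot> f \<in> ar C" "dm C (g \<cdot> f) = dm C f" "cd C (g \<cdot> f) = cd C g"
  using cmp_Hom[of f "dm C f" "cd C f" g "cd C g"] assms by (auto simp: Hom_iff)

lemma ide_typing:
  assumes "X \<in> ob C"
  shows "ide C X \<in> ar C" "dm C (ide C X) = X" "cd C (ide C X) = X"
  using ide_Hom[OF assms] by (auto simp: Hom_iff)

lemma ide_cmp: "f \<in> ar C \<Longrightarrow> X = cd C f \<Longrightarrow> ide C X \<cdot> f = f"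
  using ide_left by (auto simp: Hom_iff)

lemma cmp_ide: "f \<in> ar C \<Longrightarrow> X = dm C f \<Longrightarrow> f \<cdot> ide C X = f"
  using ide_right by (auto simp: Hom_iff)

lemma assoc_cmp:
  "\<lbrakk>f \<in> ar C; g \<in> ar C; h \<in> ar C; cd C f = dm C g; cd C g = dm C h\<rbrakk>
    \<Longrightarrow> (h \<cdot> g) \<cdot> f = h \<cdot> (g \<cdot> f)"
  using cmp_assoc by (auto simp: Hom_iff)

lemmas cat_simps = dm_ob cd_ob cmp_typing ide_typing ide_cmp cmp_ide assoc_cmp

lemma square_cmp:
  assumes "f \<cdot> b = g \<cdot> c" "f \<in> ar C" "b \<in> ar C" "g \<in> ar C" "c \<in> ar C" "h \<in> ar C"
    "cd C b = dm C f" "cd C c = dm C g" "cd C h = dm C b" "cd C h = dm C c"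
  shows "f \<cdot> (b \<cdot> h) = g \<cdot> (c \<cdot> h)"
  using assms assoc_cmp[of h b f] assoc_cmp[of h c g] by simp

lemma inverse_arrows_unique:
  assumes "inverse_arrows C X Y f g" "inverse_arrows C X Y f g'"
  shows "g = g'"
proof -
  have "g = (g' \<cdot> f) \<cdot> g"
    using assms by (auto simp: inverse_arrows_def Hom_iff cat_simps)
  also have "\<dots> = g' \<cdot> (f \<cdot> g)"
    using assms by (intro assoc_cmp) (auto simp: inverse_arrows_def Hom_iff)
  also have "\<dots> = g'"
    using assms by (auto simp: inverse_arrows_def Hom_iff cat_simps)
  finally show ?thesis .
qed

lemma inv_arr_eqI:
  assumes "inverse_arrows C X Y f g"
  shows "inv_arr C f = g"
proof -
  have "dm C f = X" "cd C f = Y"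
    using assms by (auto simp: inverse_arrows_def Hom_iff)
  then show ?thesis
    unfolding inv_arr_def using assms inverse_arrows_unique by blast
qed

end

context cartesian_category
begin

lemma bang_typing:
  assumes "X \<in> ob C"
  shows "bang C X \<in> ar C" "dm C (bang C X) = X" "cd C (bang C X) = trm C"
  using bang_Hom[OF assms] by (auto simp: Hom_iff)

lemma eq_bang: "f \<in> ar C \<Longrightarrow> cd C f = trm C \<Longrightarrow> f = bang C (dm C f)"
  using bang_unique by (auto simp: Hom_iff)

lemma bang_cmp: "f \<in> ar C \<Longrightarrow> cd C f = Y \<Longrightarrow> bang C Y \<cdot> f = bang C (dm C f)"
  using eq_bang[of "bang C Y \<cdot> f"] by (auto simp: cat_simps bang_typing)

lemma terminal_arrows_eq:
  "f \<in> ar C \<Longrightarrow> g \<in> ar C \<Longrightarrow> dm C f = dm C g \<Longrightarrow> cd C f = trm C \<Longrightarrow> cd C g = trm C \<Longrightarrow> f = g"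
  by (metis eq_bang)

lemma pr_typing:
  assumes "X \<in> ob C" "Y \<in> ob C"
  shows "pr\<^sub>0 C X Y \<in> ar C" "dm C (pr\<^sub>0 C X Y) = X \<^bold>\<times> Y" "cd C (pr\<^sub>0 C X Y) = X"
    and "pr\<^sub>1 C X Y \<in> ar C" "dm C (pr\<^sub>1 C X Y) = X \<^bold>\<times> Y" "cd C (pr\<^sub>1 C X Y) = Y"
  using pr0_Hom[OF assms] pr1_Hom[OF assms] by (auto simp: Hom_iff)

lemma pair_typing:
  assumes "f \<in> ar C" "g \<in> ar C" "dm C f = dm C g"
  shows "\<langle>f, g\<rangle> \<in> ar C" "dm C \<langle>f, g\<rangle> = dm C g" "cd C \<langle>f, g\<rangle> = cd C f \<^bold>\<times> cd C g"
  using pair_Hom[of f "dm C f" "cd C f" g "cd C g"] assms by (auto simp: Hom_iff)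

lemma pr_pair:
  assumes "f \<in> ar C" "g \<in> ar C" "dm C f = dm C g" "X = cd C f" "Y = cd C g"
  shows "pr\<^sub>0 C X Y \<cdot> \<langle>f, g\<rangle> = f" "pr\<^sub>1 C X Y \<cdot> \<langle>f, g\<rangle> = g"
  using pr0_pair[of f "dm C f" "cd C f" g "cd C g"] pr1_pair[of f "dm C f" "cd C f" g "cd C g"] assms
  by (auto simp: Hom_iff)

lemma pair_eta:
  assumes "h \<in> ar C" "cd C h = X \<^bold>\<times> Y" "X \<in> ob C" "Y \<in> ob C"
  shows "\<langle>pr\<^sub>0 C X Y \<cdot> h, pr\<^sub>1 C X Y \<cdot> h\<rangle> = h"
  using pair_unique[of X Y h "dm C h"] assms by (auto simp: Hom_iff)

lemma pair_pr: "X \<in> ob C \<Longrightarrow> Y \<in> ob C \<Longrightarrow> \<langle>pr\<^sub>0 C X Y, pr\<^sub>1 C X Y\<rangle> = ide C (X \<^bold>\<times> Y)"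
  using pair_eta[of "ide C (X \<^bold>\<times> Y)" X Y] by (simp add: cat_simps pr_typing prd_ob)

lemma prd_eqI:
  assumes "h \<in> ar C" "k \<in> ar C" "cd C h = X \<^bold>\<times> Y" "cd C k = X \<^bold>\<times> Y" "X \<in> ob C" "Y \<in> ob C"
    and "pr\<^sub>0 C X Y \<cdot> h = pr\<^sub>0 C X Y \<cdot> k" "pr\<^sub>1 C X Y \<cdot> h = pr\<^sub>1 C X Y \<cdot> k"
  shows "h = k"
  using pair_eta[of h X Y] pair_eta[of k X Y] assms by metis

lemma pair_cmp:
  assumes "f \<in> ar C" "g \<in> ar C" "h \<in> ar C" "dm C f = dm C g" "cd C h = dm C g"
  shows "\<langle>f, g\<rangle> \<cdot> h = \<langle>f \<cdot> h, g \<cdot> h\<rangle>"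
proof (rule prd_eqI[of _ _ "cd C f" "cd C g"])
  show "pr\<^sub>0 C (cd C f) (cd C g) \<cdot> \<langle>f, g\<rangle> \<cdot> h = pr\<^sub>0 C (cd C f) (cd C g) \<cdot> \<langle>f \<cdot> h, g \<cdot> h\<rangle>"
    using assms assoc_cmp[of h "\<langle>f, g\<rangle>" "pr\<^sub>0 C (cd C f) (cd C g)", symmetric]
    by (simp add: dm_ob cd_ob cmp_typing pair_typing pr_typing pr_pair)
  show "pr\<^sub>1 C (cd C f) (cd C g) \<cdot> \<langle>f, g\<rangle> \<cdot> h = pr\<^sub>1 C (cd C f) (cd C g) \<cdot> \<langle>f \<cdot> h, g \<cdot> h\<rangle>"
    using assms assoc_cmp[of h "\<langle>f, g\<rangle>" "pr\<^sub>1 C (cd C f) (cd C g)", symmetric]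
    by (simp add: dm_ob cd_ob cmp_typing pair_typing pr_typing pr_pair)
qed (use assms in \<open>simp_all add: cat_simps pair_typing\<close>)

lemma pair_eqD:
  assumes "\<langle>f, g\<rangle> = \<langle>f', g'\<rangle>" "f \<in> ar C" "g \<in> ar C" "f' \<in> ar C" "g' \<in> ar C" "dm C f = dm C g"
    "dm C f' = dm C g'" "cd C f = cd C f'" "cd C g = cd C g'"
  shows "f = f'" "g = g'"
  using assms pr_pair[of f g "cd C f" "cd C g"] pr_pair[of f' g' "cd C f" "cd C g"] by auto

lemmas prd_simps = cat_simps trm_ob prd_ob bang_typing bang_cmp pr_typing pair_typing pr_pair
  pair_eta pair_pr pair_cmp prd_arr_def

end

section \<open>Reverse derivatives on generalized elements\<close>

context left_additive_category
begin

lemma plus_typing: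
  assumes "f \<in> ar C" "g \<in> ar C" "dm C f = dm C g" "cd C f = cd C g"
  shows "f \<^bold>+ g \<in> ar C" "dm C (f \<^bold>+ g) = dm C g" "cd C (f \<^bold>+ g) = cd C g"
proof -
  interpret M: comm_monoid "\<lparr>carrier = Hom C (dm C f) (cd C f), mult = pls C, one = nul C (dm C f) (cd C f)\<rparr>"
    using assms by (intro comm_monoid_Hom) (auto simp: cat_simps)
  show "f \<^bold>+ g \<in> ar C" "dm C (f \<^bold>+ g) = dm C g" "cd C (f \<^bold>+ g) = cd C g"
    using M.m_closed[of f g] assms by (auto simp: Hom_iff)
qed

lemma nul_typing:
  assumes "X \<in> ob C" "Y \<in> ob C"
  shows "nul C X Y \<in> ar C" "dm C (nul C X Y) = X" "cd C (nul C X Y) = Y"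
proof -
  interpret M: comm_monoid "\<lparr>carrier = Hom C X Y, mult = pls C, one = nul C X Y\<rparr>"
    using assms by (intro comm_monoid_Hom)
  show "nul C X Y \<in> ar C" "dm C (nul C X Y) = X" "cd C (nul C X Y) = Y"
    using M.one_closed by (auto simp: Hom_iff)
qed

lemma plus_assoc:
  assumes "f \<in> ar C" "g \<in> ar C" "h \<in> ar C" "dm C f = dm C g" "cd C f = cd C g" "dm C h = dm C g" "cd C h = cd C g"
  shows "(f \<^bold>+ g) \<^bold>+ h = f \<^bold>+ (g \<^bold>+ h)"
proof -
  interpret M: comm_monoid "\<lparr>carrier = Hom C (dm C g) (cd C g), mult = pls C, one = nul C (dm C g) (cd C g)\<rparr>"
    using assms by (intro comm_monoid_Hom) (auto simp: cat_simps)
  show ?thesis using M.m_assoc[of f g h] assms by (auto simp: Hom_iff)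
qed

lemma plus_commute:
  assumes "f \<in> ar C" "g \<in> ar C" "dm C f = dm C g" "cd C f = cd C g"
  shows "f \<^bold>+ g = g \<^bold>+ f"
proof -
  interpret M: comm_monoid "\<lparr>carrier = Hom C (dm C g) (cd C g), mult = pls C, one = nul C (dm C g) (cd C g)\<rparr>"
    using assms by (intro comm_monoid_Hom) (auto simp: cat_simps)
  show ?thesis using M.m_comm[of f g] assms by (auto simp: Hom_iff)
qed

lemma plus_nul:
  assumes "f \<in> ar C" "X = dm C f" "Y = cd C f"
  shows "nul C X Y \<^bold>+ f = f" "f \<^bold>+ nul C X Y = f"
proof -
  interpret M: comm_monoid "\<lparr>carrier = Hom C (dm C f) (cd C f), mult = pls C, one = nul C (dm C f) (cd C f)\<rparr>"
    using assms by (intro comm_monoid_Hom) (auto simp: cat_simps)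
  show "nul C X Y \<^bold>+ f = f" "f \<^bold>+ nul C X Y = f"
    using M.l_one[of f] M.r_one[of f] assms by (auto simp: Hom_iff)
qed

lemma plus_cmp:
  assumes "f \<in> ar C" "g \<in> ar C" "h \<in> ar C" "dm C f = dm C g" "cd C f = cd C g" "cd C h = dm C g"
  shows "(f \<^bold>+ g) \<cdot> h = f \<cdot> h \<^bold>+ g \<cdot> h"
  using LA1_plus[of h "dm C h" "cd C h" f "cd C f" g] assms by (auto simp: Hom_iff)

lemma nul_cmp: "h \<in> ar C \<Longrightarrow> cd C h = Y \<Longrightarrow> Z \<in> ob C \<Longrightarrow> nul C Y Z \<cdot> h = nul C (dm C h) Z"
  using LA1_zero[of h "dm C h" "cd C h" Z] by (auto simp: Hom_iff)

lemma pr_plus: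
  assumes "f \<in> ar C" "g \<in> ar C" "dm C f = dm C g" "cd C f = Y \<^bold>\<times> Z" "cd C g = Y \<^bold>\<times> Z" "Y \<in> ob C" "Z \<in> ob C"
  shows "pr\<^sub>0 C Y Z \<cdot> (f \<^bold>+ g) = pr\<^sub>0 C Y Z \<cdot> f \<^bold>+ pr\<^sub>0 C Y Z \<cdot> g"
    "pr\<^sub>1 C Y Z \<cdot> (f \<^bold>+ g) = pr\<^sub>1 C Y Z \<cdot> f \<^bold>+ pr\<^sub>1 C Y Z \<cdot> g"
  using LA2_pr0_plus[of Y Z f "dm C f" g] LA2_pr1_plus[of Y Z f "dm C f" g] assms
  by (auto simp: Hom_iff)

lemma pair_plus:
  assumes "f \<in> ar C" "g \<in> ar C" "f' \<in> ar C" "g' \<in> ar C"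
    "dm C f = dm C g" "dm C f' = dm C g" "dm C g' = dm C g" "cd C f = cd C f'" "cd C g = cd C g'"
  shows "\<langle>f, g\<rangle> \<^bold>+ \<langle>f', g'\<rangle> = \<langle>f \<^bold>+ f', g \<^bold>+ g'\<rangle>"
  by (rule prd_eqI[of _ _ "cd C f'" "cd C g'"])
     (use assms in \<open>simp_all add: prd_simps plus_typing pr_plus\<close>)

lemmas add_simps = prd_simps plus_typing nul_typing plus_nul plus_cmp nul_cmp pr_plus pair_plus
  LA2_pr0_zero LA2_pr1_zero

end

context reverse_derivative_category
begin

lemma R_typing:
  assumes "f \<in> ar C"
  shows "\<R> f \<in> ar C" "dm C (\<R> f) = dm C f \<^bold>\<times> cd C f" "cd C (\<R> f) = dm C f"
  using R_Hom[of f "dm C f" "cd C f"] assms by (auto simp: Hom_iff)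

text \<open>As rewrite rules, the axioms of a reverse derivative are most effective when they describe the
  value of \<open>\<R> f\<close> at a generalized element \<open>\<langle>a, b\<rangle>\<close>; no composite with a bare product map is left then.\<close>

lemma R_cmp_at:
  assumes "f \<in> ar C" "g \<in> ar C" "cd C f = dm C g" "a \<in> ar C" "b \<in> ar C" "dm C a = dm C b"
    "cd C a = dm C f" "cd C b = cd C g"
  shows "\<R> (g \<cdot> f) \<cdot> \<langle>a, b\<rangle> = \<R> f \<cdot> \<langle>a, \<R> g \<cdot> \<langle>f \<cdot> a, b\<rangle>\<rangle>"
  using RD5[of f "dm C f" "cd C f" g "cd C g"] assms
  by (simp add: Hom_iff add_simps R_typing)

lemma R_pair_at:
  assumes "f \<in> ar C" "g \<in> ar C" "dm C f = dm C g" "a \<in> ar C" "b \<in> ar C" "dm C a = dm C b"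
    "cd C a = dm C f" "cd C b = cd C f \<^bold>\<times> cd C g"
  shows "\<R> \<langle>f, g\<rangle> \<cdot> \<langle>a, b\<rangle> =
    \<R> f \<cdot> \<langle>a, pr\<^sub>0 C (cd C f) (cd C g) \<cdot> b\<rangle> \<^bold>+ \<R> g \<cdot> \<langle>a, pr\<^sub>1 C (cd C f) (cd C g) \<cdot> b\<rangle>"
  using RD4_pair[of f "dm C f" "cd C f" g "cd C g"] assms
  by (simp add: Hom_iff add_simps R_typing)

lemma R_pr_at:
  assumes "X \<in> ob C" "Y \<in> ob C" "a \<in> ar C" "b \<in> ar C" "dm C a = dm C b" "cd C a = X \<^bold>\<times> Y"
  shows "cd C b = X \<Longrightarrow> \<R> (pr\<^sub>0 C X Y) \<cdot> \<langle>a, b\<rangle> = \<langle>b, nul C (dm C b) Y\<rangle>"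
    "cd C b = Y \<Longrightarrow> \<R> (pr\<^sub>1 C X Y) \<cdot> \<langle>a, b\<rangle> = \<langle>nul C (dm C b) X, b\<rangle>"
  using assms by (simp_all add: RD3_pr0 RD3_pr1 add_simps)

lemma R_ide_at:
  assumes "X \<in> ob C" "a \<in> ar C" "b \<in> ar C" "dm C a = dm C b" "cd C a = X" "cd C b = X"
  shows "\<R> (ide C X) \<cdot> \<langle>a, b\<rangle> = b"
  using assms by (simp_all add: RD3_ide add_simps)

lemma R_nul_at:
  assumes "X \<in> ob C" "Y \<in> ob C" "a \<in> ar C" "b \<in> ar C" "dm C a = dm C b" "cd C a = X" "cd C b = Y"
  shows "\<R> (nul C X Y) \<cdot> \<langle>a, b\<rangle> = nul C (dm C b) X"
  using assms by (simp_all add: RD1_zero add_simps)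

lemma R_at_nul:
  assumes "f \<in> ar C" "a \<in> ar C" "dm C a = Z" "cd C a = dm C f" "Y = cd C f"
  shows "\<R> f \<cdot> \<langle>a, nul C Z Y\<rangle> = nul C Z (dm C f)"
  using RD2_zero[of f "dm C f" "cd C f" a Z] assms by (simp add: Hom_iff)

lemma R_at_plus:
  assumes "f \<in> ar C" "a \<in> ar C" "b \<in> ar C" "c \<in> ar C" "dm C a = dm C b" "dm C b = dm C c"
    "cd C a = dm C f" "cd C b = cd C f" "cd C c = cd C f"
  shows "\<R> f \<cdot> \<langle>a, b \<^bold>+ c\<rangle> = \<R> f \<cdot> \<langle>a, b\<rangle> \<^bold>+ \<R> f \<cdot> \<langle>a, c\<rangle>"
  using RD2_plus[of f "dm C f" "cd C f" a "dm C a" b c] assms by (simp add: Hom_iff)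

lemma R_plus_at:
  assumes "f \<in> ar C" "g \<in> ar C" "dm C f = dm C g" "cd C f = cd C g" "a \<in> ar C" "b \<in> ar C" "dm C a = dm C b"
    "cd C a = dm C f" "cd C b = cd C f"
  shows "\<R> (f \<^bold>+ g) \<cdot> \<langle>a, b\<rangle> = \<R> f \<cdot> \<langle>a, b\<rangle> \<^bold>+ \<R> g \<cdot> \<langle>a, b\<rangle>"
  using RD1_plus[of f "dm C f" "cd C f" g] assms by (simp add: Hom_iff add_simps R_typing)

lemmas rd_simps = add_simps R_typing R_cmp_at R_pair_at R_pr_at R_ide_at R_nul_at R_at_nul
  R_at_plus R_plus_at

lemma D_typing:
  assumes "f \<in> ar C"
  shows "\<D> f \<in> ar C" "dm C (\<D> f) = dm C f \<^bold>\<times> dm C f" "cd C (\<D> f) = cd C f"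
  using assms by (simp_all add: fwd_d_def Let_def rd_simps)

lemma D_at:
  assumes "f \<in> ar C" "a \<in> ar C" "v \<in> ar C" "dm C a = dm C v" "cd C a = dm C f" "cd C v = dm C f"
  shows "\<D> f \<cdot> \<langle>a, v\<rangle> =
    pr\<^sub>1 C (dm C f) (cd C f) \<cdot> \<R> (\<R> f) \<cdot> \<langle>\<langle>a, nul C (dm C v) (cd C f)\<rangle>, v\<rangle>"
  using assms by (simp add: fwd_d_def Let_def rd_simps)

text \<open>The chain rule of the forward derivative comes from expanding nested reverse derivatives by RD5. In the expansion of
  \<open>\<R>[\<R>[g \<cdot> f]]\<close> every term that carries a first component is killed by the projection \<open>pr\<^sub>1\<close>, and the
  remaining one is \<open>\<D>[g]\<close> at \<open>f a\<close>, since \<open>\<R>[g]\<close> vanishes at a zero covector.\<close>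

lemma D_cmp_at:
  assumes "f \<in> ar C" "g \<in> ar C" "cd C f = dm C g" "a \<in> ar C" "v \<in> ar C" "dm C a = dm C v"
    "cd C a = dm C f" "cd C v = dm C f"
  shows "\<D> (g \<cdot> f) \<cdot> \<langle>a, v\<rangle> = \<D> g \<cdot> \<langle>f \<cdot> a, \<D> f \<cdot> \<langle>a, v\<rangle>\<rangle>"
proof -
  let ?X = "dm C f" and ?Y = "dm C g" and ?Z = "cd C g" and ?W = "dm C v"
  note t = assms cat_simps trm_ob prd_ob pr_typing pair_typing nul_typing plus_typing R_typing
  define p where "p = \<langle>a, nul C ?W ?Z\<rangle>"
  have p: "p \<in> ar C" "dm C p = ?W" "cd C p = ?X \<^bold>\<times> ?Z" "pr\<^sub>0 C ?X ?Z \<cdot> p = a"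
    "pr\<^sub>1 C ?X ?Z \<cdot> p = nul C ?W ?Z"
    using assms by (simp_all add: p_def t pr_pair)
  define m where "m = \<langle>f \<cdot> pr\<^sub>0 C ?X ?Z, pr\<^sub>1 C ?X ?Z\<rangle>"
  have m: "m \<in> ar C" "dm C m = ?X \<^bold>\<times> ?Z" "cd C m = ?Y \<^bold>\<times> ?Z" "m \<cdot> p = \<langle>f \<cdot> a, nul C ?W ?Z\<rangle>"
    using assms p by (simp_all add: m_def t pair_cmp)
  define k where "k = \<langle>pr\<^sub>0 C ?X ?Z, \<R> g \<cdot> m\<rangle>"
  have k: "k \<in> ar C" "dm C k = ?X \<^bold>\<times> ?Z" "cd C k = ?X \<^bold>\<times> ?Y" "k \<cdot> p = \<langle>a, nul C ?W ?Y\<rangle>"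
    using assms p m by (simp_all add: k_def t pair_cmp R_at_nul)
  have R: "\<R> (g \<cdot> f) = \<R> f \<cdot> k"
    using RD5[of f ?X ?Y g ?Z] assms m by (simp add: k_def Hom_iff t prd_arr_def pair_cmp pr_pair m_def)
  \<comment> \<open>\<open>pr\<^sub>1 \<cdot> y\<close> is \<open>\<D>[f](a, v)\<close>, and \<open>pr\<^sub>1 \<cdot> z\<close> is \<open>\<D>[g]\<close> in the direction \<open>pr\<^sub>1 \<cdot> y\<close>\<close>
  define y where "y = \<R> (\<R> f) \<cdot> \<langle>\<langle>a, nul C ?W ?Y\<rangle>, v\<rangle>"
  have y: "y \<in> ar C" "dm C y = ?W" "cd C y = ?X \<^bold>\<times> ?Y"
    using assms by (simp_all add: y_def t)
  define z where "z = \<R> (\<R> g) \<cdot> \<langle>\<langle>f \<cdot> a, nul C ?W ?Z\<rangle>, pr\<^sub>1 C ?X ?Y \<cdot> y\<rangle>"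
  have z: "z \<in> ar C" "dm C z = ?W" "cd C z = ?Y \<^bold>\<times> ?Z"
    using assms y by (simp_all add: z_def t)
  have "\<R> m \<cdot> \<langle>p, z\<rangle> = \<langle>\<R> f \<cdot> \<langle>a, pr\<^sub>0 C ?Y ?Z \<cdot> z\<rangle>, pr\<^sub>1 C ?Y ?Z \<cdot> z\<rangle>"
    using assms z p by (simp add: m_def R_pair_at R_cmp_at R_pr_at t pair_plus plus_nul)
  then have "pr\<^sub>1 C ?X ?Z \<cdot> \<R> k \<cdot> \<langle>p, y\<rangle> = pr\<^sub>1 C ?Y ?Z \<cdot> z"
    using assms m z y p by (simp add: k_def R_pair_at R_cmp_at R_pr_at t pair_plus plus_nul pr_pair flip: z_def)
  then have "pr\<^sub>1 C ?X ?Z \<cdot> \<R> (\<R> f \<cdot> k) \<cdot> \<langle>p, v\<rangle> = pr\<^sub>1 C ?Y ?Z \<cdot> z"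
    using assms k p by (simp add: R_cmp_at t flip: y_def)
  then show ?thesis
    using assms y by (simp add: D_at R t flip: p_def y_def z_def)
qed

lemma D_pair_at:
  assumes "f \<in> ar C" "g \<in> ar C" "dm C f = dm C g" "a \<in> ar C" "v \<in> ar C" "dm C a = dm C v"
    "cd C a = dm C f" "cd C v = dm C f"
  shows "\<D> \<langle>f, g\<rangle> \<cdot> \<langle>a, v\<rangle> = \<langle>\<D> f \<cdot> \<langle>a, v\<rangle>, \<D> g \<cdot> \<langle>a, v\<rangle>\<rangle>"
proof -
  let ?X = "dm C f" and ?Y = "cd C f" and ?Z = "cd C g"
  have R: "\<R> \<langle>f, g\<rangle> = \<R> f \<cdot> \<langle>pr\<^sub>0 C ?X (?Y \<^bold>\<times> ?Z), pr\<^sub>0 C ?Y ?Z \<cdot> pr\<^sub>1 C ?X (?Y \<^bold>\<times> ?Z)\<rangle>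
      \<^bold>+ \<R> g \<cdot> \<langle>pr\<^sub>0 C ?X (?Y \<^bold>\<times> ?Z), pr\<^sub>1 C ?Y ?Z \<cdot> pr\<^sub>1 C ?X (?Y \<^bold>\<times> ?Z)\<rangle>"
    using RD4_pair[of f ?X ?Y g ?Z] assms by (simp add: Hom_iff rd_simps)
  show ?thesis
    using assms by (simp add: D_at R rd_simps)
qed

lemma D_at_nul:
  assumes "f \<in> ar C" "a \<in> ar C" "dm C a = Z" "cd C a = dm C f" "X = dm C f"
  shows "\<D> f \<cdot> \<langle>a, nul C Z X\<rangle> = nul C Z (cd C f)"
  using assms dm_ob[of a] by (simp add: D_at rd_simps)

lemma D_at_plus:
  assumes "f \<in> ar C" "a \<in> ar C" "v \<in> ar C" "w \<in> ar C" "dm C a = dm C v" "dm C v = dm C w"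
    "cd C a = dm C f" "cd C v = dm C f" "cd C w = dm C f"
  shows "\<D> f \<cdot> \<langle>a, v \<^bold>+ w\<rangle> = \<D> f \<cdot> \<langle>a, v\<rangle> \<^bold>+ \<D> f \<cdot> \<langle>a, w\<rangle>"
  using assms dm_ob[of a] by (simp add: D_at rd_simps)

text \<open>RD6 evaluated at a generalized element: the derivative of \<open>\<R> f\<close> in a covector direction is \<open>\<R> f\<close>
  itself, as for any map that is linear in its second argument.\<close>

lemma D_R_at:
  assumes "f \<in> ar C" "a \<in> ar C" "b \<in> ar C" "c \<in> ar C" "dm C a = dm C b" "dm C c = dm C b"
    "cd C a = dm C f" "cd C b = cd C f" "cd C c = cd C f"
  shows "\<D> (\<R> f) \<cdot> \<langle>\<langle>a, b\<rangle>, \<langle>nul C (dm C c) (dm C f), c\<rangle>\<rangle> = \<R> f \<cdot> \<langle>a, c\<rangle>"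
proof -
  let ?p = "\<langle>a, \<langle>b, c\<rangle>\<rangle>" and ?X = "dm C f" and ?Y = "cd C f"
  have "(\<D> (\<R> f) \<cdot> \<langle>ide C ?X \<diamondop> pr\<^sub>0 C ?Y ?Y, nul C ?X ?X \<diamondop> pr\<^sub>1 C ?Y ?Y\<rangle>) \<cdot> ?p
      = (\<R> f \<cdot> (ide C ?X \<diamondop> pr\<^sub>1 C ?Y ?Y)) \<cdot> ?p"
    using RD6[of f ?X ?Y] assms by (simp add: Hom_iff)
  then show ?thesis
    using assms by (simp add: rd_simps D_typing)
qed

section \<open>Linear maps\<close>

text \<open>Linearity is tested on generalized elements; the generic one \<open>\<langle>pr\<^sub>0, pr\<^sub>1\<rangle>\<close> suffices.\<close>

lemma linear_iff_at:
  assumes "f \<in> ar C"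
  shows "linear C f \<longleftrightarrow> (\<forall>a v. a \<in> ar C \<longrightarrow> v \<in> ar C \<longrightarrow> dm C a = dm C v \<longrightarrow>
    cd C a = dm C f \<longrightarrow> cd C v = dm C f \<longrightarrow> \<D> f \<cdot> \<langle>a, v\<rangle> = f \<cdot> v)"
    (is "?lhs \<longleftrightarrow> ?rhs")
proof
  assume ?lhs
  then show ?rhs
    using assms by (simp add: linear_def prd_simps)
next
  assume r: ?rhs
  let ?X = "dm C f"
  have "\<D> f = \<D> f \<cdot> \<langle>pr\<^sub>0 C ?X ?X, pr\<^sub>1 C ?X ?X\<rangle>"
    using assms by (simp add: prd_simps D_typing)
  also have "\<dots> = f \<cdot> pr\<^sub>1 C ?X ?X"
    using r assms by (simp add: prd_simps del: pair_pr)
  finally show ?lhs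
    by (simp add: linear_def)
qed

definition lin_ar :: "'m \<Rightarrow> bool" where
  "lin_ar f \<longleftrightarrow> f \<in> ar C \<and> linear C f"

lemma lin_ar_imp_ar: "lin_ar f \<Longrightarrow> f \<in> ar C"
  by (simp add: lin_ar_def)

lemma D_lin_at:
  assumes "lin_ar f" "a \<in> ar C" "v \<in> ar C" "dm C a = dm C v" "cd C a = dm C f" "cd C v = dm C f"
  shows "\<D> f \<cdot> \<langle>a, v\<rangle> = f \<cdot> v"
  using assms linear_iff_at[of f] by (auto simp: lin_ar_def)

lemma lin_arI:
  assumes "f \<in> ar C"
    and "\<And>a v. \<lbrakk>a \<in> ar C; v \<in> ar C; dm C a = dm C v; cd C a = dm C f; cd C v = dm C f\<rbrakk>
      \<Longrightarrow> \<D> f \<cdot> \<langle>a, v\<rangle> = f \<cdot> v"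
  shows "lin_ar f"
  using assms linear_iff_at[of f] by (auto simp: lin_ar_def)

lemma lin_cmp:
  assumes "lin_ar f" "lin_ar g" "cd C f = dm C g"
  shows "lin_ar (g \<cdot> f)"
  using assms by (intro lin_arI) (simp_all add: cat_simps D_cmp_at D_lin_at lin_ar_imp_ar)

lemma lin_pair:
  assumes "lin_ar f" "lin_ar g" "dm C f = dm C g"
  shows "lin_ar \<langle>f, g\<rangle>"
  using assms by (intro lin_arI) (simp_all add: prd_simps D_pair_at D_lin_at lin_ar_imp_ar)

lemma lin_ide: "X \<in> ob C \<Longrightarrow> lin_ar (ide C X)"
  by (intro lin_arI) (simp_all add: D_at RD3_ide add_simps R_pr_at)

lemma lin_bang: "X \<in> ob C \<Longrightarrow> lin_ar (bang C X)"
  by (intro lin_arI terminal_arrows_eq[of "_ \<cdot> _" "bang C X \<cdot> _"])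
     (simp_all add: prd_simps D_typing)

lemma lin_nul: "X \<in> ob C \<Longrightarrow> Y \<in> ob C \<Longrightarrow> lin_ar (nul C X Y)"
  by (intro lin_arI) (simp_all add: D_at RD1_zero rd_simps)

lemma lin_pr:
  assumes "X \<in> ob C" "Y \<in> ob C"
  shows "lin_ar (pr\<^sub>0 C X Y)" "lin_ar (pr\<^sub>1 C X Y)"
  using assms by (auto intro!: lin_arI simp: D_at RD3_pr0 RD3_pr1 rd_simps)

lemma lin_prd_arr: "lin_ar f \<Longrightarrow> lin_ar g \<Longrightarrow> lin_ar (f \<diamondop> g)"
  by (simp add: prd_arr_def lin_pair lin_cmp lin_pr prd_simps lin_ar_imp_ar)

lemmas lin_simps = lin_cmp lin_pair lin_ide lin_bang lin_pr lin_nul lin_prd_arr lin_ar_imp_ar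

text \<open>A linear map is its own derivative at the base point \<open>0\<close>, and derivatives are additive in
  the direction.\<close>

lemma lin_plus:
  assumes "lin_ar f" "v \<in> ar C" "w \<in> ar C" "dm C v = dm C w" "cd C v = dm C f" "cd C w = dm C f"
  shows "f \<cdot> (v \<^bold>+ w) = f \<cdot> v \<^bold>+ f \<cdot> w"
  using assms D_at_plus[of f "nul C (dm C v) (dm C f)" v w]
  by (simp add: lin_ar_imp_ar D_lin_at plus_typing nul_typing cat_simps)

lemma lin_at_nul:
  assumes "lin_ar f" "X \<in> ob C" "Y = dm C f"
  shows "f \<cdot> nul C X Y = nul C X (cd C f)"
  using assms D_at_nul[of f "nul C X (dm C f)" X "dm C f"]
  by (simp add: lin_ar_imp_ar D_lin_at nul_typing cat_simps)

text \<open>\<open>\<R> f\<close> is a partial adjoint of \<open>\<D> f\<close>. The right-hand side appears as \<open>\<D>[\<R>[f]]((a, 0), (0, b))\<close> after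
  the definition of \<open>\<D> f\<close> is expanded by the chain rule, and RD6 evaluates it. The zero
  direction in the point \<open>(a, 0)\<close> is what turns the third reverse derivative into a forward derivative of \<open>\<R> f\<close>.\<close>

lemma R_D_at:
  assumes "f \<in> ar C" "a \<in> ar C" "b \<in> ar C" "dm C a = dm C b" "cd C a = dm C f" "cd C b = cd C f"
  shows "pr\<^sub>1 C (dm C f) (dm C f) \<cdot> \<R> (\<D> f) \<cdot> \<langle>\<langle>a, nul C (dm C b) (dm C f)\<rangle>, b\<rangle> = \<R> f \<cdot> \<langle>a, b\<rangle>"
proof -
  let ?X = "dm C f" and ?Y = "cd C f" and ?W = "dm C b"
  note t = assms cat_simps trm_ob prd_ob pr_typing pair_typing nul_typing plus_typing R_typing
  define p where "p = \<langle>a, nul C ?W ?X\<rangle>"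
  have p: "p \<in> ar C" "dm C p = ?W" "cd C p = ?X \<^bold>\<times> ?X"
    using assms by (simp_all add: p_def t)
  \<comment> \<open>\<open>i\<close> inserts the zero covector, so that \<open>\<D> f = pr\<^sub>1 \<cdot> \<R> (\<R> f) \<cdot> i\<close>\<close>
  define i where "i = \<langle>\<langle>pr\<^sub>0 C ?X ?X, nul C (?X \<^bold>\<times> ?X) ?Y\<rangle>, pr\<^sub>1 C ?X ?X\<rangle>"
  have i: "i \<in> ar C" "dm C i = ?X \<^bold>\<times> ?X" "cd C i = (?X \<^bold>\<times> ?Y) \<^bold>\<times> ?X"
    "i \<cdot> p = \<langle>\<langle>a, nul C ?W ?Y\<rangle>, nul C ?W ?X\<rangle>"
    using assms by (simp_all add: i_def p_def add_simps)
  have D: "\<D> f = pr\<^sub>1 C ?X ?Y \<cdot> \<R> (\<R> f) \<cdot> i"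
    using assms by (simp add: fwd_d_def Let_def i_def add_simps)
  define q where "q = \<langle>nul C ?W ?X, b\<rangle>"
  have q: "q \<in> ar C" "dm C q = ?W" "cd C q = ?X \<^bold>\<times> ?Y"
    using assms by (simp_all add: q_def t)
  define y where "y = \<R> (\<R> (\<R> f)) \<cdot> \<langle>\<langle>\<langle>a, nul C ?W ?Y\<rangle>, nul C ?W ?X\<rangle>, q\<rangle>"
  have y: "y \<in> ar C" "dm C y = ?W" "cd C y = (?X \<^bold>\<times> ?Y) \<^bold>\<times> ?X"
    using assms q by (simp_all add: y_def t)
  have "pr\<^sub>1 C ?X ?X \<cdot> \<R> i \<cdot> \<langle>p, y\<rangle> = pr\<^sub>1 C (?X \<^bold>\<times> ?Y) ?X \<cdot> y"
    using assms y p by (simp add: i_def rd_simps)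
  moreover have "pr\<^sub>1 C (?X \<^bold>\<times> ?Y) ?X \<cdot> y = \<R> f \<cdot> \<langle>a, b\<rangle>"
    using assms D_at[of "\<R> f" "\<langle>a, nul C ?W ?Y\<rangle>" q] D_R_at[of f a "nul C ?W ?Y" b]
    by (simp add: t y_def q_def)
  moreover have "\<R> (\<D> f) \<cdot> \<langle>p, b\<rangle> = \<R> i \<cdot> \<langle>p, y\<rangle>"
    unfolding D y_def using assms p i q by (simp add: t R_cmp_at R_pr_at flip: q_def)
  ultimately show ?thesis
    by (simp flip: p_def)
qed

text \<open>For linear \<open>f\<close>, the map \<open>\<D> f = f \<cdot> pr\<^sub>1\<close> ignores its base point, so the second component of its
  reverse derivative at \<open>((a, 0), b)\<close> is \<open>\<R>[f](0, b)\<close>. By the previous lemma it is also \<open>\<R>[f](a, b)\<close>.\<close>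

lemma R_lin_at:
  assumes "lin_ar f" "a \<in> ar C" "b \<in> ar C" "dm C a = dm C b" "cd C a = dm C f" "cd C b = cd C f"
  shows "\<R> f \<cdot> \<langle>a, b\<rangle> = f\<^bold>\<dagger> \<cdot> b"
proof -
  have f: "f \<in> ar C" "\<D> f = f \<cdot> pr\<^sub>1 C (dm C f) (dm C f)"
    using assms by (simp_all add: lin_ar_def linear_def)
  have "\<R> f \<cdot> \<langle>nul C (dm C b) (dm C f), b\<rangle> = \<R> f \<cdot> \<langle>a, b\<rangle>"
    using R_D_at[of f a b] assms f by (simp add: rd_simps)
  then show ?thesis
    using f assms by (simp add: dagger_def Let_def rd_simps)
qed

lemma dagger_typing:
  assumes "f \<in> ar C"
  shows "f\<^bold>\<dagger> \<in> ar C" "dm C (f\<^bold>\<dagger>) = cd C f" "cd C (f\<^bold>\<dagger>) = dm C f"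
  using assms by (simp_all add: dagger_def Let_def rd_simps)

text \<open>The dagger is \<open>\<R> f\<close> restricted to the base point \<open>0\<close>, and RD6 says that \<open>\<R> f\<close> is linear in the covector.\<close>

lemma dagger_lin:
  assumes "lin_ar f"
  shows "lin_ar (f\<^bold>\<dagger>)"
proof (rule lin_arI)
  fix a v
  assume v: "a \<in> ar C" "v \<in> ar C" "dm C a = dm C v" "cd C a = dm C (f\<^bold>\<dagger>)" "cd C v = dm C (f\<^bold>\<dagger>)"
  have f: "f \<in> ar C"
    using assms by (simp add: lin_ar_def)
  let ?i = "\<langle>nul C (cd C f) (dm C f), ide C (cd C f)\<rangle>"
  have a: "cd C a = cd C f" "cd C v = cd C f"
    using f v by (simp_all add: dagger_typing)
  have i: "lin_ar ?i"
    using f by (simp add: lin_simps cat_simps nul_typing)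
  have "f\<^bold>\<dagger> = \<R> f \<cdot> ?i"
    by (simp add: dagger_def Let_def)
  then have "\<D> (f\<^bold>\<dagger>) \<cdot> \<langle>a, v\<rangle> = \<D> (\<R> f \<cdot> ?i) \<cdot> \<langle>a, v\<rangle>"
    by (rule arg_cong)
  also have "\<dots> = \<D> (\<R> f) \<cdot> \<langle>?i \<cdot> a, \<D> ?i \<cdot> \<langle>a, v\<rangle>\<rangle>"
    by (rule D_cmp_at) (use f v(1-3) a in \<open>simp_all add: R_typing cat_simps pair_typing nul_typing\<close>)
  also have "\<D> ?i \<cdot> \<langle>a, v\<rangle> = ?i \<cdot> v"
    by (rule D_lin_at) (use i f v(1-3) a in \<open>simp_all add: cat_simps pair_typing nul_typing\<close>)
  also have "?i \<cdot> v = \<langle>nul C (dm C v) (dm C f), v\<rangle>"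
    using f v(2) a by (simp add: add_simps)
  also have "?i \<cdot> a = \<langle>nul C (dm C v) (dm C f), a\<rangle>"
    using f v(1-3) a by (simp add: add_simps)
  also have "\<D> (\<R> f) \<cdot> \<langle>\<langle>nul C (dm C v) (dm C f), a\<rangle>, \<langle>nul C (dm C v) (dm C f), v\<rangle>\<rangle> =
      \<R> f \<cdot> \<langle>nul C (dm C v) (dm C f), v\<rangle>"
    by (rule D_R_at) (use f v(1-3) a in \<open>simp_all add: cat_simps nul_typing\<close>)
  also have "\<dots> = f\<^bold>\<dagger> \<cdot> v"
    using f v assms by (simp add: R_lin_at add_simps dagger_typing)
  finally show "\<D> (f\<^bold>\<dagger>) \<cdot> \<langle>a, v\<rangle> = f\<^bold>\<dagger> \<cdot> v" .
qed (use assms in \<open>simp add: lin_ar_def dagger_typing\<close>)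

text \<open>This is RD5 at the base point \<open>0\<close>. The inner reverse derivative is taken at the base point \<open>f 0\<close>,
  which does not matter because \<open>g\<close> is linear.\<close>

lemma dagger_cmp:
  assumes "lin_ar f" "lin_ar g" "cd C f = dm C g"
  shows "(g \<cdot> f)\<^bold>\<dagger> = f\<^bold>\<dagger> \<cdot> g\<^bold>\<dagger>"
proof -
  have "\<R> (g \<cdot> f) \<cdot> \<langle>nul C (cd C g) (dm C f), ide C (cd C g)\<rangle> =
      \<R> f \<cdot> \<langle>nul C (cd C g) (dm C f), \<R> g \<cdot> \<langle>f \<cdot> nul C (cd C g) (dm C f), ide C (cd C g)\<rangle>\<rangle>"
    using assms by (intro R_cmp_at) (simp_all add: lin_ar_imp_ar cat_simps nul_typing)
  also have "\<dots> = f\<^bold>\<dagger> \<cdot> g\<^bold>\<dagger>"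
    using assms by (simp add: R_lin_at lin_ar_imp_ar nul_typing cat_simps dagger_typing)
  finally show ?thesis
    using assms by (simp add: dagger_def[of C "g \<cdot> f"] Let_def lin_ar_imp_ar cat_simps)
qed

lemma dagger_ide: "X \<in> ob C \<Longrightarrow> (ide C X)\<^bold>\<dagger> = ide C X"
  by (simp add: dagger_def Let_def RD3_ide add_simps)

section \<open>Pullbacks of linear maps\<close>

lemma Lin_sel: "ob (Lin C) = ob C" "ar (Lin C) = Collect lin_ar" "dm (Lin C) = dm C" "cd (Lin C) = cd C"
  "ide (Lin C) = ide C" "cmp (Lin C) = cmp C"
  by (auto simp: Lin_def lin_ar_def)

lemma Hom_Lin_iff: "f \<in> Hom (Lin C) X Y \<longleftrightarrow> lin_ar f \<and> dm C f = X \<and> cd C f = Y"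
  by (simp add: Hom_iff Lin_sel)

lemma category_Lin: "category (Lin C)"
  by unfold_locales (auto simp: Lin_sel Hom_Lin_iff lin_simps cat_simps)

lemma pullbackI:
  assumes "lin_ar f" "lin_ar g" "lin_ar b\<^sub>0" "lin_ar b\<^sub>1"
    and "cd C f = cd C g" "dm C b\<^sub>0 = dm C b\<^sub>1" "cd C b\<^sub>0 = dm C f" "cd C b\<^sub>1 = dm C g"
    and "f \<cdot> b\<^sub>0 = g \<cdot> b\<^sub>1"
    and "\<And>a\<^sub>0 a\<^sub>1. \<lbrakk>lin_ar a\<^sub>0; lin_ar a\<^sub>1; dm C a\<^sub>0 = dm C a\<^sub>1; cd C a\<^sub>0 = dm C f; cd C a\<^sub>1 = dm C g;
      f \<cdot> a\<^sub>0 = g \<cdot> a\<^sub>1\<rbrakk> \<Longrightarrow> \<exists>h. lin_ar h \<and> dm C h = dm C a\<^sub>1 \<and> cd C h = dm C b\<^sub>1 \<and> b\<^sub>0 \<cdot> h = a\<^sub>0 \<and> b\<^sub>1 \<cdot> h = a\<^sub>1"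
    and "\<And>h k. \<lbrakk>lin_ar h; lin_ar k; dm C h = dm C k; cd C h = dm C b\<^sub>1; cd C k = dm C b\<^sub>1;
      b\<^sub>0 \<cdot> h = b\<^sub>0 \<cdot> k; b\<^sub>1 \<cdot> h = b\<^sub>1 \<cdot> k\<rbrakk> \<Longrightarrow> h = k"
  shows "is_pullback (Lin C) f g b\<^sub>0 b\<^sub>1"
  unfolding is_pullback_def Hom_Lin_iff Lin_sel
proof (intro conjI exI[of _ "dm C b\<^sub>1"] allI impI)
  fix Q a\<^sub>0 a\<^sub>1
  assume a: "lin_ar a\<^sub>0 \<and> dm C a\<^sub>0 = Q \<and> cd C a\<^sub>0 = dm C f" "lin_ar a\<^sub>1 \<and> dm C a\<^sub>1 = Q \<and> cd C a\<^sub>1 = dm C g"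
    "f \<cdot> a\<^sub>0 = g \<cdot> a\<^sub>1"
  from assms(10)[of a\<^sub>0 a\<^sub>1] a obtain h
    where "lin_ar h" "dm C h = Q" "cd C h = dm C b\<^sub>1" "b\<^sub>0 \<cdot> h = a\<^sub>0" "b\<^sub>1 \<cdot> h = a\<^sub>1"
    by auto
  then show "\<exists>!h. (lin_ar h \<and> dm C h = Q \<and> cd C h = dm C b\<^sub>1) \<and> b\<^sub>0 \<cdot> h = a\<^sub>0 \<and> b\<^sub>1 \<cdot> h = a\<^sub>1"
    using assms(11) by (intro ex1I[of _ h]) auto
qed (use assms in auto)

lemma pullback_typing:
  assumes "is_pullback (Lin C) f g b\<^sub>0 b\<^sub>1"
  shows "lin_ar f" "lin_ar g" "lin_ar b\<^sub>0" "lin_ar b\<^sub>1" "cd C f = cd C g" "dm C b\<^sub>0 = dm C b\<^sub>1"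
    "cd C b\<^sub>0 = dm C f" "cd C b\<^sub>1 = dm C g" "f \<cdot> b\<^sub>0 = g \<cdot> b\<^sub>1"
  using assms by (auto simp: is_pullback_def Hom_Lin_iff Lin_sel)

lemma pullback_ex1:
  assumes "is_pullback (Lin C) f g b\<^sub>0 b\<^sub>1" "lin_ar a\<^sub>0" "lin_ar a\<^sub>1" "dm C a\<^sub>0 = dm C a\<^sub>1" "cd C a\<^sub>0 = dm C f"
    "cd C a\<^sub>1 = dm C g" "f \<cdot> a\<^sub>0 = g \<cdot> a\<^sub>1"
  shows "\<exists>!h. lin_ar h \<and> dm C h = dm C a\<^sub>1 \<and> cd C h = dm C b\<^sub>1 \<and> b\<^sub>0 \<cdot> h = a\<^sub>0 \<and> b\<^sub>1 \<cdot> h = a\<^sub>1"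
  using assms(1) unfolding is_pullback_def Hom_Lin_iff Lin_sel
proof (elim conjE exE)
  fix P
  assume "dm C b\<^sub>1 = P" and
    "\<forall>Q a\<^sub>0 a\<^sub>1. lin_ar a\<^sub>0 \<and> dm C a\<^sub>0 = Q \<and> cd C a\<^sub>0 = dm C f \<longrightarrow> lin_ar a\<^sub>1 \<and> dm C a\<^sub>1 = Q \<and> cd C a\<^sub>1 = dm C g \<longrightarrow>
      f \<cdot> a\<^sub>0 = g \<cdot> a\<^sub>1 \<longrightarrow> (\<exists>!h. (lin_ar h \<and> dm C h = Q \<and> cd C h = P) \<and> b\<^sub>0 \<cdot> h = a\<^sub>0 \<and> b\<^sub>1 \<cdot> h = a\<^sub>1)"
  from this(2)[rule_format, of a\<^sub>0 "dm C a\<^sub>1" a\<^sub>1] this(1) show ?thesis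
    using assms(2-) by simp
qed

lemma pullback_lift:
  assumes "is_pullback (Lin C) f g b\<^sub>0 b\<^sub>1" "lin_ar a\<^sub>0" "lin_ar a\<^sub>1" "dm C a\<^sub>0 = dm C a\<^sub>1" "cd C a\<^sub>0 = dm C f"
    "cd C a\<^sub>1 = dm C g" "f \<cdot> a\<^sub>0 = g \<cdot> a\<^sub>1"
  shows "\<exists>h. lin_ar h \<and> dm C h = dm C a\<^sub>1 \<and> cd C h = dm C b\<^sub>1 \<and> b\<^sub>0 \<cdot> h = a\<^sub>0 \<and> b\<^sub>1 \<cdot> h = a\<^sub>1"
  using pullback_ex1[OF assms] by blast

lemma pullback_eqI:
  assumes "is_pullback (Lin C) f g b\<^sub>0 b\<^sub>1" "lin_ar h" "lin_ar k" "dm C h = dm C k" "cd C h = dm C b\<^sub>1"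
    "cd C k = dm C b\<^sub>1" "b\<^sub>0 \<cdot> h = b\<^sub>0 \<cdot> k" "b\<^sub>1 \<cdot> h = b\<^sub>1 \<cdot> k"
  shows "h = k"
proof -
  note t = pullback_typing[OF assms(1)]
  have eq: "f \<cdot> (b\<^sub>0 \<cdot> k) = g \<cdot> (b\<^sub>1 \<cdot> k)"
    using t assms(3,6) by (intro square_cmp) (simp_all add: lin_ar_imp_ar)
  have "\<exists>!h. lin_ar h \<and> dm C h = dm C (b\<^sub>1 \<cdot> k) \<and> cd C h = dm C b\<^sub>1 \<and> b\<^sub>0 \<cdot> h = b\<^sub>0 \<cdot> k \<and> b\<^sub>1 \<cdot> h = b\<^sub>1 \<cdot> k"
    by (rule pullback_ex1[OF assms(1)]) (use t assms(3,6) eq in \<open>simp_all add: lin_simps cat_simps\<close>)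
  moreover have "dm C (b\<^sub>1 \<cdot> k) = dm C k"
    using t assms(3,6) by (simp add: lin_simps cat_simps)
  ultimately show ?thesis
    using assms by metis
qed

lemma pullback_sym:
  assumes "is_pullback (Lin C) f g b\<^sub>0 b\<^sub>1"
  shows "is_pullback (Lin C) g f b\<^sub>1 b\<^sub>0"
proof (rule pullbackI)
  fix a\<^sub>0 a\<^sub>1
  assume a: "lin_ar a\<^sub>0" "lin_ar a\<^sub>1" "dm C a\<^sub>0 = dm C a\<^sub>1" "cd C a\<^sub>0 = dm C g" "cd C a\<^sub>1 = dm C f" "g \<cdot> a\<^sub>0 = f \<cdot> a\<^sub>1"
  then obtain h where "lin_ar h" "dm C h = dm C a\<^sub>0" "cd C h = dm C b\<^sub>1" "b\<^sub>0 \<cdot> h = a\<^sub>1" "b\<^sub>1 \<cdot> h = a\<^sub>0"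
    using pullback_lift[OF assms, of a\<^sub>1 a\<^sub>0] by metis
  then show "\<exists>h. lin_ar h \<and> dm C h = dm C a\<^sub>1 \<and> cd C h = dm C b\<^sub>0 \<and> b\<^sub>1 \<cdot> h = a\<^sub>0 \<and> b\<^sub>0 \<cdot> h = a\<^sub>1"
    using pullback_typing[OF assms] a by auto
qed (use pullback_typing[OF assms] pullback_eqI[OF assms] in auto)

lemma pullback_paste:
  assumes p: "is_pullback (Lin C) f g b\<^sub>0 b\<^sub>1" and q: "is_pullback (Lin C) b\<^sub>1 h d\<^sub>0 d\<^sub>1"
  shows "is_pullback (Lin C) f (g \<cdot> h) (b\<^sub>0 \<cdot> d\<^sub>0) d\<^sub>1"
proof (rule pullbackI)
  have "cd C h = dm C g"
    using pullback_typing[OF p] pullback_typing[OF q] by metis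
  note t = this pullback_typing[OF p] pullback_typing(1-4,6-9)[OF q]
  note ts = lin_simps cat_simps
  show "f \<cdot> b\<^sub>0 \<cdot> d\<^sub>0 = (g \<cdot> h) \<cdot> d\<^sub>1"
    using t square_cmp[of f b\<^sub>0 g b\<^sub>1 d\<^sub>0] by (simp add: ts)
  {
    fix a\<^sub>0 a\<^sub>1
    assume a: "lin_ar a\<^sub>0" "lin_ar a\<^sub>1" "dm C a\<^sub>0 = dm C a\<^sub>1" "cd C a\<^sub>0 = dm C f" "cd C a\<^sub>1 = dm C (g \<cdot> h)"
      "f \<cdot> a\<^sub>0 = (g \<cdot> h) \<cdot> a\<^sub>1"
    then have a1: "cd C a\<^sub>1 = dm C h"
      using t by (simp add: ts)
    have "\<exists>k. lin_ar k \<and> dm C k = dm C (h \<cdot> a\<^sub>1) \<and> cd C k = dm C b\<^sub>1 \<and> b\<^sub>0 \<cdot> k = a\<^sub>0 \<and> b\<^sub>1 \<cdot> k = h \<cdot> a\<^sub>1"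
      by (rule pullback_lift[OF p]) (use a a1 t in \<open>simp_all add: ts\<close>)
    then obtain k where k: "lin_ar k" "dm C k = dm C a\<^sub>1" "cd C k = dm C b\<^sub>1" "b\<^sub>0 \<cdot> k = a\<^sub>0" "b\<^sub>1 \<cdot> k = h \<cdot> a\<^sub>1"
      using a1 a t by (auto simp: ts)
    have "\<exists>m. lin_ar m \<and> dm C m = dm C a\<^sub>1 \<and> cd C m = dm C d\<^sub>1 \<and> d\<^sub>0 \<cdot> m = k \<and> d\<^sub>1 \<cdot> m = a\<^sub>1"
      by (rule pullback_lift[OF q]) (use a a1 t k in \<open>simp_all add: ts\<close>)
    then obtain m where m: "lin_ar m" "dm C m = dm C a\<^sub>1" "cd C m = dm C d\<^sub>1" "d\<^sub>0 \<cdot> m = k" "d\<^sub>1 \<cdot> m = a\<^sub>1"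
      by blast
    then show "\<exists>m. lin_ar m \<and> dm C m = dm C a\<^sub>1 \<and> cd C m = dm C d\<^sub>1 \<and> (b\<^sub>0 \<cdot> d\<^sub>0) \<cdot> m = a\<^sub>0 \<and> d\<^sub>1 \<cdot> m = a\<^sub>1"
      using k t by (intro exI[of _ m]) (simp add: ts)
  }
  {
    fix m k
    assume a: "lin_ar m" "lin_ar k" "dm C m = dm C k" "cd C m = dm C d\<^sub>1" "cd C k = dm C d\<^sub>1"
      "(b\<^sub>0 \<cdot> d\<^sub>0) \<cdot> m = (b\<^sub>0 \<cdot> d\<^sub>0) \<cdot> k" "d\<^sub>1 \<cdot> m = d\<^sub>1 \<cdot> k"
    have "b\<^sub>1 \<cdot> d\<^sub>0 \<cdot> m = h \<cdot> d\<^sub>1 \<cdot> m" "b\<^sub>1 \<cdot> d\<^sub>0 \<cdot> k = h \<cdot> d\<^sub>1 \<cdot> k"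
      using t a square_cmp[of b\<^sub>1 d\<^sub>0 h d\<^sub>1 m] square_cmp[of b\<^sub>1 d\<^sub>0 h d\<^sub>1 k] by (simp_all add: ts)
    then have e1: "b\<^sub>1 \<cdot> d\<^sub>0 \<cdot> m = b\<^sub>1 \<cdot> d\<^sub>0 \<cdot> k"
      using a(7) by simp
    have e0: "b\<^sub>0 \<cdot> d\<^sub>0 \<cdot> m = b\<^sub>0 \<cdot> d\<^sub>0 \<cdot> k"
      using a t by (simp add: ts)
    have "d\<^sub>0 \<cdot> m = d\<^sub>0 \<cdot> k"
      by (rule pullback_eqI[OF p _ _ _ _ _ e0 e1]) (use a(1-5) t in \<open>simp_all add: ts\<close>)
    then show "m = k"
      by (rule pullback_eqI[OF q a(1-5) _ a(7)])
  }
  show "lin_ar (g \<cdot> h)" "lin_ar (b\<^sub>0 \<cdot> d\<^sub>0)" "cd C f = cd C (g \<cdot> h)" "dm C (b\<^sub>0 \<cdot> d\<^sub>0) = dm C d\<^sub>1"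
    "cd C (b\<^sub>0 \<cdot> d\<^sub>0) = dm C f" "cd C d\<^sub>1 = dm C (g \<cdot> h)"
    using t by (simp_all add: ts)
qed (use pullback_typing[OF p] pullback_typing[OF q] in \<open>simp_all add: lin_simps cat_simps\<close>)

lemma pullback_paste':
  assumes p: "is_pullback (Lin C) f g b\<^sub>0 b\<^sub>1" and q: "is_pullback (Lin C) h b\<^sub>0 d\<^sub>0 d\<^sub>1"
  shows "is_pullback (Lin C) (f \<cdot> h) g d\<^sub>0 (b\<^sub>1 \<cdot> d\<^sub>1)"
  using pullback_paste[OF pullback_sym[OF p] pullback_sym[OF q]] by (rule pullback_sym)

lemma pullback_ide:
  assumes "lin_ar f" "Y = cd C f"
  shows "is_pullback (Lin C) f (ide C Y) (ide C (dm C f)) f"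
  using assms by (intro pullbackI) (auto simp: lin_simps cat_simps)

text \<open>The product of two pullback squares is a pullback square because both conditions of the universal
  property can be checked one component at a time. This is what makes composition of spans
  compatible with their tensor product.\<close>

lemma pullback_prd:
  assumes p: "is_pullback (Lin C) f g b\<^sub>0 b\<^sub>1" and p': "is_pullback (Lin C) f' g' b\<^sub>0' b\<^sub>1'"
  shows "is_pullback (Lin C) (f \<diamondop> f') (g \<diamondop> g') (b\<^sub>0 \<diamondop> b\<^sub>0') (b\<^sub>1 \<diamondop> b\<^sub>1')"
proof (rule pullbackI)
  note t = pullback_typing[OF p] pullback_typing[OF p']
  note ts = lin_simps prd_simps
  let ?P = "dm C b\<^sub>1" and ?P' = "dm C b\<^sub>1'"
  have eq: "f \<cdot> b\<^sub>0 \<cdot> h = g \<cdot> b\<^sub>1 \<cdot> h" if "h \<in> ar C" "cd C h = dm C b\<^sub>1" for h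
    using t that square_cmp[of f b\<^sub>0 g b\<^sub>1 h] by (simp add: lin_ar_imp_ar)
  have eq': "f' \<cdot> b\<^sub>0' \<cdot> h = g' \<cdot> b\<^sub>1' \<cdot> h" if "h \<in> ar C" "cd C h = dm C b\<^sub>1'" for h
    using t that square_cmp[of f' b\<^sub>0' g' b\<^sub>1' h] by (simp add: lin_ar_imp_ar)
  show "(f \<diamondop> f') \<cdot> (b\<^sub>0 \<diamondop> b\<^sub>0') = (g \<diamondop> g') \<cdot> (b\<^sub>1 \<diamondop> b\<^sub>1')"
    using t by (simp add: ts eq eq')
  {
    fix a\<^sub>0 a\<^sub>1
    assume a: "lin_ar a\<^sub>0" "lin_ar a\<^sub>1" "dm C a\<^sub>0 = dm C a\<^sub>1" "cd C a\<^sub>0 = dm C (f \<diamondop> f')" "cd C a\<^sub>1 = dm C (g \<diamondop> g')"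
      "(f \<diamondop> f') \<cdot> a\<^sub>0 = (g \<diamondop> g') \<cdot> a\<^sub>1"
    have c: "cd C a\<^sub>0 = dm C f \<^bold>\<times> dm C f'" "cd C a\<^sub>1 = dm C g \<^bold>\<times> dm C g'"
      using a t by (simp_all add: ts)
    define W where "W = dm C a\<^sub>1"
    define x x' y y' where xy: "x = pr\<^sub>0 C (dm C f) (dm C f') \<cdot> a\<^sub>0" "x' = pr\<^sub>1 C (dm C f) (dm C f') \<cdot> a\<^sub>0"
      "y = pr\<^sub>0 C (dm C g) (dm C g') \<cdot> a\<^sub>1" "y' = pr\<^sub>1 C (dm C g) (dm C g') \<cdot> a\<^sub>1"
    have txy: "lin_ar x" "lin_ar x'" "lin_ar y" "lin_ar y'" "dm C x = W" "dm C x' = W"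
      "dm C y = W" "dm C y' = W" "cd C x = dm C f" "cd C x' = dm C f'" "cd C y = dm C g"
      "cd C y' = dm C g'"
      using a(1-3) c t by (simp_all add: ts xy W_def)
    have a': "a\<^sub>0 = \<langle>x, x'\<rangle>" "a\<^sub>1 = \<langle>y, y'\<rangle>"
      using a(1-3) c t by (simp_all add: ts xy W_def)
    have e: "\<langle>f \<cdot> x, f' \<cdot> x'\<rangle> = \<langle>g \<cdot> y, g' \<cdot> y'\<rangle>"
      using a(6) a' txy t by (simp add: ts)
    have "f \<cdot> x = g \<cdot> y" "f' \<cdot> x' = g' \<cdot> y'"
      by (rule pair_eqD[OF e]; use txy t in \<open>simp add: ts\<close>)+
    then obtain h h' where h: "lin_ar h" "dm C h = dm C y" "cd C h = ?P" "b\<^sub>0 \<cdot> h = x" "b\<^sub>1 \<cdot> h = y"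
      and h': "lin_ar h'" "dm C h' = dm C y'" "cd C h' = ?P'" "b\<^sub>0' \<cdot> h' = x'" "b\<^sub>1' \<cdot> h' = y'"
      using pullback_lift[OF p, of x y] pullback_lift[OF p', of x' y'] txy by metis
    then show "\<exists>h. lin_ar h \<and> dm C h = dm C a\<^sub>1 \<and> cd C h = dm C (b\<^sub>1 \<diamondop> b\<^sub>1') \<and> (b\<^sub>0 \<diamondop> b\<^sub>0') \<cdot> h = a\<^sub>0 \<and> (b\<^sub>1 \<diamondop> b\<^sub>1') \<cdot> h = a\<^sub>1"
      unfolding W_def[symmetric] a' using txy t by (intro exI[of _ "\<langle>h, h'\<rangle>"]) (simp add: ts)
  }
  {
    fix h k
    assume a: "lin_ar h" "lin_ar k" "dm C h = dm C k" "cd C h = dm C (b\<^sub>1 \<diamondop> b\<^sub>1')" "cd C k = dm C (b\<^sub>1 \<diamondop> b\<^sub>1')"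
      "(b\<^sub>0 \<diamondop> b\<^sub>0') \<cdot> h = (b\<^sub>0 \<diamondop> b\<^sub>0') \<cdot> k" "(b\<^sub>1 \<diamondop> b\<^sub>1') \<cdot> h = (b\<^sub>1 \<diamondop> b\<^sub>1') \<cdot> k"
    have c: "cd C h = ?P \<^bold>\<times> ?P'" "cd C k = ?P \<^bold>\<times> ?P'"
      using a t by (simp_all add: ts)
    define W where "W = dm C k"
    define x x' y y' where xy: "x = pr\<^sub>0 C ?P ?P' \<cdot> h" "x' = pr\<^sub>1 C ?P ?P' \<cdot> h"
      "y = pr\<^sub>0 C ?P ?P' \<cdot> k" "y' = pr\<^sub>1 C ?P ?P' \<cdot> k"
    have txy: "lin_ar x" "lin_ar x'" "lin_ar y" "lin_ar y'" "dm C x = W" "dm C x' = W"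
      "dm C y = W" "dm C y' = W" "cd C x = ?P" "cd C x' = ?P'" "cd C y = ?P"
      "cd C y' = ?P'"
      using a(1-3) c t by (simp_all add: ts xy W_def)
    have a': "h = \<langle>x, x'\<rangle>" "k = \<langle>y, y'\<rangle>"
      using a(1-3) c t by (simp_all add: ts xy W_def)
    have e: "\<langle>b\<^sub>0 \<cdot> x, b\<^sub>0' \<cdot> x'\<rangle> = \<langle>b\<^sub>0 \<cdot> y, b\<^sub>0' \<cdot> y'\<rangle>" "\<langle>b\<^sub>1 \<cdot> x, b\<^sub>1' \<cdot> x'\<rangle> = \<langle>b\<^sub>1 \<cdot> y, b\<^sub>1' \<cdot> y'\<rangle>"
      using a(6,7) a' txy t by (simp_all add: ts)
    have "b\<^sub>0 \<cdot> x = b\<^sub>0 \<cdot> y" "b\<^sub>0' \<cdot> x' = b\<^sub>0' \<cdot> y'"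
      by (rule pair_eqD[OF e(1)]; use txy t in \<open>simp add: ts\<close>)+
    moreover have "b\<^sub>1 \<cdot> x = b\<^sub>1 \<cdot> y" "b\<^sub>1' \<cdot> x' = b\<^sub>1' \<cdot> y'"
      by (rule pair_eqD[OF e(2)]; use txy t in \<open>simp add: ts\<close>)+
    ultimately show "h = k"
      using pullback_eqI[OF p, of x y] pullback_eqI[OF p', of x' y'] txy a' by simp
  }
qed (use pullback_typing[OF p] pullback_typing[OF p'] in \<open>simp_all add: lin_simps prd_simps\<close>)

lemma Iso_Lin_iff: "n \<in> Iso (Lin C) X Y \<longleftrightarrow> lin_ar n \<and> dm C n = X \<and> cd C n = Y \<and>
    (\<exists>m. lin_ar m \<and> dm C m = Y \<and> cd C m = X \<and> m \<cdot> n = ide C X \<and> n \<cdot> m = ide C Y)"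
  by (auto simp: Iso_def inverse_arrows_def Hom_Lin_iff Lin_sel)

text \<open>Two pullbacks of one cospan are isomorphic; this is why the composite of two spans does not depend
  on the chosen pullback.\<close>

lemma pullback_unique:
  assumes p: "is_pullback (Lin C) f g b\<^sub>0 b\<^sub>1" and q: "is_pullback (Lin C) f g c\<^sub>0 c\<^sub>1"
  obtains n where "n \<in> Iso (Lin C) (dm C b\<^sub>1) (dm C c\<^sub>1)" "c\<^sub>0 \<cdot> n = b\<^sub>0" "c\<^sub>1 \<cdot> n = b\<^sub>1"
proof -
  note t = pullback_typing[OF p] pullback_typing[OF q]
  note ts = lin_simps cat_simps
  obtain n where n: "lin_ar n" "dm C n = dm C b\<^sub>1" "cd C n = dm C c\<^sub>1" "c\<^sub>0 \<cdot> n = b\<^sub>0" "c\<^sub>1 \<cdot> n = b\<^sub>1"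
    using pullback_lift[OF q, of b\<^sub>0 b\<^sub>1] t by blast
  obtain m where m: "lin_ar m" "dm C m = dm C c\<^sub>1" "cd C m = dm C b\<^sub>1" "b\<^sub>0 \<cdot> m = c\<^sub>0" "b\<^sub>1 \<cdot> m = c\<^sub>1"
    using pullback_lift[OF p, of c\<^sub>0 c\<^sub>1] t by blast
  have "m \<cdot> n = ide C (dm C b\<^sub>1)"
  proof (rule pullback_eqI[OF p])
    show "b\<^sub>0 \<cdot> m \<cdot> n = b\<^sub>0 \<cdot> ide C (dm C b\<^sub>1)" "b\<^sub>1 \<cdot> m \<cdot> n = b\<^sub>1 \<cdot> ide C (dm C b\<^sub>1)"
      using assoc_cmp[of n m b\<^sub>0] assoc_cmp[of n m b\<^sub>1] n m t by (simp_all add: lin_ar_imp_ar cmp_ide)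
  qed (use n m t in \<open>simp_all add: ts\<close>)
  moreover have "n \<cdot> m = ide C (dm C c\<^sub>1)"
  proof (rule pullback_eqI[OF q])
    show "c\<^sub>0 \<cdot> n \<cdot> m = c\<^sub>0 \<cdot> ide C (dm C c\<^sub>1)" "c\<^sub>1 \<cdot> n \<cdot> m = c\<^sub>1 \<cdot> ide C (dm C c\<^sub>1)"
      using assoc_cmp[of m n c\<^sub>0] assoc_cmp[of m n c\<^sub>1] n m t by (simp_all add: lin_ar_imp_ar cmp_ide)
  qed (use n m t in \<open>simp_all add: ts\<close>)
  ultimately show thesis
    using n m by (intro that[of n]) (auto simp: Iso_Lin_iff)
qed

lemma pullback_iso:
  assumes "lin_ar f" "lin_ar n" "lin_ar m" "cd C f = cd C n" "dm C m = cd C n" "cd C m = dm C n"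
    "m \<cdot> n = ide C (dm C n)" "n \<cdot> m = ide C (cd C n)"
  shows "is_pullback (Lin C) f n (ide C (dm C f)) (m \<cdot> f)"
proof (rule pullbackI)
  show "f \<cdot> ide C (dm C f) = n \<cdot> m \<cdot> f"
    using assms assoc_cmp[of f m n] by (simp add: lin_simps cmp_ide ide_cmp)
  fix a\<^sub>0 a\<^sub>1
  assume a: "lin_ar a\<^sub>0" "lin_ar a\<^sub>1" "dm C a\<^sub>0 = dm C a\<^sub>1" "cd C a\<^sub>0 = dm C f" "cd C a\<^sub>1 = dm C n" "f \<cdot> a\<^sub>0 = n \<cdot> a\<^sub>1"
  then have "m \<cdot> f \<cdot> a\<^sub>0 = a\<^sub>1"
    using assms assoc_cmp[of a\<^sub>1 n m] by (simp add: lin_ar_imp_ar ide_cmp)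
  then show "\<exists>h. lin_ar h \<and> dm C h = dm C a\<^sub>1 \<and> cd C h = dm C (m \<cdot> f) \<and> ide C (dm C f) \<cdot> h = a\<^sub>0 \<and> (m \<cdot> f) \<cdot> h = a\<^sub>1"
    using a assms by (intro exI[of _ a\<^sub>0]) (simp add: lin_simps cat_simps)
qed (use assms in \<open>simp_all add: lin_simps cat_simps\<close>)

text \<open>A cospan is a diagram on the category \<open>0 \<rightarrow> 2 \<leftarrow> 1\<close>, whose two non-identity arrows are the
  numbers \<open>3\<close> and \<open>4\<close>; the identities are \<open>0\<close>, \<open>1\<close> and \<open>2\<close>.\<close>

lemma pullback_exists:
  assumes lim: "has_finite_limits (Lin C)" and fg: "lin_ar f" "lin_ar g" "cd C f = cd C g"
  shows "\<exists>b\<^sub>0 b\<^sub>1. is_pullback (Lin C) f g b\<^sub>0 b\<^sub>1"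
proof -
  define J :: "(nat, nat) cat" where
    "J = \<lparr>ob = {0, 1, 2}, ar = {0, 1, 2, 3, 4}, dm = (\<lambda>u. if u = 3 then 0 else if u = 4 then 1 else u),
          cd = (\<lambda>u. if u = 3 \<or> u = 4 then 2 else u), ide = (\<lambda>x. x),
          cmp = (\<lambda>v u. if u < 3 then v else u)\<rparr>"
  define Do where "Do j = (if j = 0 then dm C f else if j = 1 then dm C g else cd C g)" for j :: nat
  define Da where "Da u = (if u = 3 then f else if u = 4 then g else ide C (Do u))" for u :: nat
  interpret J: category J
    by unfold_locales (auto simp: J_def Hom_def)
  have "category_functor J (Lin C) Do Da"
    by (intro category_functor.intro J.category_axioms category_Lin category_functor_axioms.intro)
       (use fg in \<open>auto simp: J_def Hom_iff Lin_sel Do_def Da_def lin_simps cat_simps\<close>)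
  moreover have "finite (ob J)" "finite (ar J)"
    by (simp_all add: J_def)
  ultimately obtain L p where "limit_cone J (Lin C) Do Da L p"
    using lim unfolding has_finite_limits_def by blast
  then have cone: "cone J (Lin C) Do Da L p" and
    lift: "\<And>M q. cone J (Lin C) Do Da M q \<Longrightarrow> \<exists>!h. h \<in> Hom (Lin C) M L \<and> (\<forall>j\<in>ob J. p j \<cdot> h = q j)"
    unfolding limit_cone_def Lin_sel by auto
  have coneI: "cone J (Lin C) Do Da (dm C a\<^sub>1) (\<lambda>j. if j = 0 then a\<^sub>0 else if j = 1 then a\<^sub>1 else f \<cdot> a\<^sub>0)"
    if "lin_ar a\<^sub>0" "lin_ar a\<^sub>1" "dm C a\<^sub>0 = dm C a\<^sub>1" "cd C a\<^sub>0 = dm C f" "cd C a\<^sub>1 = dm C g" "f \<cdot> a\<^sub>0 = g \<cdot> a\<^sub>1"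
    for a\<^sub>0 a\<^sub>1
    using that fg by (auto simp: cone_def J_def Hom_Lin_iff Lin_sel Do_def Da_def lin_simps cat_simps)
  have p: "lin_ar (p 0)" "lin_ar (p 1)" "dm C (p 0) = L" "dm C (p 1) = L" "cd C (p 0) = dm C f"
    "cd C (p 1) = dm C g" "f \<cdot> p 0 = p 2" "g \<cdot> p 1 = p 2"
    using cone by (auto simp: cone_def J_def Hom_Lin_iff Lin_sel Do_def Da_def split: if_splits)
  have "is_pullback (Lin C) f g (p 0) (p 1)"
  proof (rule pullbackI)
    fix a\<^sub>0 a\<^sub>1
    assume a: "lin_ar a\<^sub>0" "lin_ar a\<^sub>1" "dm C a\<^sub>0 = dm C a\<^sub>1" "cd C a\<^sub>0 = dm C f" "cd C a\<^sub>1 = dm C g" "f \<cdot> a\<^sub>0 = g \<cdot> a\<^sub>1"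
    obtain h where "h \<in> Hom (Lin C) (dm C a\<^sub>1) L"
      "\<forall>j\<in>ob J. p j \<cdot> h = (if j = 0 then a\<^sub>0 else if j = 1 then a\<^sub>1 else f \<cdot> a\<^sub>0)"
      using lift[OF coneI[OF a]] by blast
    then show "\<exists>h. lin_ar h \<and> dm C h = dm C a\<^sub>1 \<and> cd C h = dm C (p 1) \<and> p 0 \<cdot> h = a\<^sub>0 \<and> p 1 \<cdot> h = a\<^sub>1"
      using p by (auto simp: Hom_Lin_iff J_def)
  next
    fix h k
    assume a: "lin_ar h" "lin_ar k" "dm C h = dm C k" "cd C h = dm C (p 1)" "cd C k = dm C (p 1)"
      "p 0 \<cdot> h = p 0 \<cdot> k" "p 1 \<cdot> h = p 1 \<cdot> k"
    have e: "p 2 \<cdot> h = f \<cdot> p 0 \<cdot> h" "p 2 \<cdot> k = f \<cdot> p 0 \<cdot> k" "f \<cdot> p 0 \<cdot> k = g \<cdot> p 1 \<cdot> k"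
      using a p fg assoc_cmp[of h "p 0" f] assoc_cmp[of k "p 0" f] assoc_cmp[of k "p 1" g]
      by (simp_all add: lin_ar_imp_ar)
    let ?q = "\<lambda>j::nat. if j = 0 then p 0 \<cdot> h else if j = 1 then p 1 \<cdot> h else f \<cdot> p 0 \<cdot> h"
    have "cone J (Lin C) Do Da (dm C (p 1 \<cdot> h)) ?q"
      using a p fg e by (intro coneI) (simp_all add: lin_simps cat_simps)
    from lift[OF this] show "h = k"
      using a p fg e by (auto simp: J_def Hom_Lin_iff cat_simps lin_ar_imp_ar)
  qed (use p fg in auto)
  then show ?thesis by blast
qed

end

section \<open>Spans decorated by a functor to commutative monoids\<close>

lemma UN_triple_I: "(a, b, c) \<in> A \<Longrightarrow> x \<in> f a b c \<Longrightarrow> x \<in> (\<Union>(a, b, c) \<in> A. f a b c)"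
  by force

text \<open>
  The functor is written additively: \<open>\<uplus>\<close> and \<open>zero X\<close> are the monoid structure of \<open>F(X)\<close>. The
  last two assumptions express the comparison maps of the lax structure by this monoid structure; their
  naturality and coherence then follow from functoriality and additivity of \<open>dar F\<close>.
\<close>

locale additive_decoration = reverse_derivative_category C
  for C :: "('o, 'm, 'z) crdcat_scheme" (structure) +
  fixes F :: "('o, 'm, 's) decoration"
    and add :: "'s \<Rightarrow> 's \<Rightarrow> 's"  (infixl \<open>\<uplus>\<close> 65)
    and zero :: "'o \<Rightarrow> 's"
  assumes has_pullbacks: "\<lbrakk>lin_ar f; lin_ar g; cd C f = cd C g\<rbrakk> \<Longrightarrow> \<exists>b\<^sub>0 b\<^sub>1. is_pullback (Lin C) f g b\<^sub>0 b\<^sub>1"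
    and zero_in: "X \<in> ob C \<Longrightarrow> zero X \<in> dob F X"
    and add_in: "\<lbrakk>s \<in> dob F X; t \<in> dob F X\<rbrakk> \<Longrightarrow> s \<uplus> t \<in> dob F X"
    and add_assoc: "\<lbrakk>s \<in> dob F X; t \<in> dob F X; u \<in> dob F X\<rbrakk> \<Longrightarrow> (s \<uplus> t) \<uplus> u = s \<uplus> (t \<uplus> u)"
    and add_commute: "\<lbrakk>s \<in> dob F X; t \<in> dob F X\<rbrakk> \<Longrightarrow> s \<uplus> t = t \<uplus> s"
    and add_zero: "s \<in> dob F X \<Longrightarrow> s \<uplus> zero X = s"
    and dar_in: "\<lbrakk>lin_ar f; s \<in> dob F (cd C f); X = dm C f\<rbrakk> \<Longrightarrow> dar F f s \<in> dob F X"
    and dar_ide: "\<lbrakk>X \<in> ob C; s \<in> dob F X\<rbrakk> \<Longrightarrow> dar F (ide C X) s = s"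
    and dar_cmp: "\<lbrakk>lin_ar f; lin_ar g; cd C f = dm C g; s \<in> dob F (cd C g)\<rbrakk>
      \<Longrightarrow> dar F f (dar F g s) = dar F (g \<cdot> f) s"
    and dar_add: "\<lbrakk>lin_ar f; s \<in> dob F (cd C f); t \<in> dob F (cd C f)\<rbrakk>
      \<Longrightarrow> dar F f (s \<uplus> t) = dar F f s \<uplus> dar F f t"
    and dar_zero: "\<lbrakk>lin_ar f; X = cd C f\<rbrakk> \<Longrightarrow> dar F f (zero X) = zero (dm C f)"
    and dprd_eq: "\<lbrakk>X \<in> ob C; Y \<in> ob C; s \<in> dob F X; t \<in> dob F Y\<rbrakk>
      \<Longrightarrow> dprd F X Y s t = dar F (pr\<^sub>0 C X Y) s \<uplus> dar F (pr\<^sub>1 C X Y) t"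
    and dunit_eq: "dunit F = zero (trm C)"
begin

lemma zero_add: "s \<in> dob F X \<Longrightarrow> X \<in> ob C \<Longrightarrow> zero X \<uplus> s = s"
  using add_commute[of "zero X" X s] by (simp add: add_zero zero_in)

lemma add_interchange:
  assumes "s \<in> dob F X" "t \<in> dob F X" "u \<in> dob F X" "v \<in> dob F X"
  shows "(s \<uplus> t) \<uplus> (u \<uplus> v) = (s \<uplus> u) \<uplus> (t \<uplus> v)"
proof -
  have "(s \<uplus> t) \<uplus> (u \<uplus> v) = s \<uplus> ((t \<uplus> u) \<uplus> v)"
    using assms by (simp add: add_assoc[of _ X] add_in)
  also have "\<dots> = s \<uplus> ((u \<uplus> t) \<uplus> v)"
    using assms by (simp add: add_commute[of t X u])
  also have "\<dots> = (s \<uplus> u) \<uplus> (t \<uplus> v)"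
    using assms by (simp add: add_assoc[of _ X] add_in)
  finally show ?thesis .
qed

lemmas dec_simps = lin_simps prd_simps zero_in add_in add_zero zero_add dar_in dar_ide dar_cmp dar_add
  dar_zero

definition span :: "'m \<Rightarrow> 'm \<Rightarrow> 's \<Rightarrow> bool" where
  "span l r s \<longleftrightarrow> lin_ar l \<and> lin_ar r \<and> dm C l = dm C r \<and> s \<in> dob F (dm C r)"

abbreviation cls :: "'m \<Rightarrow> 'm \<Rightarrow> 's \<Rightarrow> ('m, 's) dspan set" where
  "cls \<equiv> dspan_class C F"

lemma dspans_iff: "(l, r, s) \<in> dspans C F X Y \<longleftrightarrow> span l r s \<and> cd C l = X \<and> cd C r = Y"
  by (auto simp: dspans_def Hom_Lin_iff span_def)

text \<open>An isomorphism of decorated spans together with its inverse; keeping both maps explicit makes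
  symmetry and transitivity a matter of rewriting.\<close>

definition span_iso :: "'m \<Rightarrow> 'm \<Rightarrow> 'm \<Rightarrow> 'm \<Rightarrow> 's \<Rightarrow> 'm \<Rightarrow> 'm \<Rightarrow> 's \<Rightarrow> bool" where
  "span_iso n m l r s l' r' s' \<longleftrightarrow> lin_ar n \<and> lin_ar m \<and> dm C n = dm C r \<and> cd C n = dm C r' \<and>
     dm C m = dm C r' \<and> cd C m = dm C r \<and> m \<cdot> n = ide C (dm C r) \<and> n \<cdot> m = ide C (dm C r') \<and>
     l' \<cdot> n = l \<and> r' \<cdot> n = r \<and> dar F n s' = s"

lemma span_iso_sym:
  assumes "span l' r' s'" "span_iso n m l r s l' r' s'"
  shows "span_iso m n l' r' s' l r s"
proof -
  have t: "lin_ar l'" "lin_ar r'" "dm C l' = dm C r'" "s' \<in> dob F (dm C r')"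
    "lin_ar n" "lin_ar m" "dm C n = dm C r" "cd C n = dm C r'"
    "dm C m = dm C r'" "cd C m = dm C r"  "n \<cdot> m = ide C (dm C r')"
    and e: "l = l' \<cdot> n" "r = r' \<cdot> n" "s = dar F n s'" and "m \<cdot> n = ide C (dm C r)"
    using assms by (auto simp: span_def span_iso_def)
  moreover from t have "(l' \<cdot> n) \<cdot> m = l'" "(r' \<cdot> n) \<cdot> m = r'"
    by (simp_all add: dec_simps)
  moreover from t have "dar F m (dar F n s') = s'"
    by (simp add: dec_simps)
  ultimately show ?thesis
    by (simp add: span_iso_def)
qed

lemma dspan_iso_iff:
  "((l, r, s), (l', r', s')) \<in> dspan_iso C F \<longleftrightarrow>
    span l r s \<and> span l' r' s' \<and> (\<exists>n m. span_iso n m l r s l' r' s')"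
  (is "?lhs \<longleftrightarrow> ?rhs")
proof
  assume ?lhs
  then obtain n where sp: "span l r s" "span l' r' s'" and n: "n \<in> Iso (Lin C) (dm C l) (dm C l')"
    "l' \<cdot> n = l" "r' \<cdot> n = r" "dar F n s' = s"
    by (auto simp: dspan_iso_def dspans_iff)
  then obtain m where "span_iso n m l r s l' r' s'"
    by (auto simp: Iso_Lin_iff span_def span_iso_def)
  with sp show ?rhs
    by blast
next
  assume r: ?rhs
  then obtain n m where nm: "span_iso n m l r s l' r' s'"
    by blast
  have "cd C l = cd C l'" "cd C r = cd C r'"
    using r nm unfolding span_def span_iso_def by (metis cmp_typing(3) lin_ar_imp_ar)+
  moreover have "\<exists>n\<in>Iso (Lin C) (dm C l) (dm C l'). l' \<cdot> n = l \<and> r' \<cdot> n = r \<and> dar F n s' = s"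
    using r nm unfolding span_def span_iso_def by (intro bexI[of _ n]) (auto simp: Iso_Lin_iff)
  ultimately show ?lhs
    using r by (simp add: dspan_iso_def dspans_iff)
qed

lemma dspan_iso_trans: "trans (dspan_iso C F)"
proof (rule transI, clarify)
  fix l r s l' r' s' l'' r'' s''
  assume "((l, r, s), (l', r', s')) \<in> dspan_iso C F" "((l', r', s'), (l'', r'', s'')) \<in> dspan_iso C F"
  then obtain n m n' m' where sp: "span l r s" "span l' r' s'" "span l'' r'' s''"
    and "span_iso n m l r s l' r' s'" "span_iso n' m' l' r' s' l'' r'' s''"
    unfolding dspan_iso_iff by blast
  then have t: "lin_ar n" "lin_ar m" "dm C n = dm C r" "cd C n = dm C r'"
     "dm C m = dm C r'" "cd C m = dm C r" "lin_ar n'" "lin_ar m'" "dm C n' = dm C r'" "cd C n' = dm C r''"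
     "dm C m' = dm C r''" "cd C m' = dm C r'"
     "lin_ar l''" "lin_ar r''" "dm C l'' = dm C r''" "s'' \<in> dob F (dm C r'')" "lin_ar r'" "lin_ar r"
    and i: "m \<cdot> n = ide C (dm C r)" "n \<cdot> m = ide C (dm C r')"
     "m' \<cdot> n' = ide C (dm C r')" "n' \<cdot> m' = ide C (dm C r'')"
    and e: "l = l' \<cdot> n" "r = r' \<cdot> n" "s = dar F n s'" "l' = l'' \<cdot> n'" "r' = r'' \<cdot> n'" "s' = dar F n' s''"
    by (simp_all add: span_def span_iso_def)
  have "m \<cdot> (m' \<cdot> n') \<cdot> n = ide C (dm C r)" "n' \<cdot> (n \<cdot> m) \<cdot> m' = ide C (dm C r'')"
    using t i by (simp_all add: dec_simps)
  then have "(m \<cdot> m') \<cdot> (n' \<cdot> n) = ide C (dm C r)" "(n' \<cdot> n) \<cdot> (m \<cdot> m') = ide C (dm C r'')"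
    using t by (simp_all add: dec_simps)
  moreover have "l'' \<cdot> n' \<cdot> n = l" "r'' \<cdot> n' \<cdot> n = r"
    using e t assoc_cmp[of n n' l''] assoc_cmp[of n n' r''] by (simp_all add: lin_ar_imp_ar)
  moreover have "dar F (n' \<cdot> n) s'' = s"
    using e t dar_cmp[of n n' s''] by simp
  moreover have "lin_ar (n' \<cdot> n)" "lin_ar (m \<cdot> m')" "dm C (n' \<cdot> n) = dm C r" "cd C (n' \<cdot> n) = dm C r''"
     "dm C (m \<cdot> m') = dm C r''" "cd C (m \<cdot> m') = dm C r"
    using t by (simp_all add: dec_simps)
  ultimately have "span_iso (n' \<cdot> n) (m \<cdot> m') l r s l'' r'' s''"
    by (simp add: span_iso_def)
  with sp show "((l, r, s), (l'', r'', s'')) \<in> dspan_iso C F"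
    unfolding dspan_iso_iff by blast
qed

lemma dspan_iso_sym: "sym (dspan_iso C F)"
proof (rule symI, clarify)
  fix l r s l' r' s'
  assume "((l, r, s), (l', r', s')) \<in> dspan_iso C F"
  then show "((l', r', s'), (l, r, s)) \<in> dspan_iso C F"
    unfolding dspan_iso_iff using span_iso_sym by blast
qed

lemma dspan_iso_refl:
  assumes "span l r s"
  shows "((l, r, s), (l, r, s)) \<in> dspan_iso C F"
proof -
  have "span_iso (ide C (dm C r)) (ide C (dm C r)) l r s l r s"
    using assms by (simp add: span_iso_def span_def dec_simps)
  with assms show ?thesis
    unfolding dspan_iso_iff by blast
qed

lemma mem_cls_iff: "(l', r', s') \<in> cls l r s \<longleftrightarrow> ((l, r, s), (l', r', s')) \<in> dspan_iso C F"
  by (simp add: dspan_class_def)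

lemma self_mem_cls: "span l r s \<Longrightarrow> (l, r, s) \<in> cls l r s"
  by (simp add: mem_cls_iff dspan_iso_refl)

lemma mem_cls_cases:
  assumes "x \<in> cls l r s"
  obtains l' r' s' n m where "x = (l', r', s')" "span l r s" "span l' r' s'" "span_iso n m l r s l' r' s'"
proof -
  obtain l' r' s' where x: "x = (l', r', s')"
    by (cases x)
  with assms obtain n m where "span l r s" "span l' r' s'" "span_iso n m l r s l' r' s'"
    by (auto simp: mem_cls_iff dspan_iso_iff)
  with x that show thesis by blast
qed

lemma cls_eqI:
  assumes "span l r s" "span l' r' s'" "span_iso n m l r s l' r' s'"
  shows "cls l r s = cls l' r' s'"
proof -
  have "((l, r, s), (l', r', s')) \<in> dspan_iso C F"
    unfolding dspan_iso_iff using assms by blast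
  then show ?thesis
    unfolding dspan_class_def using dspan_iso_sym dspan_iso_trans
    by (auto dest: symD transD)
qed

lemma cls_eq_feet:
  assumes "span l r s" "span l' r' s'" "cls l r s = cls l' r' s'"
  shows "cd C l = cd C l'" "cd C r = cd C r'"
proof -
  have "(l', r', s') \<in> cls l r s"
    using assms by (simp add: self_mem_cls)
  then show "cd C l = cd C l'" "cd C r = cd C r'"
    by (auto simp: mem_cls_iff dspan_iso_def dspans_iff)
qed

text \<open>The comparison map of \<open>F\<close>, reindexed along a pair, is a sum. Through this rule the decoration on a
  product apex disappears from the computation of composites.\<close>

lemma dar_pair_dprd:
  assumes "lin_ar f" "lin_ar g" "dm C f = dm C g" "s \<in> dob F (cd C f)" "t \<in> dob F (cd C g)"
    "X = cd C f" "Y = cd C g"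
  shows "dar F \<langle>f, g\<rangle> (dprd F X Y s t) = dar F f s \<uplus> dar F g t"
  using assms by (simp add: dprd_eq dec_simps)

text \<open>The pullback of an arbitrary map along an isomorphism is given by the inverse, so that replacing the
  two apexes by isomorphic ones amounts to pasting two such squares on.\<close>

lemma pullback_change_iso:
  assumes p: "is_pullback (Lin C) f g c\<^sub>0 c\<^sub>1"
    and n: "lin_ar n" "lin_ar n'" "cd C n = dm C f" "dm C n' = dm C f" "cd C n' = dm C n"
      "n' \<cdot> n = ide C (dm C n)" "n \<cdot> n' = ide C (dm C f)"
    and m: "lin_ar m" "lin_ar m'" "cd C m = dm C g" "dm C m' = dm C g" "cd C m' = dm C m"
      "m' \<cdot> m = ide C (dm C m)" "m \<cdot> m' = ide C (dm C g)"
  shows "is_pullback (Lin C) (f \<cdot> n) (g \<cdot> m) (n' \<cdot> c\<^sub>0) (m' \<cdot> c\<^sub>1)"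
proof -
  note t = pullback_typing[OF p]
  have "is_pullback (Lin C) c\<^sub>0 n (ide C (dm C c\<^sub>0)) (n' \<cdot> c\<^sub>0)"
    using n t by (intro pullback_iso) simp_all
  from pullback_paste'[OF p pullback_sym[OF this]]
  have p': "is_pullback (Lin C) (f \<cdot> n) g (n' \<cdot> c\<^sub>0) c\<^sub>1"
    using t by (simp add: dec_simps)
  have "is_pullback (Lin C) c\<^sub>1 m (ide C (dm C c\<^sub>1)) (m' \<cdot> c\<^sub>1)"
    using m t by (intro pullback_iso) simp_all
  from pullback_paste[OF p' this] show ?thesis
    using t n by (simp add: dec_simps)
qed

text \<open>All choices in the composition (two representatives and a pullback) lead to isomorphic spans: a pullback
  for one choice of representatives is transported along the isomorphisms of apexes to one for the other
  choice, and pullbacks are unique. The union that collects the results is therefore a union of equal sets.\<close>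

lemma cls_cmp:
  assumes S: "span l\<^sub>1 r\<^sub>1 s" and T: "span l\<^sub>2 r\<^sub>2 t" and p: "is_pullback (Lin C) r\<^sub>1 l\<^sub>2 b\<^sub>0 b\<^sub>1"
  shows "dspan_cmp C F (cls l\<^sub>2 r\<^sub>2 t) (cls l\<^sub>1 r\<^sub>1 s) = cls (l\<^sub>1 \<cdot> b\<^sub>0) (r\<^sub>2 \<cdot> b\<^sub>1) (dar F b\<^sub>0 s \<uplus> dar F b\<^sub>1 t)"
    (is "_ = ?K")
proof -
  note tp = pullback_typing[OF p]
  have *: "cls (l\<^sub>1' \<cdot> c\<^sub>0) (r\<^sub>2' \<cdot> c\<^sub>1) (dar F \<langle>c\<^sub>0, c\<^sub>1\<rangle> (dprd F (dm C l\<^sub>1') (dm C l\<^sub>2') s' t')) = ?K"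
    if S': "(l\<^sub>1', r\<^sub>1', s') \<in> cls l\<^sub>1 r\<^sub>1 s" and T': "(l\<^sub>2', r\<^sub>2', t') \<in> cls l\<^sub>2 r\<^sub>2 t"
      and q: "is_pullback (Lin C) r\<^sub>1' l\<^sub>2' c\<^sub>0 c\<^sub>1" for l\<^sub>1' r\<^sub>1' s' l\<^sub>2' r\<^sub>2' t' c\<^sub>0 c\<^sub>1
  proof -
    note tq = pullback_typing[OF q]
    obtain n n' where sS': "span l\<^sub>1' r\<^sub>1' s'" and "span_iso n n' l\<^sub>1 r\<^sub>1 s l\<^sub>1' r\<^sub>1' s'"
      using S' by (auto elim: mem_cls_cases)
    then have n: "lin_ar n" "lin_ar n'" "dm C n = dm C r\<^sub>1" "cd C n = dm C r\<^sub>1'" "dm C n' = dm C r\<^sub>1'"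
      "cd C n' = dm C r\<^sub>1" "n' \<cdot> n = ide C (dm C r\<^sub>1)" "n \<cdot> n' = ide C (dm C r\<^sub>1')"
      and nr: "r\<^sub>1' \<cdot> n = r\<^sub>1" and nl: "l\<^sub>1' \<cdot> n = l\<^sub>1" and ns: "dar F n s' = s"
      by (simp_all add: span_iso_def)
    obtain m m' where sT': "span l\<^sub>2' r\<^sub>2' t'" and "span_iso m m' l\<^sub>2 r\<^sub>2 t l\<^sub>2' r\<^sub>2' t'"
      using T' by (auto elim: mem_cls_cases)
    then have m: "lin_ar m" "lin_ar m'" "dm C m = dm C r\<^sub>2" "cd C m = dm C r\<^sub>2'" "dm C m' = dm C r\<^sub>2'"
      "cd C m' = dm C r\<^sub>2" "m' \<cdot> m = ide C (dm C r\<^sub>2)" "m \<cdot> m' = ide C (dm C r\<^sub>2')"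
      and mr: "r\<^sub>2' \<cdot> m = r\<^sub>2" and ml: "l\<^sub>2' \<cdot> m = l\<^sub>2" and mt: "dar F m t' = t"
      by (simp_all add: span_iso_def)
    have sp: "lin_ar l\<^sub>1" "lin_ar l\<^sub>1'" "lin_ar r\<^sub>2" "lin_ar r\<^sub>2'" "dm C l\<^sub>1 = dm C r\<^sub>1" "dm C l\<^sub>1' = dm C r\<^sub>1'"
      "dm C l\<^sub>2 = dm C r\<^sub>2" "dm C l\<^sub>2' = dm C r\<^sub>2'" "s \<in> dob F (dm C r\<^sub>1)" "s' \<in> dob F (dm C r\<^sub>1')"
      "t \<in> dob F (dm C r\<^sub>2)" "t' \<in> dob F (dm C r\<^sub>2')"
      using sS' sT' S T by (simp_all add: span_def)
    have "is_pullback (Lin C) (r\<^sub>1' \<cdot> n) (l\<^sub>2' \<cdot> m) (n' \<cdot> c\<^sub>0) (m' \<cdot> c\<^sub>1)"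
      using n m sp by (intro pullback_change_iso[OF q]) simp_all
    then have "is_pullback (Lin C) r\<^sub>1 l\<^sub>2 (n' \<cdot> c\<^sub>0) (m' \<cdot> c\<^sub>1)"
      by (simp add: nr ml)
    then obtain k where "k \<in> Iso (Lin C) (dm C b\<^sub>1) (dm C (m' \<cdot> c\<^sub>1))"
      and "(n' \<cdot> c\<^sub>0) \<cdot> k = b\<^sub>0" "(m' \<cdot> c\<^sub>1) \<cdot> k = b\<^sub>1"
      using pullback_unique[OF p] by blast
    moreover have "dm C (m' \<cdot> c\<^sub>1) = dm C c\<^sub>1"
      using tq m sp by (simp add: dec_simps)
    ultimately obtain k' where k: "lin_ar k" "lin_ar k'" "dm C k = dm C b\<^sub>1" "cd C k = dm C c\<^sub>1"
      "dm C k' = dm C c\<^sub>1" "cd C k' = dm C b\<^sub>1" "k' \<cdot> k = ide C (dm C b\<^sub>1)" "k \<cdot> k' = ide C (dm C c\<^sub>1)"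
      and kb: "n' \<cdot> c\<^sub>0 \<cdot> k = b\<^sub>0" "m' \<cdot> c\<^sub>1 \<cdot> k = b\<^sub>1"
      using tq m n sp by (auto simp: Iso_Lin_iff dec_simps)
    have "(n \<cdot> n') \<cdot> c\<^sub>0 \<cdot> k = n \<cdot> b\<^sub>0"
      using n k tq unfolding kb(1)[symmetric] by (intro assoc_cmp) (simp_all add: dec_simps)
    \<comment> \<open>\<open>k\<close> is compatible with the transported legs; cancelling \<open>n'\<close> and \<open>m'\<close> gives the original ones\<close>
    then have ck0: "c\<^sub>0 \<cdot> k = n \<cdot> b\<^sub>0"
      using n k tq by (simp add: dec_simps)
    have "(m \<cdot> m') \<cdot> c\<^sub>1 \<cdot> k = m \<cdot> b\<^sub>1"
      using m k tq sp unfolding kb(2)[symmetric] by (intro assoc_cmp) (simp_all add: dec_simps)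
    then have ck1: "c\<^sub>1 \<cdot> k = m \<cdot> b\<^sub>1"
      using m k tq sp by (simp add: dec_simps)
    have d: "dar F \<langle>c\<^sub>0, c\<^sub>1\<rangle> (dprd F (dm C l\<^sub>1') (dm C l\<^sub>2') s' t') = dar F c\<^sub>0 s' \<uplus> dar F c\<^sub>1 t'"
      using tq sp by (intro dar_pair_dprd) simp_all
    have "cls (l\<^sub>1 \<cdot> b\<^sub>0) (r\<^sub>2 \<cdot> b\<^sub>1) (dar F b\<^sub>0 s \<uplus> dar F b\<^sub>1 t) =
        cls (l\<^sub>1' \<cdot> c\<^sub>0) (r\<^sub>2' \<cdot> c\<^sub>1) (dar F c\<^sub>0 s' \<uplus> dar F c\<^sub>1 t')"
    proof (rule cls_eqI)
      show "span (l\<^sub>1 \<cdot> b\<^sub>0) (r\<^sub>2 \<cdot> b\<^sub>1) (dar F b\<^sub>0 s \<uplus> dar F b\<^sub>1 t)"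
        using tp sp by (simp add: span_def dec_simps)
      show "span (l\<^sub>1' \<cdot> c\<^sub>0) (r\<^sub>2' \<cdot> c\<^sub>1) (dar F c\<^sub>0 s' \<uplus> dar F c\<^sub>1 t')"
        using tq sp by (simp add: span_def dec_simps)
      have "l\<^sub>1' \<cdot> n \<cdot> b\<^sub>0 = l\<^sub>1 \<cdot> b\<^sub>0" "r\<^sub>2' \<cdot> m \<cdot> b\<^sub>1 = r\<^sub>2 \<cdot> b\<^sub>1"
        using assoc_cmp[of b\<^sub>0 n l\<^sub>1'] assoc_cmp[of b\<^sub>1 m r\<^sub>2'] tp sp n m nl mr by (simp_all add: lin_ar_imp_ar)
      then have "(l\<^sub>1' \<cdot> c\<^sub>0) \<cdot> k = l\<^sub>1 \<cdot> b\<^sub>0" "(r\<^sub>2' \<cdot> c\<^sub>1) \<cdot> k = r\<^sub>2 \<cdot> b\<^sub>1"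
        using tq sp k by (simp_all add: dec_simps ck0 ck1)
      moreover have "dar F (n \<cdot> b\<^sub>0) s' = dar F b\<^sub>0 s" "dar F (m \<cdot> b\<^sub>1) t' = dar F b\<^sub>1 t"
        using dar_cmp[of b\<^sub>0 n s'] dar_cmp[of b\<^sub>1 m t'] tp sp n m ns mt by simp_all
      then have "dar F k (dar F c\<^sub>0 s' \<uplus> dar F c\<^sub>1 t') = dar F b\<^sub>0 s \<uplus> dar F b\<^sub>1 t"
        using tq sp k by (simp add: dec_simps ck0 ck1)
      ultimately show "span_iso k k' (l\<^sub>1 \<cdot> b\<^sub>0) (r\<^sub>2 \<cdot> b\<^sub>1) (dar F b\<^sub>0 s \<uplus> dar F b\<^sub>1 t)
          (l\<^sub>1' \<cdot> c\<^sub>0) (r\<^sub>2' \<cdot> c\<^sub>1) (dar F c\<^sub>0 s' \<uplus> dar F c\<^sub>1 t')"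
        using k tp tq sp by (simp add: span_iso_def dec_simps)
    qed
    then show ?thesis
      by (simp add: d)
  qed
  show ?thesis
    unfolding dspan_cmp_def
  proof (intro equalityI subsetI)
    fix x assume "x \<in> ?K"
    then show "x \<in> (\<Union>(l\<^sub>1, r\<^sub>1, s) \<in> cls l\<^sub>1 r\<^sub>1 s. \<Union>(l\<^sub>2, r\<^sub>2, t) \<in> cls l\<^sub>2 r\<^sub>2 t.
      \<Union>(b\<^sub>0, b\<^sub>1) \<in> {(b\<^sub>0, b\<^sub>1). is_pullback (Lin C) r\<^sub>1 l\<^sub>2 b\<^sub>0 b\<^sub>1}.
        cls (l\<^sub>1 \<cdot> b\<^sub>0) (r\<^sub>2 \<cdot> b\<^sub>1) (dar F \<langle>b\<^sub>0, b\<^sub>1\<rangle> (dprd F (dm C l\<^sub>1) (dm C l\<^sub>2) s t)))"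
      using p *[OF self_mem_cls[OF S] self_mem_cls[OF T] p]
      by (intro UN_triple_I[OF self_mem_cls[OF S]] UN_triple_I[OF self_mem_cls[OF T]]
          UN_I[of "(b\<^sub>0, b\<^sub>1)"]) simp_all
  qed (use * in auto)
qed

text \<open>The tensor of two isomorphisms of spans is an isomorphism of the tensors, so again the union is one of
  equal sets.\<close>

lemma cls_tensor:
  assumes S: "span l\<^sub>1 r\<^sub>1 s" and T: "span l\<^sub>2 r\<^sub>2 t"
  shows "dspan_tensor C F (cls l\<^sub>1 r\<^sub>1 s) (cls l\<^sub>2 r\<^sub>2 t) =
    cls (l\<^sub>1 \<diamondop> l\<^sub>2) (r\<^sub>1 \<diamondop> r\<^sub>2) (dar F (pr\<^sub>0 C (dm C r\<^sub>1) (dm C r\<^sub>2)) s \<uplus> dar F (pr\<^sub>1 C (dm C r\<^sub>1) (dm C r\<^sub>2)) t)"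
    (is "_ = ?K")
proof -
  have *: "cls (l\<^sub>1' \<diamondop> l\<^sub>2') (r\<^sub>1' \<diamondop> r\<^sub>2') (dprd F (dm C l\<^sub>1') (dm C l\<^sub>2') s' t') = ?K"
    if S': "(l\<^sub>1', r\<^sub>1', s') \<in> cls l\<^sub>1 r\<^sub>1 s" and T': "(l\<^sub>2', r\<^sub>2', t') \<in> cls l\<^sub>2 r\<^sub>2 t"
    for l\<^sub>1' r\<^sub>1' s' l\<^sub>2' r\<^sub>2' t'
  proof -
    obtain n n' where sS': "span l\<^sub>1' r\<^sub>1' s'" and "span_iso n n' l\<^sub>1 r\<^sub>1 s l\<^sub>1' r\<^sub>1' s'"
      using S' by (auto elim: mem_cls_cases)
    then have n: "lin_ar n" "lin_ar n'" "dm C n = dm C r\<^sub>1" "cd C n = dm C r\<^sub>1'" "dm C n' = dm C r\<^sub>1'"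
      "cd C n' = dm C r\<^sub>1" "n' \<cdot> n = ide C (dm C r\<^sub>1)" "n \<cdot> n' = ide C (dm C r\<^sub>1')"
      and nr: "r\<^sub>1' \<cdot> n = r\<^sub>1" and nl: "l\<^sub>1' \<cdot> n = l\<^sub>1" and ns: "dar F n s' = s"
      by (simp_all add: span_iso_def)
    obtain m m' where sT': "span l\<^sub>2' r\<^sub>2' t'" and "span_iso m m' l\<^sub>2 r\<^sub>2 t l\<^sub>2' r\<^sub>2' t'"
      using T' by (auto elim: mem_cls_cases)
    then have m: "lin_ar m" "lin_ar m'" "dm C m = dm C r\<^sub>2" "cd C m = dm C r\<^sub>2'" "dm C m' = dm C r\<^sub>2'"
      "cd C m' = dm C r\<^sub>2" "m' \<cdot> m = ide C (dm C r\<^sub>2)" "m \<cdot> m' = ide C (dm C r\<^sub>2')"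
      and mr: "r\<^sub>2' \<cdot> m = r\<^sub>2" and ml: "l\<^sub>2' \<cdot> m = l\<^sub>2" and mt: "dar F m t' = t"
      by (simp_all add: span_iso_def)
    have sp: "lin_ar l\<^sub>1" "lin_ar l\<^sub>1'" "lin_ar r\<^sub>1" "lin_ar r\<^sub>1'" "lin_ar l\<^sub>2" "lin_ar l\<^sub>2'" "lin_ar r\<^sub>2" "lin_ar r\<^sub>2'"
      "dm C l\<^sub>1 = dm C r\<^sub>1" "dm C l\<^sub>1' = dm C r\<^sub>1'"
      "dm C l\<^sub>2 = dm C r\<^sub>2" "dm C l\<^sub>2' = dm C r\<^sub>2'" "s \<in> dob F (dm C r\<^sub>1)" "s' \<in> dob F (dm C r\<^sub>1')"
      "t \<in> dob F (dm C r\<^sub>2)" "t' \<in> dob F (dm C r\<^sub>2')"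
      using sS' sT' S T by (simp_all add: span_def)
    have d: "dprd F (dm C l\<^sub>1') (dm C l\<^sub>2') s' t' =
      dar F (pr\<^sub>0 C (dm C r\<^sub>1') (dm C r\<^sub>2')) s' \<uplus> dar F (pr\<^sub>1 C (dm C r\<^sub>1') (dm C r\<^sub>2')) t'" (is "_ = ?d'")
      using sp by (simp add: dprd_eq dec_simps)
    have "?K = cls (l\<^sub>1' \<diamondop> l\<^sub>2') (r\<^sub>1' \<diamondop> r\<^sub>2') ?d'"
    proof (rule cls_eqI)
      show "span (l\<^sub>1 \<diamondop> l\<^sub>2) (r\<^sub>1 \<diamondop> r\<^sub>2) (dar F (pr\<^sub>0 C (dm C r\<^sub>1) (dm C r\<^sub>2)) s \<uplus> dar F (pr\<^sub>1 C (dm C r\<^sub>1) (dm C r\<^sub>2)) t)"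
        using sp by (simp add: span_def dec_simps)
      show "span (l\<^sub>1' \<diamondop> l\<^sub>2') (r\<^sub>1' \<diamondop> r\<^sub>2') ?d'"
        using sp by (simp add: span_def dec_simps)
      show "span_iso (n \<diamondop> m) (n' \<diamondop> m') (l\<^sub>1 \<diamondop> l\<^sub>2) (r\<^sub>1 \<diamondop> r\<^sub>2)
         (dar F (pr\<^sub>0 C (dm C r\<^sub>1) (dm C r\<^sub>2)) s \<uplus> dar F (pr\<^sub>1 C (dm C r\<^sub>1) (dm C r\<^sub>2)) t)
         (l\<^sub>1' \<diamondop> l\<^sub>2') (r\<^sub>1' \<diamondop> r\<^sub>2') ?d'"
        unfolding span_iso_def
      proof (intro conjI)
        note ts = dec_simps
        have "n' \<cdot> n \<cdot> x = x" if "x \<in> ar C" "cd C x = dm C r\<^sub>1" for x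
          using n that assoc_cmp[of x n n'] by (simp add: lin_ar_imp_ar cat_simps)
        moreover have "m' \<cdot> m \<cdot> x = x" if "x \<in> ar C" "cd C x = dm C r\<^sub>2" for x
          using m that assoc_cmp[of x m m'] by (simp add: lin_ar_imp_ar cat_simps)
        ultimately show "(n' \<diamondop> m') \<cdot> (n \<diamondop> m) = ide C (dm C (r\<^sub>1 \<diamondop> r\<^sub>2))"
          using sp n m by (simp add: ts)
        have "n \<cdot> n' \<cdot> x = x" if "x \<in> ar C" "cd C x = dm C r\<^sub>1'" for x
          using n that assoc_cmp[of x n' n] by (simp add: lin_ar_imp_ar cat_simps)
        moreover have "m \<cdot> m' \<cdot> x = x" if "x \<in> ar C" "cd C x = dm C r\<^sub>2'" for x
          using m that assoc_cmp[of x m' m] by (simp add: lin_ar_imp_ar cat_simps)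
        ultimately show "(n \<diamondop> m) \<cdot> (n' \<diamondop> m') = ide C (dm C (r\<^sub>1' \<diamondop> r\<^sub>2'))"
          using sp n m by (simp add: ts)
        have "l\<^sub>1' \<cdot> n \<cdot> x = l\<^sub>1 \<cdot> x" "r\<^sub>1' \<cdot> n \<cdot> x = r\<^sub>1 \<cdot> x" if "x \<in> ar C" "cd C x = dm C r\<^sub>1" for x
          using n sp that assoc_cmp[of x n l\<^sub>1'] assoc_cmp[of x n r\<^sub>1'] nl nr by (simp_all add: lin_ar_imp_ar)
        moreover have "l\<^sub>2' \<cdot> m \<cdot> x = l\<^sub>2 \<cdot> x" "r\<^sub>2' \<cdot> m \<cdot> x = r\<^sub>2 \<cdot> x" if "x \<in> ar C" "cd C x = dm C r\<^sub>2" for x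
          using m sp that assoc_cmp[of x m l\<^sub>2'] assoc_cmp[of x m r\<^sub>2'] ml mr by (simp_all add: lin_ar_imp_ar)
        ultimately show "(l\<^sub>1' \<diamondop> l\<^sub>2') \<cdot> (n \<diamondop> m) = l\<^sub>1 \<diamondop> l\<^sub>2" "(r\<^sub>1' \<diamondop> r\<^sub>2') \<cdot> (n \<diamondop> m) = r\<^sub>1 \<diamondop> r\<^sub>2"
          using sp n m by (simp_all add: ts)
        have "dar F (n \<cdot> x) s' = dar F x s" if "lin_ar x" "cd C x = dm C r\<^sub>1" for x
          using dar_cmp[of x n s'] sp n ns that by simp
        moreover have "dar F (m \<cdot> x) t' = dar F x t" if "lin_ar x" "cd C x = dm C r\<^sub>2" for x
          using dar_cmp[of x m t'] sp m mt that by simp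
        ultimately show "dar F (n \<diamondop> m) ?d' = dar F (pr\<^sub>0 C (dm C r\<^sub>1) (dm C r\<^sub>2)) s \<uplus> dar F (pr\<^sub>1 C (dm C r\<^sub>1) (dm C r\<^sub>2)) t"
          using sp n m by (simp add: ts)
      qed (use sp n m in \<open>simp_all add: dec_simps\<close>)
    qed
    then show ?thesis
      by (simp add: d)
  qed
  show ?thesis
    unfolding dspan_tensor_def
  proof (intro equalityI subsetI)
    fix x assume "x \<in> ?K"
    then show "x \<in> (\<Union>(l\<^sub>1, r\<^sub>1, s) \<in> cls l\<^sub>1 r\<^sub>1 s. \<Union>(l\<^sub>2, r\<^sub>2, t) \<in> cls l\<^sub>2 r\<^sub>2 t.
        cls (l\<^sub>1 \<diamondop> l\<^sub>2) (r\<^sub>1 \<diamondop> r\<^sub>2) (dprd F (dm C l\<^sub>1) (dm C l\<^sub>2) s t))"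
      using *[OF self_mem_cls[OF S] self_mem_cls[OF T]]
      by (intro UN_triple_I[OF self_mem_cls[OF S]] UN_triple_I[OF self_mem_cls[OF T]]) simp_all
  qed (use * in auto)
qed

section \<open>Graphs and cographs of linear maps\<close>

abbreviation H :: "('o, ('m, 's) dspan set) hypcat" where
  "H \<equiv> dspan_hypcat C F"

abbreviation span_cmp (infixr \<open>\<bullet>\<close> 70) where
  "T \<bullet> S \<equiv> dspan_cmp C F T S"

abbreviation span_tensor (infixr \<open>\<otimes>\<close> 75) where
  "T \<otimes> S \<equiv> dspan_tensor C F T S"

lemma H_sel: "ob H = ob C" "cmp H = dspan_cmp C F" "tob H = prd C" "tar H = dspan_tensor C F" "unit H = trm C"
  by (simp_all add: dspan_hypcat_def)

lemma mem_quotient_iff: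
  "S \<in> dspans C F X Y // dspan_iso C F \<longleftrightarrow> (\<exists>l r s. S = cls l r s \<and> span l r s \<and> cd C l = X \<and> cd C r = Y)"
proof
  assume "S \<in> dspans C F X Y // dspan_iso C F"
  then obtain x where "x \<in> dspans C F X Y" "S = dspan_iso C F `` {x}"
    by (rule quotientE)
  then show "\<exists>l r s. S = cls l r s \<and> span l r s \<and> cd C l = X \<and> cd C r = Y"
    by (cases x) (auto simp: dspan_class_def dspans_iff)
next
  assume "\<exists>l r s. S = cls l r s \<and> span l r s \<and> cd C l = X \<and> cd C r = Y"
  then obtain l r s where "S = cls l r s" "(l, r, s) \<in> dspans C F X Y"
    by (auto simp: dspans_iff)
  then show "S \<in> dspans C F X Y // dspan_iso C F"
    by (auto simp: dspan_class_def intro: quotientI)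
qed

text \<open>A class determines its feet, so the definite descriptions for domain and codomain have unique witnesses.\<close>

lemma dm_cls:
  assumes "span l r s"
  shows "dm H (cls l r s) = cd C l" "cd H (cls l r s) = cd C r"
proof -
  have "(\<exists>Y. cls l r s \<in> dspans C F X Y // dspan_iso C F) \<longleftrightarrow> X = cd C l" for X
    unfolding mem_quotient_iff using assms cls_eq_feet by blast
  then show "dm H (cls l r s) = cd C l"
    by (simp add: dspan_hypcat_def)
  have "(\<exists>X. cls l r s \<in> dspans C F X Y // dspan_iso C F) \<longleftrightarrow> Y = cd C r" for Y
    unfolding mem_quotient_iff using assms cls_eq_feet by blast
  then show "cd H (cls l r s) = cd C r"
    by (simp add: dspan_hypcat_def)
qed

lemma Hom_H_iff: "S \<in> Hom H X Y \<longleftrightarrow> (\<exists>l r s. S = cls l r s \<and> span l r s \<and> cd C l = X \<and> cd C r = Y)"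
proof
  assume S: "S \<in> Hom H X Y"
  then have "S \<in> ar H" "dm H S = X" "cd H S = Y"
    by (simp_all add: Hom_iff)
  moreover then obtain l r s where "S = cls l r s" "span l r s"
    by (auto simp: dspan_hypcat_def mem_quotient_iff)
  ultimately show "\<exists>l r s. S = cls l r s \<and> span l r s \<and> cd C l = X \<and> cd C r = Y"
    using dm_cls[of l r s] by (intro exI[of _ l] exI[of _ r] exI[of _ s]) simp
next
  assume "\<exists>l r s. S = cls l r s \<and> span l r s \<and> cd C l = X \<and> cd C r = Y"
  then obtain l r s where S: "S = cls l r s" "span l r s" "cd C l = X" "cd C r = Y"
    by blast
  then have "X \<in> ob C" "Y \<in> ob C"
    by (auto simp: span_def dec_simps)
  moreover have "S \<in> dspans C F X Y // dspan_iso C F"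
    using S by (auto simp: mem_quotient_iff)
  ultimately have "S \<in> ar H"
    by (auto simp: dspan_hypcat_def)
  then show "S \<in> Hom H X Y"
    using S dm_cls[of l r s] by (simp add: Hom_iff)
qed

lemma Hom_HE:
  assumes "S \<in> Hom H X Y"
  obtains l r s where "S = cls l r s" "lin_ar l" "lin_ar r" "dm C l = dm C r" "s \<in> dob F (dm C r)"
    "cd C l = X" "cd C r = Y"
  using assms unfolding Hom_H_iff span_def by blast

lemma cls_Hom: "span l r s \<Longrightarrow> X = cd C l \<Longrightarrow> Y = cd C r \<Longrightarrow> cls l r s \<in> Hom H X Y"
  unfolding Hom_H_iff by blast

text \<open>Linear maps embed into decorated spans covariantly (as right legs) and contravariantly (as left
  legs). All structural arrows are of one of these two forms.\<close>

definition graph :: "'m \<Rightarrow> ('m, 's) dspan set" where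
  "graph f = cls (ide C (dm C f)) f (zero (dm C f))"

definition cograph :: "'m \<Rightarrow> ('m, 's) dspan set" where
  "cograph f = cls f (ide C (dm C f)) (zero (dm C f))"

lemma span_graph: "lin_ar f \<Longrightarrow> X = dm C f \<Longrightarrow> span (ide C X) f (zero X)"
  by (simp add: span_def dec_simps)

lemma span_cograph: "lin_ar f \<Longrightarrow> X = dm C f \<Longrightarrow> span f (ide C X) (zero X)"
  by (simp add: span_def dec_simps)

lemma graph_ide: "X \<in> ob C \<Longrightarrow> graph (ide C X) = cograph (ide C X)"
  by (simp add: graph_def cograph_def dec_simps)

lemma graph_Hom: "lin_ar f \<Longrightarrow> X = dm C f \<Longrightarrow> Y = cd C f \<Longrightarrow> graph f \<in> Hom H X Y"
  by (simp add: graph_def cls_Hom span_graph dec_simps)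

lemma cograph_Hom: "lin_ar f \<Longrightarrow> X = cd C f \<Longrightarrow> Y = dm C f \<Longrightarrow> cograph f \<in> Hom H X Y"
  by (simp add: cograph_def cls_Hom span_cograph dec_simps)

text \<open>The pullback along an identity is trivial, so composing with a graph after, or with a cograph before,
  only extends one leg of a span.\<close>

lemma graph_cmp_cls:
  assumes "lin_ar l" "lin_ar r" "dm C l = dm C r" "s \<in> dob F (dm C r)" "lin_ar f" "dm C f = cd C r"
  shows "graph f \<bullet> cls l r s = cls l (f \<cdot> r) s"
proof -
  have "graph f \<bullet> cls l r s = cls (l \<cdot> ide C (dm C r)) (f \<cdot> r) (dar F (ide C (dm C r)) s \<uplus> dar F r (zero (cd C r)))"
    unfolding graph_def assms(6)
    by (rule cls_cmp) (use assms in \<open>simp_all add: span_def pullback_ide dec_simps\<close>)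
  then show ?thesis
    using assms by (simp add: dec_simps)
qed

lemma cls_cmp_cograph:
  assumes "lin_ar l" "lin_ar r" "dm C l = dm C r" "s \<in> dob F (dm C r)" "lin_ar f" "dm C f = cd C l"
  shows "cls l r s \<bullet> cograph f = cls (f \<cdot> l) r s"
proof -
  have "cls l r s \<bullet> cograph f = cls (f \<cdot> l) (r \<cdot> ide C (dm C l)) (dar F l (zero (cd C l)) \<uplus> dar F (ide C (dm C l)) s)"
    unfolding cograph_def assms(6)
    by (rule cls_cmp) (use assms pullback_sym[OF pullback_ide[of l]] in \<open>simp_all add: span_def dec_simps\<close>)
  then show ?thesis
    using assms by (simp add: dec_simps)
qed

lemma graph_cmp: "lin_ar f \<Longrightarrow> lin_ar g \<Longrightarrow> dm C g = cd C f \<Longrightarrow> graph g \<bullet> graph f = graph (g \<cdot> f)"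
  by (subst (2) graph_def) (simp add: graph_cmp_cls dec_simps, simp add: graph_def dec_simps)

lemma cograph_cmp: "lin_ar f \<Longrightarrow> lin_ar g \<Longrightarrow> dm C f = cd C g \<Longrightarrow> cograph g \<bullet> cograph f = cograph (f \<cdot> g)"
  by (subst (1) cograph_def) (simp add: cls_cmp_cograph dec_simps, simp add: cograph_def dec_simps)

text \<open>The Beck-Chevalley rule for a pullback square: a graph followed by a cograph is rewritten to a cograph
  followed by a graph. It carries the whole interaction between the two variances.\<close>

lemma cograph_cmp_graph:
  assumes "is_pullback (Lin C) f g b\<^sub>0 b\<^sub>1"
  shows "cograph g \<bullet> graph f = graph b\<^sub>1 \<bullet> cograph b\<^sub>0"
proof -
  note t = pullback_typing[OF assms]
  have "cograph g \<bullet> graph f = cls (ide C (dm C f) \<cdot> b\<^sub>0) (ide C (dm C g) \<cdot> b\<^sub>1)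
      (dar F b\<^sub>0 (zero (dm C f)) \<uplus> dar F b\<^sub>1 (zero (dm C g)))"
    unfolding graph_def cograph_def
    by (rule cls_cmp) (use assms t in \<open>simp_all add: span_def dec_simps\<close>)
  also have "\<dots> = cls b\<^sub>0 b\<^sub>1 (zero (dm C b\<^sub>1))"
    using t by (simp add: dec_simps)
  also have "\<dots> = graph b\<^sub>1 \<bullet> cls b\<^sub>0 (ide C (dm C b\<^sub>1)) (zero (dm C b\<^sub>1))"
    using t by (simp add: graph_cmp_cls dec_simps)
  finally show ?thesis
    using t by (simp add: cograph_def)
qed

definition inverse_pair :: "'m \<Rightarrow> 'm \<Rightarrow> bool" where
  "inverse_pair i j \<longleftrightarrow> lin_ar i \<and> lin_ar j \<and> dm C j = cd C i \<and> cd C j = dm C i \<and>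
     j \<cdot> i = ide C (dm C i) \<and> i \<cdot> j = ide C (cd C i)"

lemma inverse_pair_sym: "inverse_pair i j \<Longrightarrow> inverse_pair j i"
  by (auto simp: inverse_pair_def)

text \<open>The isomorphism \<open>i\<close> itself identifies the two spans. Coherence isomorphisms can hence be used as graphs
  or as cographs, whichever variance the neighbouring arrows have.\<close>

lemma graph_iso:
  assumes "inverse_pair i j"
  shows "graph i = cograph j"
  unfolding graph_def cograph_def
proof (rule cls_eqI)
  show "span_iso i j (ide C (dm C i)) i (zero (dm C i)) j (ide C (dm C j)) (zero (dm C j))"
    using assms by (auto simp: span_iso_def inverse_pair_def dec_simps)
qed (use assms in \<open>auto simp: span_graph span_cograph inverse_pair_def\<close>)

lemma graph_inverse_arrows:
  assumes "inverse_pair i j"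
  shows "inverse_arrows H (dm C i) (cd C i) (graph i) (graph j)"
proof -
  have "ide H X = graph (ide C X)" if "X \<in> ob C" for X
    using that by (simp add: dspan_hypcat_def plain_class_def graph_def ide_dec_def dunit_eq dec_simps)
  then show ?thesis
    using assms
    by (auto simp: inverse_arrows_def inverse_pair_def H_sel graph_cmp graph_Hom dec_simps)
qed

lemma cls_cmp_graph_iso:
  assumes "lin_ar l" "lin_ar r" "dm C l = dm C r" "s \<in> dob F (dm C r)" "inverse_pair i j" "cd C i = cd C l"
  shows "cls l r s \<bullet> graph i = cls (j \<cdot> l) r s"
  unfolding graph_iso[OF assms(5)] using assms by (intro cls_cmp_cograph) (simp_all add: inverse_pair_def)

lemma tensor_cls:
  assumes "lin_ar l" "lin_ar r" "dm C l = dm C r" "s \<in> dob F (dm C r)"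
    and "lin_ar l'" "lin_ar r'" "dm C l' = dm C r'" "s' \<in> dob F (dm C r')"
  shows "cls l r s \<otimes> cls l' r' s' = cls (l \<diamondop> l') (r \<diamondop> r')
    (dar F (pr\<^sub>0 C (dm C r) (dm C r')) s \<uplus> dar F (pr\<^sub>1 C (dm C r) (dm C r')) s')"
  using assms by (intro cls_tensor) (simp_all add: span_def)

lemma tensor_graph: "lin_ar f \<Longrightarrow> lin_ar g \<Longrightarrow> graph f \<otimes> graph g = graph (f \<diamondop> g)"
  by (simp add: graph_def tensor_cls dec_simps)

lemma tensor_cograph: "lin_ar f \<Longrightarrow> lin_ar g \<Longrightarrow> cograph f \<otimes> cograph g = cograph (f \<diamondop> g)"
  by (simp add: cograph_def tensor_cls dec_simps)

section \<open>The hypergraph structure\<close>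

definition asc :: "'o \<Rightarrow> 'o \<Rightarrow> 'o \<Rightarrow> 'm" where
  "asc X Y Z = \<langle>pr\<^sub>0 C X Y \<cdot> pr\<^sub>0 C (X \<^bold>\<times> Y) Z,
    \<langle>pr\<^sub>1 C X Y \<cdot> pr\<^sub>0 C (X \<^bold>\<times> Y) Z, pr\<^sub>1 C (X \<^bold>\<times> Y) Z\<rangle>\<rangle>"

definition asc_inv :: "'o \<Rightarrow> 'o \<Rightarrow> 'o \<Rightarrow> 'm" where
  "asc_inv X Y Z = \<langle>\<langle>pr\<^sub>0 C X (Y \<^bold>\<times> Z), pr\<^sub>0 C Y Z \<cdot> pr\<^sub>1 C X (Y \<^bold>\<times> Z)\<rangle>,
    pr\<^sub>1 C Y Z \<cdot> pr\<^sub>1 C X (Y \<^bold>\<times> Z)\<rangle>"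

definition swp :: "'o \<Rightarrow> 'o \<Rightarrow> 'm" where
  "swp X Y = \<langle>pr\<^sub>1 C X Y, pr\<^sub>0 C X Y\<rangle>"

definition diag :: "'o \<Rightarrow> 'm" where
  "diag X = \<langle>ide C X, ide C X\<rangle>"

lemma structure_typing:
  assumes "X \<in> ob C" "Y \<in> ob C" "Z \<in> ob C"
  shows "lin_ar (asc X Y Z)" "dm C (asc X Y Z) = (X \<^bold>\<times> Y) \<^bold>\<times> Z" "cd C (asc X Y Z) = X \<^bold>\<times> Y \<^bold>\<times> Z"
    "lin_ar (asc_inv X Y Z)" "dm C (asc_inv X Y Z) = X \<^bold>\<times> Y \<^bold>\<times> Z" "cd C (asc_inv X Y Z) = (X \<^bold>\<times> Y) \<^bold>\<times> Z"
    "lin_ar (swp X Y)" "dm C (swp X Y) = X \<^bold>\<times> Y" "cd C (swp X Y) = Y \<^bold>\<times> X"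
    "lin_ar (diag X)" "dm C (diag X) = X" "cd C (diag X) = X \<^bold>\<times> X"
  using assms by (simp_all add: asc_def asc_inv_def swp_def diag_def dec_simps)

lemma asc_inverse: "\<lbrakk>X \<in> ob C; Y \<in> ob C; Z \<in> ob C\<rbrakk> \<Longrightarrow> inverse_pair (asc X Y Z) (asc_inv X Y Z)"
  by (simp add: inverse_pair_def structure_typing)
     (simp add: asc_def asc_inv_def dec_simps)

lemma swp_inverse: "\<lbrakk>X \<in> ob C; Y \<in> ob C\<rbrakk> \<Longrightarrow> inverse_pair (swp X Y) (swp Y X)"
  by (simp add: inverse_pair_def structure_typing)
     (simp add: swp_def dec_simps)

text \<open>The projection from a product with the terminal object is invertible since the other projection is
  forced to be the unique map.\<close>

lemma lunit_inverse: "X \<in> ob C \<Longrightarrow> inverse_pair (pr\<^sub>1 C (trm C) X) \<langle>bang C X, ide C X\<rangle>"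
proof -
  assume X: "X \<in> ob C"
  have "\<langle>bang C (trm C \<^bold>\<times> X), pr\<^sub>1 C (trm C) X\<rangle> = ide C (trm C \<^bold>\<times> X)"
    using X eq_bang[of "pr\<^sub>0 C (trm C) X"] pair_pr[of "trm C" X] by (simp add: dec_simps)
  with X show ?thesis
    by (simp add: inverse_pair_def dec_simps)
qed

lemma runit_inverse: "X \<in> ob C \<Longrightarrow> inverse_pair (pr\<^sub>0 C X (trm C)) \<langle>ide C X, bang C X\<rangle>"
proof -
  assume X: "X \<in> ob C"
  have "\<langle>pr\<^sub>0 C X (trm C), bang C (X \<^bold>\<times> trm C)\<rangle> = ide C (X \<^bold>\<times> trm C)"
    using X eq_bang[of "pr\<^sub>1 C X (trm C)"] pair_pr[of X "trm C"] by (simp add: dec_simps)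
  with X show ?thesis
    by (simp add: inverse_pair_def dec_simps)
qed

lemma plain_class_eq: "lin_ar l \<Longrightarrow> plain_class C F l r = cls l r (zero (dm C l))"
  by (simp add: plain_class_def ide_dec_def dunit_eq dec_simps)

lemma H_structure:
  shows "X \<in> ob C \<Longrightarrow> ide H X = graph (ide C X)"
    "\<lbrakk>X \<in> ob C; Y \<in> ob C; Z \<in> ob C\<rbrakk> \<Longrightarrow> assoc H X Y Z = graph (asc X Y Z)"
    "X \<in> ob C \<Longrightarrow> lunit H X = graph (pr\<^sub>1 C (trm C) X)"
    "X \<in> ob C \<Longrightarrow> runit H X = graph (pr\<^sub>0 C X (trm C))"
    "\<lbrakk>X \<in> ob C; Y \<in> ob C\<rbrakk> \<Longrightarrow> swap H X Y = graph (swp X Y)"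
    "X \<in> ob C \<Longrightarrow> mu H X = cograph (diag X)"
    "X \<in> ob C \<Longrightarrow> eta H X = cograph (bang C X)"
    "X \<in> ob C \<Longrightarrow> delta H X = graph (diag X)"
    "X \<in> ob C \<Longrightarrow> eps H X = graph (bang C X)"
  by (simp_all add: dspan_hypcat_def plain_class_eq graph_def cograph_def asc_def swp_def diag_def dec_simps)

lemmas struct_simps = H_sel H_structure asc_def asc_inv_def swp_def diag_def

text \<open>Both bracketings are computed with one common apex, the pullback of \<open>b\<^sub>1\<close> and \<open>c\<^sub>0\<close>: by pasting, it is
  a pullback of the cospans that occur in either of them. The two spans are then equal, not only isomorphic.\<close>

lemma H_cmp_assoc:
  assumes S: "S \<in> Hom H W X" and T: "T \<in> Hom H X Y" and U: "U \<in> Hom H Y Z"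
  shows "(U \<bullet> T) \<bullet> S = U \<bullet> (T \<bullet> S)"
proof -
  obtain l\<^sub>1 r\<^sub>1 s where s: "S = cls l\<^sub>1 r\<^sub>1 s" "lin_ar l\<^sub>1" "lin_ar r\<^sub>1" "dm C l\<^sub>1 = dm C r\<^sub>1" "s \<in> dob F (dm C r\<^sub>1)"
    "cd C l\<^sub>1 = W" "cd C r\<^sub>1 = X"
    using S by (rule Hom_HE)
  obtain l\<^sub>2 r\<^sub>2 t where t: "T = cls l\<^sub>2 r\<^sub>2 t" "lin_ar l\<^sub>2" "lin_ar r\<^sub>2" "dm C l\<^sub>2 = dm C r\<^sub>2" "t \<in> dob F (dm C r\<^sub>2)"
    "cd C l\<^sub>2 = X" "cd C r\<^sub>2 = Y"
    using T by (rule Hom_HE)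
  obtain l\<^sub>3 r\<^sub>3 u where u: "U = cls l\<^sub>3 r\<^sub>3 u" "lin_ar l\<^sub>3" "lin_ar r\<^sub>3" "dm C l\<^sub>3 = dm C r\<^sub>3" "u \<in> dob F (dm C r\<^sub>3)"
    "cd C l\<^sub>3 = Y" "cd C r\<^sub>3 = Z"
    using U by (rule Hom_HE)
  obtain b\<^sub>0 b\<^sub>1 where b: "is_pullback (Lin C) r\<^sub>1 l\<^sub>2 b\<^sub>0 b\<^sub>1"
    using has_pullbacks[of r\<^sub>1 l\<^sub>2] s t by auto
  obtain c\<^sub>0 c\<^sub>1 where c: "is_pullback (Lin C) r\<^sub>2 l\<^sub>3 c\<^sub>0 c\<^sub>1"
    using has_pullbacks[of r\<^sub>2 l\<^sub>3] t u by auto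
  note tb = pullback_typing(3,4,6-9)[OF b] and tc = pullback_typing(3,4,6-9)[OF c]
  obtain d\<^sub>0 d\<^sub>1 where d: "is_pullback (Lin C) b\<^sub>1 c\<^sub>0 d\<^sub>0 d\<^sub>1"
    using has_pullbacks[of b\<^sub>1 c\<^sub>0] t tb tc by auto
  note td = pullback_typing(3,4,6-8)[OF d]
  have TS: "T \<bullet> S = cls (l\<^sub>1 \<cdot> b\<^sub>0) (r\<^sub>2 \<cdot> b\<^sub>1) (dar F b\<^sub>0 s \<uplus> dar F b\<^sub>1 t)"
    unfolding s t by (rule cls_cmp[OF _ _ b]) (use s t in \<open>simp_all add: span_def\<close>)
  have UT: "U \<bullet> T = cls (l\<^sub>2 \<cdot> c\<^sub>0) (r\<^sub>3 \<cdot> c\<^sub>1) (dar F c\<^sub>0 t \<uplus> dar F c\<^sub>1 u)"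
    unfolding u t by (rule cls_cmp[OF _ _ c]) (use u t in \<open>simp_all add: span_def\<close>)
  have "(U \<bullet> T) \<bullet> S = cls (l\<^sub>1 \<cdot> b\<^sub>0 \<cdot> d\<^sub>0) ((r\<^sub>3 \<cdot> c\<^sub>1) \<cdot> d\<^sub>1)
      (dar F (b\<^sub>0 \<cdot> d\<^sub>0) s \<uplus> dar F d\<^sub>1 (dar F c\<^sub>0 t \<uplus> dar F c\<^sub>1 u))"
    unfolding UT s(1)
    by (rule cls_cmp[OF _ _ pullback_paste[OF b d]])
      (use s(2-) t(2-) u(2-) tb tc in \<open>simp_all add: span_def dec_simps\<close>)
  moreover have "U \<bullet> (T \<bullet> S) = cls ((l\<^sub>1 \<cdot> b\<^sub>0) \<cdot> d\<^sub>0) (r\<^sub>3 \<cdot> c\<^sub>1 \<cdot> d\<^sub>1)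
      (dar F d\<^sub>0 (dar F b\<^sub>0 s \<uplus> dar F b\<^sub>1 t) \<uplus> dar F (c\<^sub>1 \<cdot> d\<^sub>1) u)"
    unfolding TS u(1)
    by (rule cls_cmp[OF _ _ pullback_paste'[OF c d]])
      (use s(2-) t(2-) u(2-) tb tc in \<open>simp_all add: span_def dec_simps\<close>)
  moreover have "b\<^sub>1 \<cdot> d\<^sub>0 = c\<^sub>0 \<cdot> d\<^sub>1"
    by (rule pullback_typing(9)[OF d])
  then have "dar F (b\<^sub>0 \<cdot> d\<^sub>0) s \<uplus> dar F d\<^sub>1 (dar F c\<^sub>0 t \<uplus> dar F c\<^sub>1 u) =
      dar F d\<^sub>0 (dar F b\<^sub>0 s \<uplus> dar F b\<^sub>1 t) \<uplus> dar F (c\<^sub>1 \<cdot> d\<^sub>1) u"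
    using s(2-) t(2-) u(2-) tb tc td by (simp add: dec_simps add_assoc[of _ "dm C d\<^sub>1"])
  ultimately show ?thesis
    using s(2-) t(2-) u(2-) tb tc td by (simp add: dec_simps)
qed

lemma Hom_H_ob:
  assumes "S \<in> Hom H X Y"
  shows "X \<in> ob C" "Y \<in> ob C"
proof -
  obtain l r s where "lin_ar l" "lin_ar r" "cd C l = X" "cd C r = Y"
    using assms by (rule Hom_HE)
  then show "X \<in> ob C" "Y \<in> ob C"
    using cd_ob lin_ar_imp_ar by auto
qed

lemma category_H: "category H"
proof
  fix S assume "S \<in> ar H"
  then have "S \<in> Hom H (dm H S) (cd H S)"
    by (simp add: Hom_iff)
  then show "dm H S \<in> ob H" "cd H S \<in> ob H"
    by (simp_all add: H_sel Hom_H_ob)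
next
  fix X assume "X \<in> ob H"
  then show "ide H X \<in> Hom H X X"
    by (simp add: H_sel H_structure graph_Hom dec_simps)
next
  fix S T X Y Z assume S: "S \<in> Hom H X Y" and T: "T \<in> Hom H Y Z"
  obtain l\<^sub>1 r\<^sub>1 s where s: "S = cls l\<^sub>1 r\<^sub>1 s" "lin_ar l\<^sub>1" "lin_ar r\<^sub>1" "dm C l\<^sub>1 = dm C r\<^sub>1" "s \<in> dob F (dm C r\<^sub>1)"
    "cd C l\<^sub>1 = X" "cd C r\<^sub>1 = Y"
    using S by (rule Hom_HE)
  obtain l\<^sub>2 r\<^sub>2 t where t: "T = cls l\<^sub>2 r\<^sub>2 t" "lin_ar l\<^sub>2" "lin_ar r\<^sub>2" "dm C l\<^sub>2 = dm C r\<^sub>2" "t \<in> dob F (dm C r\<^sub>2)"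
    "cd C l\<^sub>2 = Y" "cd C r\<^sub>2 = Z"
    using T by (rule Hom_HE)
  obtain b\<^sub>0 b\<^sub>1 where b: "is_pullback (Lin C) r\<^sub>1 l\<^sub>2 b\<^sub>0 b\<^sub>1"
    using has_pullbacks[of r\<^sub>1 l\<^sub>2] s t by auto
  note tb = pullback_typing(3,4,6-9)[OF b]
  have TS: "T \<bullet> S = cls (l\<^sub>1 \<cdot> b\<^sub>0) (r\<^sub>2 \<cdot> b\<^sub>1) (dar F b\<^sub>0 s \<uplus> dar F b\<^sub>1 t)"
    unfolding s t by (rule cls_cmp[OF _ _ b]) (use s t in \<open>simp_all add: span_def\<close>)
  show "T \<cdot>\<^bsub>H\<^esub> S \<in> Hom H X Z"
    unfolding H_sel TS by (rule cls_Hom) (use s(2-) t(2-) tb in \<open>simp_all add: span_def dec_simps\<close>)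
next
  fix S X Y assume "S \<in> Hom H X Y"
  then show "S \<cdot>\<^bsub>H\<^esub> ide H X = S" "ide H Y \<cdot>\<^bsub>H\<^esub> S = S"
    by (auto elim!: Hom_HE simp: H_sel H_structure graph_ide cls_cmp_cograph dec_simps)
       (auto simp flip: graph_ide simp: graph_cmp_cls dec_simps)
next
  fix S T U W X Y Z assume "S \<in> Hom H W X" "T \<in> Hom H X Y" "U \<in> Hom H Y Z"
  then show "(U \<cdot>\<^bsub>H\<^esub> T) \<cdot>\<^bsub>H\<^esub> S = U \<cdot>\<^bsub>H\<^esub> (T \<cdot>\<^bsub>H\<^esub> S)"
    unfolding H_sel by (rule H_cmp_assoc)
qed

lemma H_tensor_Hom:
  assumes "S \<in> Hom H X Y" "T \<in> Hom H Z W"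
  shows "S \<otimes> T \<in> Hom H (X \<^bold>\<times> Z) (Y \<^bold>\<times> W)"
  using assms by (auto elim!: Hom_HE simp: tensor_cls intro!: cls_Hom simp: span_def dec_simps)

text \<open>The product of the two pullbacks is a pullback of the products; the decorations differ by exchanging the
  two middle summands.\<close>

lemma H_interchange:
  assumes S: "S \<in> Hom H X Y" and T: "T \<in> Hom H Y Z" and S': "S' \<in> Hom H X' Y'" and T': "T' \<in> Hom H Y' Z'"
  shows "(T \<bullet> S) \<otimes> (T' \<bullet> S') = (T \<otimes> T') \<bullet> (S \<otimes> S')"
proof -
  obtain l\<^sub>1 r\<^sub>1 s where s: "S = cls l\<^sub>1 r\<^sub>1 s" "lin_ar l\<^sub>1" "lin_ar r\<^sub>1" "dm C l\<^sub>1 = dm C r\<^sub>1" "s \<in> dob F (dm C r\<^sub>1)"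
    "cd C l\<^sub>1 = X" "cd C r\<^sub>1 = Y"
    using S by (rule Hom_HE)
  obtain l\<^sub>2 r\<^sub>2 t where t: "T = cls l\<^sub>2 r\<^sub>2 t" "lin_ar l\<^sub>2" "lin_ar r\<^sub>2" "dm C l\<^sub>2 = dm C r\<^sub>2" "t \<in> dob F (dm C r\<^sub>2)"
    "cd C l\<^sub>2 = Y" "cd C r\<^sub>2 = Z"
    using T by (rule Hom_HE)
  obtain b\<^sub>0 b\<^sub>1 where b: "is_pullback (Lin C) r\<^sub>1 l\<^sub>2 b\<^sub>0 b\<^sub>1"
    using has_pullbacks[of r\<^sub>1 l\<^sub>2] s t by auto
  note tb = pullback_typing(3,4,6-8)[OF b]
  obtain l\<^sub>1' r\<^sub>1' s' where s': "S' = cls l\<^sub>1' r\<^sub>1' s'" "lin_ar l\<^sub>1'" "lin_ar r\<^sub>1'" "dm C l\<^sub>1' = dm C r\<^sub>1'"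
    "s' \<in> dob F (dm C r\<^sub>1')" "cd C l\<^sub>1' = X'" "cd C r\<^sub>1' = Y'"
    using S' by (rule Hom_HE)
  obtain l\<^sub>2' r\<^sub>2' t' where t': "T' = cls l\<^sub>2' r\<^sub>2' t'" "lin_ar l\<^sub>2'" "lin_ar r\<^sub>2'" "dm C l\<^sub>2' = dm C r\<^sub>2'"
    "t' \<in> dob F (dm C r\<^sub>2')" "cd C l\<^sub>2' = Y'" "cd C r\<^sub>2' = Z'"
    using T' by (rule Hom_HE)
  obtain b\<^sub>0' b\<^sub>1' where b': "is_pullback (Lin C) r\<^sub>1' l\<^sub>2' b\<^sub>0' b\<^sub>1'"
    using has_pullbacks[of r\<^sub>1' l\<^sub>2'] s' t' by auto
  note tb' = pullback_typing(3,4,6-8)[OF b']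
  note ty = s(2-) t(2-) tb s'(2-) t'(2-) tb'
  have "T \<bullet> S = cls (l\<^sub>1 \<cdot> b\<^sub>0) (r\<^sub>2 \<cdot> b\<^sub>1) (dar F b\<^sub>0 s \<uplus> dar F b\<^sub>1 t)"
    unfolding s t by (rule cls_cmp[OF _ _ b]) (use s t in \<open>simp_all add: span_def\<close>)
  moreover have "T' \<bullet> S' = cls (l\<^sub>1' \<cdot> b\<^sub>0') (r\<^sub>2' \<cdot> b\<^sub>1') (dar F b\<^sub>0' s' \<uplus> dar F b\<^sub>1' t')"
    unfolding s' t' by (rule cls_cmp[OF _ _ b']) (use s' t' in \<open>simp_all add: span_def\<close>)
  moreover define p p' where "p = pr\<^sub>0 C (dm C b\<^sub>1) (dm C b\<^sub>1')" and "p' = pr\<^sub>1 C (dm C b\<^sub>1) (dm C b\<^sub>1')"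
  ultimately have "(T \<bullet> S) \<otimes> (T' \<bullet> S') = cls ((l\<^sub>1 \<cdot> b\<^sub>0) \<diamondop> (l\<^sub>1' \<cdot> b\<^sub>0')) ((r\<^sub>2 \<cdot> b\<^sub>1) \<diamondop> (r\<^sub>2' \<cdot> b\<^sub>1'))
     (dar F p (dar F b\<^sub>0 s \<uplus> dar F b\<^sub>1 t) \<uplus> dar F p' (dar F b\<^sub>0' s' \<uplus> dar F b\<^sub>1' t'))"
    using ty by (simp add: tensor_cls cat_simps add_in dar_in lin_simps)
  moreover have "S \<otimes> S' = cls (l\<^sub>1 \<diamondop> l\<^sub>1') (r\<^sub>1 \<diamondop> r\<^sub>1')
     (dar F (pr\<^sub>0 C (dm C r\<^sub>1) (dm C r\<^sub>1')) s \<uplus> dar F (pr\<^sub>1 C (dm C r\<^sub>1) (dm C r\<^sub>1')) s')" (is "_ = cls _ _ ?s")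
    unfolding s(1) s'(1) using ty by (intro tensor_cls) simp_all
  moreover have "T \<otimes> T' = cls (l\<^sub>2 \<diamondop> l\<^sub>2') (r\<^sub>2 \<diamondop> r\<^sub>2')
     (dar F (pr\<^sub>0 C (dm C r\<^sub>2) (dm C r\<^sub>2')) t \<uplus> dar F (pr\<^sub>1 C (dm C r\<^sub>2) (dm C r\<^sub>2')) t')" (is "_ = cls _ _ ?t")
    unfolding t(1) t'(1) using ty by (intro tensor_cls) simp_all
  moreover have "cls (l\<^sub>2 \<diamondop> l\<^sub>2') (r\<^sub>2 \<diamondop> r\<^sub>2') ?t \<bullet> cls (l\<^sub>1 \<diamondop> l\<^sub>1') (r\<^sub>1 \<diamondop> r\<^sub>1') ?s =
      cls ((l\<^sub>1 \<diamondop> l\<^sub>1') \<cdot> (b\<^sub>0 \<diamondop> b\<^sub>0')) ((r\<^sub>2 \<diamondop> r\<^sub>2') \<cdot> (b\<^sub>1 \<diamondop> b\<^sub>1')) (dar F (b\<^sub>0 \<diamondop> b\<^sub>0') ?s \<uplus> dar F (b\<^sub>1 \<diamondop> b\<^sub>1') ?t)"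
    by (rule cls_cmp[OF _ _ pullback_prd[OF b b']]) (use ty in \<open>simp_all add: span_def dec_simps\<close>)
  moreover have "dar F (b\<^sub>0 \<diamondop> b\<^sub>0') ?s \<uplus> dar F (b\<^sub>1 \<diamondop> b\<^sub>1') ?t =
      (dar F (b\<^sub>0 \<cdot> p) s \<uplus> dar F (b\<^sub>0' \<cdot> p') s') \<uplus> (dar F (b\<^sub>1 \<cdot> p) t \<uplus> dar F (b\<^sub>1' \<cdot> p') t')"
    using ty by (simp add: dec_simps p_def p'_def)
  moreover have "\<dots> = (dar F (b\<^sub>0 \<cdot> p) s \<uplus> dar F (b\<^sub>1 \<cdot> p) t) \<uplus> (dar F (b\<^sub>0' \<cdot> p') s' \<uplus> dar F (b\<^sub>1' \<cdot> p') t')"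
    using ty by (intro add_interchange[of _ "dm C b\<^sub>1 \<^bold>\<times> dm C b\<^sub>1'"]) (simp_all add: dec_simps p_def p'_def)
  moreover have "\<dots> = dar F p (dar F b\<^sub>0 s \<uplus> dar F b\<^sub>1 t) \<uplus> dar F p' (dar F b\<^sub>0' s' \<uplus> dar F b\<^sub>1' t')"
    using ty by (simp add: dec_simps p_def p'_def)
  moreover have "(l\<^sub>1 \<diamondop> l\<^sub>1') \<cdot> (b\<^sub>0 \<diamondop> b\<^sub>0') = (l\<^sub>1 \<cdot> b\<^sub>0) \<diamondop> (l\<^sub>1' \<cdot> b\<^sub>0')" "(r\<^sub>2 \<diamondop> r\<^sub>2') \<cdot> (b\<^sub>1 \<diamondop> b\<^sub>1') = (r\<^sub>2 \<cdot> b\<^sub>1) \<diamondop> (r\<^sub>2' \<cdot> b\<^sub>1')"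
    using ty by (simp_all add: prd_simps lin_ar_imp_ar)
  ultimately show ?thesis
    by simp
qed

text \<open>Composing with the associator from the left changes the right legs, and composing from the right changes the
  left legs by its inverse. The associator of the apexes identifies the two results. The unit and
  symmetry isomorphisms below behave in the same way.\<close>

lemma H_assoc_natural:
  assumes S: "S \<in> Hom H X X'" and T: "T \<in> Hom H Y Y'" and U: "U \<in> Hom H Z Z'"
  shows "assoc H X' Y' Z' \<bullet> ((S \<otimes> T) \<otimes> U) = (S \<otimes> (T \<otimes> U)) \<bullet> assoc H X Y Z"
proof -
  obtain l r s where s: "S = cls l r s" "lin_ar l" "lin_ar r" "dm C l = dm C r" "s \<in> dob F (dm C r)"
    "cd C l = X" "cd C r = X'"
    using S by (rule Hom_HE)
  obtain l' r' t where t: "T = cls l' r' t" "lin_ar l'" "lin_ar r'" "dm C l' = dm C r'" "t \<in> dob F (dm C r')"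
    "cd C l' = Y" "cd C r' = Y'"
    using T by (rule Hom_HE)
  obtain l'' r'' u where u: "U = cls l'' r'' u" "lin_ar l''" "lin_ar r''" "dm C l'' = dm C r''" "u \<in> dob F (dm C r'')"
    "cd C l'' = Z" "cd C r'' = Z'"
    using U by (rule Hom_HE)
  note ty = s(2-5) t(2-5) u(2-5)
  let ?N = "dm C r" and ?M = "dm C r'" and ?P = "dm C r''"
  have ob: "X \<in> ob C" "Y \<in> ob C" "Z \<in> ob C" "X' \<in> ob C" "Y' \<in> ob C" "Z' \<in> ob C" "?N \<in> ob C" "?M \<in> ob C" "?P \<in> ob C"
    using s t u by (auto simp: dec_simps)
  define L where "L = (l \<diamondop> l') \<diamondop> l''"
  define R where "R = (r \<diamondop> r') \<diamondop> r''"
  define D where "D = dar F (pr\<^sub>0 C (?N \<^bold>\<times> ?M) ?P) (dar F (pr\<^sub>0 C ?N ?M) s \<uplus> dar F (pr\<^sub>1 C ?N ?M) t)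
    \<uplus> dar F (pr\<^sub>1 C (?N \<^bold>\<times> ?M) ?P) u"
  define L' where "L' = l \<diamondop> (l' \<diamondop> l'')"
  define R' where "R' = r \<diamondop> (r' \<diamondop> r'')"
  define D' where "D' = dar F (pr\<^sub>0 C ?N (?M \<^bold>\<times> ?P)) s
    \<uplus> dar F (pr\<^sub>1 C ?N (?M \<^bold>\<times> ?P)) (dar F (pr\<^sub>0 C ?M ?P) t \<uplus> dar F (pr\<^sub>1 C ?M ?P) u)"
  have "(S \<otimes> T) \<otimes> U = cls L R D"
    unfolding s(1) t(1) u(1) L_def R_def D_def using ty ob
    by (simp add: tensor_cls lin_simps pr_typing pair_typing cmp_typing prd_arr_def add_in dar_in)
  moreover have "S \<otimes> (T \<otimes> U) = cls L' R' D'"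
    unfolding s(1) t(1) u(1) L'_def R'_def D'_def using ty ob
    by (simp add: tensor_cls lin_simps pr_typing pair_typing cmp_typing prd_arr_def add_in dar_in)
  moreover have tL: "lin_ar L" "lin_ar R" "dm C L = (?N \<^bold>\<times> ?M) \<^bold>\<times> ?P" "dm C R = (?N \<^bold>\<times> ?M) \<^bold>\<times> ?P"
      "cd C L = (X \<^bold>\<times> Y) \<^bold>\<times> Z" "cd C R = (X' \<^bold>\<times> Y') \<^bold>\<times> Z'" "D \<in> dob F (dm C R)"
    and tL': "lin_ar L'" "lin_ar R'" "dm C L' = ?N \<^bold>\<times> ?M \<^bold>\<times> ?P" "dm C R' = ?N \<^bold>\<times> ?M \<^bold>\<times> ?P"
      "cd C L' = X \<^bold>\<times> Y \<^bold>\<times> Z" "cd C R' = X' \<^bold>\<times> Y' \<^bold>\<times> Z'" "D' \<in> dob F (dm C R')"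
    using ty ob s t u by (simp_all add: L_def R_def D_def L'_def R'_def D'_def dec_simps)
  moreover have "cls L (asc X' Y' Z' \<cdot> R) D = cls (asc_inv X Y Z \<cdot> L') R' D'"
  proof (rule cls_eqI)
    let ?a = "asc ?N ?M ?P" and ?b = "asc_inv ?N ?M ?P"
    have "dar F ?a D' = D"
      using ty ob by (simp add: D_def D'_def asc_def dec_simps add_assoc[of _ "(?N \<^bold>\<times> ?M) \<^bold>\<times> ?P"])
    moreover have "(asc_inv X Y Z \<cdot> L') \<cdot> ?a = L" "R' \<cdot> ?a = asc X' Y' Z' \<cdot> R"
      using ty ob s t u by (simp_all add: L_def L'_def R_def R'_def asc_def asc_inv_def dec_simps)
    ultimately show "span_iso ?a ?b L (asc X' Y' Z' \<cdot> R) D (asc_inv X Y Z \<cdot> L') R' D'"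
      using ob tL tL' asc_inverse[of ?N ?M ?P]
      by (simp add: span_iso_def structure_typing inverse_pair_def dec_simps)
  qed (use ob tL tL' in \<open>simp_all add: span_def dec_simps structure_typing\<close>)
  moreover have "graph (asc X' Y' Z') \<bullet> cls L R D = cls L (asc X' Y' Z' \<cdot> R) D"
    using ob tL by (intro graph_cmp_cls) (simp_all add: structure_typing)
  moreover have "cls L' R' D' \<bullet> graph (asc X Y Z) = cls (asc_inv X Y Z \<cdot> L') R' D'"
    using ob tL' asc_inverse by (intro cls_cmp_graph_iso) (simp_all add: structure_typing)
  ultimately show ?thesis
    using ob by (simp add: H_structure)
qed

lemma H_lunit_natural:
  assumes "S \<in> Hom H X X'"
  shows "lunit H X' \<bullet> (ide H (trm C) \<otimes> S) = S \<bullet> lunit H X"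
proof -
  obtain l r s where s: "S = cls l r s" "lin_ar l" "lin_ar r" "dm C l = dm C r" "s \<in> dob F (dm C r)"
    "cd C l = X" "cd C r = X'"
    using assms by (rule Hom_HE)
  let ?N = "dm C r"
  have ob: "X \<in> ob C" "X' \<in> ob C" "?N \<in> ob C"
    using s by (auto simp: dec_simps)
  let ?L = "ide C (trm C) \<diamondop> l" and ?R = "ide C (trm C) \<diamondop> r" and ?D = "dar F (pr\<^sub>1 C (trm C) ?N) s"
  have "ide H (trm C) \<otimes> S = cls ?L ?R ?D"
    unfolding s(1) using s(2-) ob by (simp add: H_structure graph_def tensor_cls dec_simps)
  moreover have "graph (pr\<^sub>1 C (trm C) X') \<bullet> cls ?L ?R ?D = cls ?L (pr\<^sub>1 C (trm C) X' \<cdot> ?R) ?D"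
    by (rule graph_cmp_cls) (use s(2-) ob in \<open>simp_all add: dec_simps\<close>)
  moreover have "S \<bullet> graph (pr\<^sub>1 C (trm C) X) = cls (\<langle>bang C X, ide C X\<rangle> \<cdot> l) r s"
    unfolding s(1) by (rule cls_cmp_graph_iso[OF _ _ _ _ lunit_inverse]) (use s(2-) ob in \<open>simp_all add: dec_simps\<close>)
  moreover have "cls ?L (pr\<^sub>1 C (trm C) X' \<cdot> ?R) ?D = cls (\<langle>bang C X, ide C X\<rangle> \<cdot> l) r s"
  proof (rule cls_eqI)
    have "pr\<^sub>0 C (trm C) ?N = bang C (trm C \<^bold>\<times> ?N)"
      using ob eq_bang[of "pr\<^sub>0 C (trm C) ?N"] by (simp add: prd_simps)
    then have "(\<langle>bang C X, ide C X\<rangle> \<cdot> l) \<cdot> pr\<^sub>1 C (trm C) ?N = ?L"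
      using s(2-) ob by (simp add: dec_simps)
    then show "span_iso (pr\<^sub>1 C (trm C) ?N) \<langle>bang C ?N, ide C ?N\<rangle> ?L (pr\<^sub>1 C (trm C) X' \<cdot> ?R) ?D
        (\<langle>bang C X, ide C X\<rangle> \<cdot> l) r s"
      using s(2-) ob lunit_inverse[of ?N] by (simp add: span_iso_def inverse_pair_def dec_simps)
  qed (use s(2-) ob in \<open>simp_all add: span_def dec_simps\<close>)
  ultimately show ?thesis
    using ob by (simp add: H_structure)
qed

lemma H_runit_natural:
  assumes "S \<in> Hom H X X'"
  shows "runit H X' \<bullet> (S \<otimes> ide H (trm C)) = S \<bullet> runit H X"
proof -
  obtain l r s where s: "S = cls l r s" "lin_ar l" "lin_ar r" "dm C l = dm C r" "s \<in> dob F (dm C r)"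
    "cd C l = X" "cd C r = X'"
    using assms by (rule Hom_HE)
  let ?N = "dm C r"
  have ob: "X \<in> ob C" "X' \<in> ob C" "?N \<in> ob C"
    using s by (auto simp: dec_simps)
  let ?L = "l \<diamondop> ide C (trm C)" and ?R = "r \<diamondop> ide C (trm C)" and ?D = "dar F (pr\<^sub>0 C ?N (trm C)) s"
  have "S \<otimes> ide H (trm C) = cls ?L ?R ?D"
    unfolding s(1) using s(2-) ob by (simp add: H_structure graph_def tensor_cls dec_simps)
  moreover have "graph (pr\<^sub>0 C X' (trm C)) \<bullet> cls ?L ?R ?D = cls ?L (pr\<^sub>0 C X' (trm C) \<cdot> ?R) ?D"
    by (rule graph_cmp_cls) (use s(2-) ob in \<open>simp_all add: dec_simps\<close>)
  moreover have "S \<bullet> graph (pr\<^sub>0 C X (trm C)) = cls (\<langle>ide C X, bang C X\<rangle> \<cdot> l) r s"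
    unfolding s(1) by (rule cls_cmp_graph_iso[OF _ _ _ _ runit_inverse]) (use s(2-) ob in \<open>simp_all add: dec_simps\<close>)
  moreover have "cls ?L (pr\<^sub>0 C X' (trm C) \<cdot> ?R) ?D = cls (\<langle>ide C X, bang C X\<rangle> \<cdot> l) r s"
  proof (rule cls_eqI)
    have "pr\<^sub>1 C ?N (trm C) = bang C (?N \<^bold>\<times> trm C)"
      using ob eq_bang[of "pr\<^sub>1 C ?N (trm C)"] by (simp add: prd_simps)
    then have "(\<langle>ide C X, bang C X\<rangle> \<cdot> l) \<cdot> pr\<^sub>0 C ?N (trm C) = ?L"
      using s(2-) ob by (simp add: dec_simps)
    then show "span_iso (pr\<^sub>0 C ?N (trm C)) \<langle>ide C ?N, bang C ?N\<rangle> ?L (pr\<^sub>0 C X' (trm C) \<cdot> ?R) ?D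
        (\<langle>ide C X, bang C X\<rangle> \<cdot> l) r s"
      using s(2-) ob runit_inverse[of ?N] by (simp add: span_iso_def inverse_pair_def dec_simps)
  qed (use s(2-) ob in \<open>simp_all add: span_def dec_simps\<close>)
  ultimately show ?thesis
    using ob by (simp add: H_structure)
qed

lemma H_swap_natural:
  assumes S: "S \<in> Hom H X X'" and T: "T \<in> Hom H Y Y'"
  shows "swap H X' Y' \<bullet> (S \<otimes> T) = (T \<otimes> S) \<bullet> swap H X Y"
proof -
  obtain l r s where s: "S = cls l r s" "lin_ar l" "lin_ar r" "dm C l = dm C r" "s \<in> dob F (dm C r)"
    "cd C l = X" "cd C r = X'"
    using S by (rule Hom_HE)
  obtain l' r' t where t: "T = cls l' r' t" "lin_ar l'" "lin_ar r'" "dm C l' = dm C r'" "t \<in> dob F (dm C r')"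
    "cd C l' = Y" "cd C r' = Y'"
    using T by (rule Hom_HE)
  note ty = s(2-) t(2-)
  let ?N = "dm C r" and ?M = "dm C r'"
  have ob: "X \<in> ob C" "Y \<in> ob C" "X' \<in> ob C" "Y' \<in> ob C" "?N \<in> ob C" "?M \<in> ob C"
    using s t by (auto simp: dec_simps)
  let ?D = "dar F (pr\<^sub>0 C ?N ?M) s \<uplus> dar F (pr\<^sub>1 C ?N ?M) t"
  let ?D' = "dar F (pr\<^sub>0 C ?M ?N) t \<uplus> dar F (pr\<^sub>1 C ?M ?N) s"
  have "S \<otimes> T = cls (l \<diamondop> l') (r \<diamondop> r') ?D" "T \<otimes> S = cls (l' \<diamondop> l) (r' \<diamondop> r) ?D'"
    unfolding s(1) t(1) using ty by (simp_all add: tensor_cls)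
  moreover have "graph (swp X' Y') \<bullet> cls (l \<diamondop> l') (r \<diamondop> r') ?D = cls (l \<diamondop> l') (swp X' Y' \<cdot> (r \<diamondop> r')) ?D"
    by (rule graph_cmp_cls) (use ty ob in \<open>simp_all add: dec_simps structure_typing\<close>)
  moreover have "cls (l' \<diamondop> l) (r' \<diamondop> r) ?D' \<bullet> graph (swp X Y) = cls (swp Y X \<cdot> (l' \<diamondop> l)) (r' \<diamondop> r) ?D'"
    by (rule cls_cmp_graph_iso[OF _ _ _ _ swp_inverse]) (use ty ob in \<open>simp_all add: dec_simps structure_typing\<close>)
  moreover have "cls (l \<diamondop> l') (swp X' Y' \<cdot> (r \<diamondop> r')) ?D = cls (swp Y X \<cdot> (l' \<diamondop> l)) (r' \<diamondop> r) ?D'"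
  proof (rule cls_eqI)
    have "dar F (swp ?N ?M) ?D' = ?D"
      using ty ob add_commute[of _ "?N \<^bold>\<times> ?M" "dar F (pr\<^sub>1 C ?N ?M) t"] by (simp add: swp_def dec_simps)
    moreover have "(swp Y X \<cdot> (l' \<diamondop> l)) \<cdot> swp ?N ?M = l \<diamondop> l'" "(r' \<diamondop> r) \<cdot> swp ?N ?M = swp X' Y' \<cdot> (r \<diamondop> r')"
      using ty ob by (simp_all add: swp_def dec_simps)
    ultimately show "span_iso (swp ?N ?M) (swp ?M ?N) (l \<diamondop> l') (swp X' Y' \<cdot> (r \<diamondop> r')) ?D
        (swp Y X \<cdot> (l' \<diamondop> l)) (r' \<diamondop> r) ?D'"
      using ty ob swp_inverse[of ?N ?M] by (simp add: span_iso_def structure_typing inverse_pair_def dec_simps)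
  qed (use ty ob in \<open>simp_all add: span_def dec_simps structure_typing\<close>)
  ultimately show ?thesis
    using ob by (simp add: H_structure)
qed

lemma graph_Iso: "inverse_pair i j \<Longrightarrow> X = dm C i \<Longrightarrow> Y = cd C i \<Longrightarrow> graph i \<in> Iso H X Y"
  unfolding Iso_def using graph_inverse_arrows by blast

lemma monoidal_category_H: "monoidal_category H"
proof (intro monoidal_category.intro monoidal_category_axioms.intro category_H)
  show "unit H \<in> ob H"
    by (simp add: H_sel trm_ob)
next
  fix X Y assume ob: "X \<in> ob H" "Y \<in> ob H"
  then show "X \<odot>\<^bsub>H\<^esub> Y \<in> ob H" "ide H X \<star>\<^bsub>H\<^esub> ide H Y = ide H (X \<odot>\<^bsub>H\<^esub> Y)"
    "(ide H X \<star>\<^bsub>H\<^esub> lunit H Y) \<cdot>\<^bsub>H\<^esub> assoc H X (unit H) Y = runit H X \<star>\<^bsub>H\<^esub> ide H Y"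
    by (simp_all add: struct_simps tensor_graph graph_cmp dec_simps)
next
  fix S T X Y Z W assume "S \<in> Hom H X Y" "T \<in> Hom H Z W"
  then show "S \<star>\<^bsub>H\<^esub> T \<in> Hom H (X \<odot>\<^bsub>H\<^esub> Z) (Y \<odot>\<^bsub>H\<^esub> W)"
    by (simp add: H_sel H_tensor_Hom)
next
  fix S T S' T' X Y Z X' Y' Z'
  assume "S \<in> Hom H X Y" "T \<in> Hom H Y Z" "S' \<in> Hom H X' Y'" "T' \<in> Hom H Y' Z'"
  then show "(T \<cdot>\<^bsub>H\<^esub> S) \<star>\<^bsub>H\<^esub> (T' \<cdot>\<^bsub>H\<^esub> S') = (T \<star>\<^bsub>H\<^esub> T') \<cdot>\<^bsub>H\<^esub> (S \<star>\<^bsub>H\<^esub> S')"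
    unfolding H_sel by (rule H_interchange)
next
  fix X Y Z assume "X \<in> ob H" "Y \<in> ob H" "Z \<in> ob H"
  then show "assoc H X Y Z \<in> Iso H ((X \<odot>\<^bsub>H\<^esub> Y) \<odot>\<^bsub>H\<^esub> Z) (X \<odot>\<^bsub>H\<^esub> (Y \<odot>\<^bsub>H\<^esub> Z))"
    by (auto simp: H_sel H_structure structure_typing intro!: graph_Iso[OF asc_inverse])
next
  fix X assume "X \<in> ob H"
  then show "lunit H X \<in> Iso H (unit H \<odot>\<^bsub>H\<^esub> X) X" "runit H X \<in> Iso H (X \<odot>\<^bsub>H\<^esub> unit H) X"
    by (auto simp: H_sel H_structure pr_typing trm_ob intro!: graph_Iso[OF lunit_inverse] graph_Iso[OF runit_inverse])
next
  fix S T U X X' Y Y' Z Z' assume "S \<in> Hom H X X'" "T \<in> Hom H Y Y'" "U \<in> Hom H Z Z'"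
  then show "assoc H X' Y' Z' \<cdot>\<^bsub>H\<^esub> ((S \<star>\<^bsub>H\<^esub> T) \<star>\<^bsub>H\<^esub> U) = (S \<star>\<^bsub>H\<^esub> (T \<star>\<^bsub>H\<^esub> U)) \<cdot>\<^bsub>H\<^esub> assoc H X Y Z"
    unfolding H_sel by (rule H_assoc_natural)
next
  fix S X X' assume "S \<in> Hom H X X'"
  then show "lunit H X' \<cdot>\<^bsub>H\<^esub> (ide H (unit H) \<star>\<^bsub>H\<^esub> S) = S \<cdot>\<^bsub>H\<^esub> lunit H X"
    "runit H X' \<cdot>\<^bsub>H\<^esub> (S \<star>\<^bsub>H\<^esub> ide H (unit H)) = S \<cdot>\<^bsub>H\<^esub> runit H X"
    unfolding H_sel by (rule H_lunit_natural H_runit_natural)+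
next
  fix W X Y Z assume "W \<in> ob H" "X \<in> ob H" "Y \<in> ob H" "Z \<in> ob H"
  then show "(ide H W \<star>\<^bsub>H\<^esub> assoc H X Y Z) \<cdot>\<^bsub>H\<^esub> assoc H W (X \<odot>\<^bsub>H\<^esub> Y) Z \<cdot>\<^bsub>H\<^esub> (assoc H W X Y \<star>\<^bsub>H\<^esub> ide H Z)
    = assoc H W X (Y \<odot>\<^bsub>H\<^esub> Z) \<cdot>\<^bsub>H\<^esub> assoc H (W \<odot>\<^bsub>H\<^esub> X) Y Z"
    by (simp add: struct_simps tensor_graph graph_cmp dec_simps)
qed

lemma symmetric_monoidal_category_H: "symmetric_monoidal_category H"
proof (intro symmetric_monoidal_category.intro symmetric_monoidal_category_axioms.intro monoidal_category_H)
  fix X Y assume "X \<in> ob H" "Y \<in> ob H"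
  then show "swap H X Y \<in> Hom H (X \<odot>\<^bsub>H\<^esub> Y) (Y \<odot>\<^bsub>H\<^esub> X)" "swap H Y X \<cdot>\<^bsub>H\<^esub> swap H X Y = ide H (X \<odot>\<^bsub>H\<^esub> Y)"
    by (simp_all add: struct_simps graph_Hom graph_cmp dec_simps)
next
  fix S T X X' Y Y' assume "S \<in> Hom H X X'" "T \<in> Hom H Y Y'"
  then show "swap H X' Y' \<cdot>\<^bsub>H\<^esub> (S \<star>\<^bsub>H\<^esub> T) = (T \<star>\<^bsub>H\<^esub> S) \<cdot>\<^bsub>H\<^esub> swap H X Y"
    unfolding H_sel by (rule H_swap_natural)
next
  fix X Y Z assume "X \<in> ob H" "Y \<in> ob H" "Z \<in> ob H"
  then show "(ide H Y \<star>\<^bsub>H\<^esub> swap H X Z) \<cdot>\<^bsub>H\<^esub> assoc H Y X Z \<cdot>\<^bsub>H\<^esub> (swap H X Y \<star>\<^bsub>H\<^esub> ide H Z)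
    = assoc H Y Z X \<cdot>\<^bsub>H\<^esub> swap H X (Y \<odot>\<^bsub>H\<^esub> Z) \<cdot>\<^bsub>H\<^esub> assoc H X Y Z"
    by (simp add: struct_simps tensor_graph graph_cmp dec_simps)
qed

text \<open>The linear map \<open>(A \<times> B) \<times> (A' \<times> B') \<rightarrow> (A \<times> A') \<times> (B \<times> B')\<close> that exchanges the two middle factors.\<close>

definition mid :: "'o \<Rightarrow> 'o \<Rightarrow> 'o \<Rightarrow> 'o \<Rightarrow> 'm" where
  "mid A B A' B' = \<langle>pr\<^sub>0 C A B \<diamondop> pr\<^sub>0 C A' B', pr\<^sub>1 C A B \<diamondop> pr\<^sub>1 C A' B'\<rangle>"

lemma inv_arr_graph: "inverse_pair i j \<Longrightarrow> inv_arr H (graph i) = graph j"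
  using category.inv_arr_eqI[OF category_H graph_inverse_arrows] .

lemma mid_swap_eq:
  assumes "X \<in> ob C" "Y \<in> ob C" "Z \<in> ob C" "W \<in> ob C"
  shows "mid_swap H X Y Z W = graph (mid X Y Z W)"
  using assms
  by (simp add: mid_swap_def H_sel H_structure inv_arr_graph[OF asc_inverse] prd_ob)
     (simp add: struct_simps tensor_graph graph_cmp dec_simps mid_def)

lemma mid_inverse:
  assumes "X \<in> ob C" "Y \<in> ob C" "Z \<in> ob C" "W \<in> ob C"
  shows "inverse_pair (mid X Y Z W) (mid X Z Y W)"
  using assms by (simp add: inverse_pair_def mid_def dec_simps)

text \<open>A diagonal has the projections as retractions, hence is monic; this is the special law.\<close>

lemma diag_pullback:
  assumes "X \<in> ob C"
  shows "is_pullback (Lin C) (diag X) (diag X) (ide C X) (ide C X)"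
proof (rule pullbackI)
  fix a\<^sub>0 a\<^sub>1
  assume a: "lin_ar a\<^sub>0" "lin_ar a\<^sub>1" "dm C a\<^sub>0 = dm C a\<^sub>1" "cd C a\<^sub>0 = dm C (diag X)" "cd C a\<^sub>1 = dm C (diag X)"
    "diag X \<cdot> a\<^sub>0 = diag X \<cdot> a\<^sub>1"
  then have "pr\<^sub>0 C X X \<cdot> diag X \<cdot> a\<^sub>0 = pr\<^sub>0 C X X \<cdot> diag X \<cdot> a\<^sub>1"
    by simp
  then have "a\<^sub>0 = a\<^sub>1"
    using a(1-5) assms by (simp add: diag_def dec_simps)
  then show "\<exists>h. lin_ar h \<and> dm C h = dm C a\<^sub>1 \<and> cd C h = dm C (ide C X) \<and> ide C X \<cdot> h = a\<^sub>0 \<and> ide C X \<cdot> h = a\<^sub>1"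
    using a(1-5) assms by (intro exI[of _ a\<^sub>1]) (simp add: diag_def dec_simps)
qed (use assms in \<open>simp_all add: diag_def dec_simps\<close>)

text \<open>The square says that \<open>(x, x, y) = (u, v, v)\<close> holds exactly if all entries are equal. With
  the Beck-Chevalley rule it becomes the Frobenius law.\<close>

lemma frobenius_pullback:
  assumes X: "X \<in> ob C"
  shows "is_pullback (Lin C) (asc X X X \<cdot> (diag X \<diamondop> ide C X)) (ide C X \<diamondop> diag X) (diag X) (diag X)"
    (is "is_pullback _ ?f ?g _ _")
proof (rule pullbackI)
  fix a\<^sub>0 a\<^sub>1
  assume a: "lin_ar a\<^sub>0" "lin_ar a\<^sub>1" "dm C a\<^sub>0 = dm C a\<^sub>1" "cd C a\<^sub>0 = dm C ?f" "cd C a\<^sub>1 = dm C ?g" "?f \<cdot> a\<^sub>0 = ?g \<cdot> a\<^sub>1"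
  define W where "W = dm C a\<^sub>1"
  define x y u v where xy: "x = pr\<^sub>0 C X X \<cdot> a\<^sub>0" and "y = pr\<^sub>1 C X X \<cdot> a\<^sub>0" and "u = pr\<^sub>0 C X X \<cdot> a\<^sub>1"
    and "v = pr\<^sub>1 C X X \<cdot> a\<^sub>1"
  note xy = this
  have ty: "lin_ar x" "lin_ar y" "lin_ar u" "lin_ar v" "dm C x = W" "dm C y = W" "dm C u = W" "dm C v = W"
    "cd C x = X" "cd C y = X" "cd C u = X" "cd C v = X"
    using a(1-5) X by (simp_all add: xy W_def structure_typing dec_simps)
  have a': "a\<^sub>0 = \<langle>x, y\<rangle>" "a\<^sub>1 = \<langle>u, v\<rangle>"
    using a(1-5) X by (simp_all add: xy structure_typing dec_simps)
  have e: "\<langle>x, \<langle>x, y\<rangle>\<rangle> = \<langle>u, \<langle>v, v\<rangle>\<rangle>"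
    using a(6) unfolding a' using ty X by (simp add: asc_def diag_def dec_simps)
  have "x = u" and xy': "\<langle>x, y\<rangle> = \<langle>v, v\<rangle>"
    by (rule pair_eqD[OF e]; use ty X in \<open>simp add: dec_simps\<close>)+
  moreover have "x = v" "y = v"
    by (rule pair_eqD[OF xy']; use ty X in \<open>simp add: dec_simps\<close>)+
  ultimately have "diag X \<cdot> v = a\<^sub>0" "diag X \<cdot> v = a\<^sub>1"
    unfolding a' using ty X by (simp_all add: diag_def dec_simps)
  then show "\<exists>h. lin_ar h \<and> dm C h = dm C a\<^sub>1 \<and> cd C h = dm C (diag X) \<and> diag X \<cdot> h = a\<^sub>0 \<and> diag X \<cdot> h = a\<^sub>1"
    unfolding W_def[symmetric] using ty X by (intro exI[of _ v]) (simp add: structure_typing)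
next
  fix h k
  assume a: "lin_ar h" "lin_ar k" "dm C h = dm C k" "cd C h = dm C (diag X)" "cd C k = dm C (diag X)"
    "diag X \<cdot> h = diag X \<cdot> k"
  then have "pr\<^sub>0 C X X \<cdot> diag X \<cdot> h = pr\<^sub>0 C X X \<cdot> diag X \<cdot> k"
    by simp
  then show "h = k"
    using a(1-5) X by (simp add: diag_def dec_simps)
qed (use X in \<open>simp_all add: asc_def diag_def dec_simps\<close>)

text \<open>The mirror image of the previous square, obtained by moving the associator to the other side.\<close>

lemma frobenius_pullback':
  assumes X: "X \<in> ob C"
  shows "is_pullback (Lin C) (asc_inv X X X \<cdot> (ide C X \<diamondop> diag X)) (diag X \<diamondop> ide C X) (diag X) (diag X)"
    (is "is_pullback _ ?f ?g _ _")
proof (rule pullbackI)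
  note p = pullback_sym[OF frobenius_pullback[OF X]]
  have ac: "asc X X X \<cdot> ?f = ide C X \<diamondop> diag X"
    using X by (simp add: asc_def asc_inv_def diag_def dec_simps)
  fix a\<^sub>0 a\<^sub>1
  assume a: "lin_ar a\<^sub>0" "lin_ar a\<^sub>1" "dm C a\<^sub>0 = dm C a\<^sub>1" "cd C a\<^sub>0 = dm C ?f" "cd C a\<^sub>1 = dm C ?g" "?f \<cdot> a\<^sub>0 = ?g \<cdot> a\<^sub>1"
  have "(asc X X X \<cdot> ?f) \<cdot> a\<^sub>0 = (asc X X X \<cdot> ?g) \<cdot> a\<^sub>1"
    using a X assoc_cmp[of a\<^sub>0 ?f "asc X X X"] assoc_cmp[of a\<^sub>1 ?g "asc X X X"]
    by (simp add: structure_typing lin_simps prd_simps)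
  then show "\<exists>h. lin_ar h \<and> dm C h = dm C a\<^sub>1 \<and> cd C h = dm C (diag X) \<and> diag X \<cdot> h = a\<^sub>0 \<and> diag X \<cdot> h = a\<^sub>1"
    unfolding ac using a(1-5) X by (intro pullback_lift[OF p]) (simp_all add: structure_typing dec_simps)
next
  fix h k
  assume a: "lin_ar h" "lin_ar k" "dm C h = dm C k" "cd C h = dm C (diag X)" "cd C k = dm C (diag X)"
    "diag X \<cdot> h = diag X \<cdot> k"
  show "h = k"
    by (rule pullback_eqI[OF frobenius_pullback[OF X] a(1-6) a(6)])
qed (use X in \<open>simp_all add: asc_inv_def diag_def dec_simps\<close>)

lemma hypergraph_category_H: "hypergraph_category H"
proof (intro hypergraph_category.intro hypergraph_category_axioms.intro symmetric_monoidal_category_H)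
  fix X assume "X \<in> ob H"
  then have X: "X \<in> ob C"
    by (simp add: H_sel)
  note ts = struct_simps tensor_graph tensor_cograph graph_cmp cograph_cmp dec_simps
  have [simp]: "ide H X = cograph (ide C X)"
    using X by (simp add: H_structure graph_ide)
  show "mu H X \<in> Hom H (X \<odot>\<^bsub>H\<^esub> X) X" "eta H X \<in> Hom H (unit H) X"
    "delta H X \<in> Hom H X (X \<odot>\<^bsub>H\<^esub> X)" "eps H X \<in> Hom H X (unit H)"
    using X by (simp_all add: ts graph_Hom cograph_Hom)
  \<comment> \<open>the monoid laws are equations of cographs, with the coherence isomorphism turned into a cograph\<close>
  show "mu H X \<cdot>\<^bsub>H\<^esub> (mu H X \<star>\<^bsub>H\<^esub> ide H X) = mu H X \<cdot>\<^bsub>H\<^esub> (ide H X \<star>\<^bsub>H\<^esub> mu H X) \<cdot>\<^bsub>H\<^esub> assoc H X X X"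
    using X graph_iso[OF asc_inverse[of X X X]] by (simp add: ts)
  show "mu H X \<cdot>\<^bsub>H\<^esub> (eta H X \<star>\<^bsub>H\<^esub> ide H X) = lunit H X"
    using X graph_iso[OF lunit_inverse[of X]] by (simp add: ts)
  show "mu H X \<cdot>\<^bsub>H\<^esub> (ide H X \<star>\<^bsub>H\<^esub> eta H X) = runit H X"
    using X graph_iso[OF runit_inverse[of X]] by (simp add: ts)
  show "mu H X \<cdot>\<^bsub>H\<^esub> swap H X X = mu H X"
    using X graph_iso[OF swp_inverse[of X X]] by (simp add: ts)
  \<comment> \<open>the comonoid laws are equations of graphs\<close>
  show "assoc H X X X \<cdot>\<^bsub>H\<^esub> (delta H X \<star>\<^bsub>H\<^esub> ide H X) \<cdot>\<^bsub>H\<^esub> delta H X = (ide H X \<star>\<^bsub>H\<^esub> delta H X) \<cdot>\<^bsub>H\<^esub> delta H X"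
    using X by (simp add: ts flip: graph_ide)
  show "lunit H X \<cdot>\<^bsub>H\<^esub> (eps H X \<star>\<^bsub>H\<^esub> ide H X) \<cdot>\<^bsub>H\<^esub> delta H X = ide H X"
    using X by (simp add: ts flip: graph_ide)
  show "runit H X \<cdot>\<^bsub>H\<^esub> (ide H X \<star>\<^bsub>H\<^esub> eps H X) \<cdot>\<^bsub>H\<^esub> delta H X = ide H X"
    using X by (simp add: ts flip: graph_ide)
  show "swap H X X \<cdot>\<^bsub>H\<^esub> delta H X = delta H X"
    using X by (simp add: ts)
  show "mu H X \<cdot>\<^bsub>H\<^esub> delta H X = ide H X"
    using X cograph_cmp_graph[OF diag_pullback[OF X]]
    by (simp add: H_sel H_structure graph_ide cograph_cmp dec_simps)
  have di: "graph (diag X) \<otimes> graph (ide C X) = graph (diag X \<diamondop> ide C X)"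
     "graph (ide C X) \<otimes> graph (diag X) = graph (ide C X \<diamondop> diag X)"
     "cograph (diag X) \<otimes> cograph (ide C X) = cograph (diag X \<diamondop> ide C X)"
     "cograph (ide C X) \<otimes> cograph (diag X) = cograph (ide C X \<diamondop> diag X)"
    using X by (simp_all add: tensor_graph tensor_cograph lin_ide structure_typing)
  have "graph (asc X X X) \<bullet> graph (diag X \<diamondop> ide C X) = graph (asc X X X \<cdot> (diag X \<diamondop> ide C X))"
    using X by (intro graph_cmp) (simp_all add: lin_simps structure_typing prd_simps)
  then show "(ide H X \<star>\<^bsub>H\<^esub> mu H X) \<cdot>\<^bsub>H\<^esub> assoc H X X X \<cdot>\<^bsub>H\<^esub> (delta H X \<star>\<^bsub>H\<^esub> ide H X) = delta H X \<cdot>\<^bsub>H\<^esub> mu H X"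
    using X cograph_cmp_graph[OF frobenius_pullback[OF X]] di graph_ide[OF X]
    by (simp add: H_sel H_structure)
  have "graph (asc_inv X X X) \<bullet> graph (ide C X \<diamondop> diag X) = graph (asc_inv X X X \<cdot> (ide C X \<diamondop> diag X))"
    using X by (intro graph_cmp) (simp_all add: lin_simps structure_typing prd_simps)
  then show "(mu H X \<star>\<^bsub>H\<^esub> ide H X) \<cdot>\<^bsub>H\<^esub> inv_arr H (assoc H X X X) \<cdot>\<^bsub>H\<^esub> (ide H X \<star>\<^bsub>H\<^esub> delta H X) = delta H X \<cdot>\<^bsub>H\<^esub> mu H X"
    using X cograph_cmp_graph[OF frobenius_pullback'[OF X]] di graph_ide[OF X]
    by (simp add: H_sel H_structure inv_arr_graph[OF asc_inverse])
next
  fix X Y assume "X \<in> ob H" "Y \<in> ob H"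
  then have ob: "X \<in> ob C" "Y \<in> ob C"
    by (simp_all add: H_sel)
  note ts = struct_simps tensor_graph tensor_cograph graph_cmp cograph_cmp dec_simps
  show "mu H (X \<odot>\<^bsub>H\<^esub> Y) = (mu H X \<star>\<^bsub>H\<^esub> mu H Y) \<cdot>\<^bsub>H\<^esub> mid_swap H X Y X Y"
    using ob graph_iso[OF mid_inverse[of X Y X Y]] by (simp add: mid_swap_eq ts mid_def)
  show "delta H (X \<odot>\<^bsub>H\<^esub> Y) = mid_swap H X X Y Y \<cdot>\<^bsub>H\<^esub> (delta H X \<star>\<^bsub>H\<^esub> delta H Y)"
    using ob by (simp add: mid_swap_eq ts mid_def)
  have "pr\<^sub>1 C (trm C) (trm C) \<cdot> (bang C X \<diamondop> bang C Y) = bang C (X \<^bold>\<times> Y)"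
    using ob by (simp add: dec_simps)
  then show "eps H (X \<odot>\<^bsub>H\<^esub> Y) = lunit H (unit H) \<cdot>\<^bsub>H\<^esub> (eps H X \<star>\<^bsub>H\<^esub> eps H Y)"
    using ob by (simp add: ts)
  show "eta H (X \<odot>\<^bsub>H\<^esub> Y) = (eta H X \<star>\<^bsub>H\<^esub> eta H Y) \<cdot>\<^bsub>H\<^esub> inv_arr H (lunit H (unit H))"
    using ob graph_iso[OF inverse_pair_sym[OF lunit_inverse[of "trm C"]]]
    by (simp add: H_sel H_structure inv_arr_graph[OF lunit_inverse] trm_ob)
       (simp add: ts)
next
  have "bang C (trm C) = ide C (trm C)"
    using eq_bang[of "ide C (trm C)"] by (simp add: dec_simps)
  then show "eta H (unit H) = ide H (unit H)" "eps H (unit H) = ide H (unit H)"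
    by (simp_all add: H_sel H_structure trm_ob graph_ide)
qed

end

section \<open>Functors induced by natural transformations\<close>

text \<open>
  A natural transformation between functors to commutative monoids. Since the comparison maps are sums,
  compatibility with them is additivity of the components.
\<close>

locale additive_decoration_map = reverse_derivative_category C +
    F: additive_decoration C F addF zeroF + G: additive_decoration C G addG zeroG
  for C :: "('o, 'm, 'z) crdcat_scheme" (structure)
    and F :: "('o, 'm, 's) decoration" and addF zeroF
    and G :: "('o, 'm, 't) decoration" and addG zeroG +
  fixes \<alpha> :: "'s \<Rightarrow> 't"
  assumes map_in: "\<lbrakk>X \<in> ob C; s \<in> dob F X\<rbrakk> \<Longrightarrow> \<alpha> s \<in> dob G X"
    and map_natural: "\<lbrakk>lin_ar f; s \<in> dob F (cd C f)\<rbrakk> \<Longrightarrow> \<alpha> (dar F f s) = dar G f (\<alpha> s)"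
    and map_add: "\<lbrakk>X \<in> ob C; s \<in> dob F X; t \<in> dob F X\<rbrakk> \<Longrightarrow> \<alpha> (addF s t) = addG (\<alpha> s) (\<alpha> t)"
    and map_zero: "X \<in> ob C \<Longrightarrow> \<alpha> (zeroF X) = zeroG X"
begin

definition map_span :: "('m, 's) dspan set \<Rightarrow> ('m, 't) dspan set" where
  "map_span S = (\<Union>(l, r, s) \<in> S. dspan_class C G l r (\<alpha> s))"

lemma span_map: "F.span l r s \<Longrightarrow> G.span l r (\<alpha> s)"
  by (simp add: F.span_def G.span_def map_in dm_ob lin_ar_imp_ar)

text \<open>By naturality an isomorphism of \<open>F\<close>-decorated spans is also one of the mapped spans, so the union
  that defines \<open>map_span\<close> is one of equal sets.\<close>

lemma map_span_cls:
  assumes S: "F.span l r s"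
  shows "map_span (dspan_class C F l r s) = dspan_class C G l r (\<alpha> s)"
proof -
  have *: "dspan_class C G l' r' (\<alpha> s') = dspan_class C G l r (\<alpha> s)"
    if "(l', r', s') \<in> dspan_class C F l r s" for l' r' s'
  proof -
    obtain n m where S': "F.span l' r' s'" and n: "F.span_iso n m l r s l' r' s'"
      using \<open>(l', r', s') \<in> dspan_class C F l r s\<close> by (auto elim: F.mem_cls_cases)
    then have "G.span_iso n m l r (\<alpha> s) l' r' (\<alpha> s')"
      unfolding F.span_iso_def G.span_iso_def F.span_def using map_natural[of n s'] by auto
    then show ?thesis
      using G.cls_eqI[OF span_map[OF S] span_map[OF S']] by simp
  qed
  show ?thesis
    unfolding map_span_def
  proof (intro equalityI subsetI)
    fix x assume "x \<in> dspan_class C G l r (\<alpha> s)"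
    then show "x \<in> (\<Union>(l, r, s) \<in> dspan_class C F l r s. dspan_class C G l r (\<alpha> s))"
      by (rule UN_triple_I[OF F.self_mem_cls[OF S]])
  qed (use * in auto)
qed

lemma map_span_graph: "lin_ar f \<Longrightarrow> map_span (F.graph f) = G.graph f"
  by (simp add: F.graph_def G.graph_def map_span_cls F.span_graph map_zero dm_ob lin_ar_imp_ar)

lemma map_span_cograph: "lin_ar f \<Longrightarrow> map_span (F.cograph f) = G.cograph f"
  by (simp add: F.cograph_def G.cograph_def map_span_cls F.span_cograph map_zero dm_ob lin_ar_imp_ar)

lemma map_span_Hom: "S \<in> Hom F.H X Y \<Longrightarrow> map_span S \<in> Hom G.H X Y"
  by (auto simp: F.Hom_H_iff map_span_cls intro!: G.cls_Hom span_map)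

lemma map_span_cmp:
  assumes S: "S \<in> Hom F.H X Y" and T: "T \<in> Hom F.H Y Z"
  shows "map_span (dspan_cmp C F T S) = dspan_cmp C G (map_span T) (map_span S)"
proof -
  obtain l\<^sub>1 r\<^sub>1 s where s: "S = dspan_class C F l\<^sub>1 r\<^sub>1 s" "F.span l\<^sub>1 r\<^sub>1 s" "cd C r\<^sub>1 = Y"
    using S unfolding F.Hom_H_iff by blast
  obtain l\<^sub>2 r\<^sub>2 t where t: "T = dspan_class C F l\<^sub>2 r\<^sub>2 t" "F.span l\<^sub>2 r\<^sub>2 t" "cd C l\<^sub>2 = Y"
    using T unfolding F.Hom_H_iff by blast
  obtain b\<^sub>0 b\<^sub>1 where b: "is_pullback (Lin C) r\<^sub>1 l\<^sub>2 b\<^sub>0 b\<^sub>1"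
    using F.has_pullbacks[of r\<^sub>1 l\<^sub>2] s t by (auto simp: F.span_def)
  note tb = pullback_typing(3,4,6-8)[OF b]
  have sp: "F.span (l\<^sub>1 \<cdot> b\<^sub>0) (r\<^sub>2 \<cdot> b\<^sub>1) (addF (dar F b\<^sub>0 s) (dar F b\<^sub>1 t))"
    using s t tb by (simp add: F.span_def F.dec_simps)
  have "\<alpha> (addF (dar F b\<^sub>0 s) (dar F b\<^sub>1 t)) = addG (dar G b\<^sub>0 (\<alpha> s)) (dar G b\<^sub>1 (\<alpha> t))"
    using s t tb by (simp add: F.span_def map_add[of "dm C b\<^sub>1"] map_natural F.dar_in dm_ob lin_ar_imp_ar)
  then show ?thesis
    using F.cls_cmp[OF s(2) t(2) b] G.cls_cmp[OF span_map[OF s(2)] span_map[OF t(2)] b]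
    by (simp add: s(1) t(1) map_span_cls s(2) t(2) sp)
qed

lemma map_span_tensor:
  assumes S: "S \<in> Hom F.H X Y" and T: "T \<in> Hom F.H Z W"
  shows "map_span (dspan_tensor C F S T) = dspan_tensor C G (map_span S) (map_span T)"
proof -
  obtain l\<^sub>1 r\<^sub>1 s where s: "S = dspan_class C F l\<^sub>1 r\<^sub>1 s" "F.span l\<^sub>1 r\<^sub>1 s"
    using S unfolding F.Hom_H_iff by blast
  obtain l\<^sub>2 r\<^sub>2 t where t: "T = dspan_class C F l\<^sub>2 r\<^sub>2 t" "F.span l\<^sub>2 r\<^sub>2 t"
    using T unfolding F.Hom_H_iff by blast
  let ?p = "pr\<^sub>0 C (dm C r\<^sub>1) (dm C r\<^sub>2)" and ?q = "pr\<^sub>1 C (dm C r\<^sub>1) (dm C r\<^sub>2)"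
  have sp: "F.span (l\<^sub>1 \<diamondop> l\<^sub>2) (r\<^sub>1 \<diamondop> r\<^sub>2) (addF (dar F ?p s) (dar F ?q t))"
    using s t by (simp add: F.span_def F.dec_simps)
  have "\<alpha> (addF (dar F ?p s) (dar F ?q t)) = addG (dar G ?p (\<alpha> s)) (dar G ?q (\<alpha> t))"
    using s t by (simp add: F.span_def map_add[of "dm C r\<^sub>1 \<^bold>\<times> dm C r\<^sub>2"] map_natural F.dec_simps)
  then show ?thesis
    using F.cls_tensor[OF s(2) t(2)] G.cls_tensor[OF span_map[OF s(2)] span_map[OF t(2)]]
    by (simp add: s(1) t(1) map_span_cls s(2) t(2) sp)
qed

text \<open>The functor is strict: it preserves the tensor product and all structural arrows on the nose, so that
  identities serve as coherence isomorphisms.\<close>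

lemma hypergraph_functor_map_span:
  "hypergraph_functor F.H G.H (\<lambda>X. X) map_span (\<lambda>X Y. ide G.H (X \<^bold>\<times> Y)) (ide G.H (trm C))"
proof -
  interpret A: hypergraph_category F.H by (rule F.hypergraph_category_H)
  interpret B: hypergraph_category G.H by (rule G.hypergraph_category_H)
  note sel = F.H_sel G.H_sel
  have str: "X \<in> ob C \<Longrightarrow> map_span (ide F.H X) = ide G.H X"
    "\<lbrakk>X \<in> ob C; Y \<in> ob C; Z \<in> ob C\<rbrakk> \<Longrightarrow> map_span (assoc F.H X Y Z) = assoc G.H X Y Z"
    "X \<in> ob C \<Longrightarrow> map_span (lunit F.H X) = lunit G.H X"
    "X \<in> ob C \<Longrightarrow> map_span (runit F.H X) = runit G.H X"
    "\<lbrakk>X \<in> ob C; Y \<in> ob C\<rbrakk> \<Longrightarrow> map_span (swap F.H X Y) = swap G.H X Y"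
    "X \<in> ob C \<Longrightarrow> map_span (mu F.H X) = mu G.H X"
    "X \<in> ob C \<Longrightarrow> map_span (eta F.H X) = eta G.H X"
    "X \<in> ob C \<Longrightarrow> map_span (delta F.H X) = delta G.H X"
    "X \<in> ob C \<Longrightarrow> map_span (eps F.H X) = eps G.H X" for X Y Z
    by (simp_all add: F.H_structure G.H_structure map_span_graph map_span_cograph
        F.structure_typing lin_simps F.asc_def G.asc_def F.swp_def G.swp_def F.diag_def G.diag_def prd_simps)
  have id: "inverse_arrows G.H X X (ide G.H X) (ide G.H X)" if "X \<in> ob C" for X
    using that B.ide_Hom[of X] B.ide_left[OF B.ide_Hom[of X]] by (simp add: inverse_arrows_def sel)
  have unit: "S \<in> Hom G.H X Y \<Longrightarrow> dspan_cmp C G (ide G.H Y) S = S" "S \<in> Hom G.H X Y \<Longrightarrow> dspan_cmp C G S (ide G.H X) = S"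
    for S X Y
    using B.ide_left[of S X Y] B.ide_right[of S X Y] by (simp_all add: sel)
  have tid: "\<lbrakk>X \<in> ob C; Y \<in> ob C\<rbrakk> \<Longrightarrow> dspan_tensor C G (ide G.H X) (ide G.H Y) = ide G.H (X \<^bold>\<times> Y)" for X Y
    using B.tar_ide[of X Y] by (simp add: sel)
  note [simp] = trm_ob prd_ob
  show ?thesis
  proof (intro hypergraph_functor.intro A.hypergraph_category_axioms B.hypergraph_category_axioms
      category_functor.intro A.category_axioms B.category_axioms category_functor_axioms.intro
      hypergraph_functor_axioms.intro)
    fix X assume "X \<in> ob F.H"
    then have X: "X \<in> ob C"
      by (simp add: sel)
    then show "X \<in> ob G.H" "map_span (ide F.H X) = ide G.H X"
      by (simp_all add: sel str)
    show "map_span (mu F.H X) \<cdot>\<^bsub>G.H\<^esub> ide G.H (X \<^bold>\<times> X) = mu G.H X"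
      using X unit[OF B.mu_Hom[of X]] by (simp add: sel str)
    show "map_span (eta F.H X) \<cdot>\<^bsub>G.H\<^esub> ide G.H (trm C) = eta G.H X"
      using X unit[OF B.eta_Hom[of X]] by (simp add: sel str)
    show "map_span (delta F.H X) = ide G.H (X \<^bold>\<times> X) \<cdot>\<^bsub>G.H\<^esub> delta G.H X"
      using X unit[OF B.delta_Hom[of X]] by (simp add: sel str)
    show "map_span (eps F.H X) = ide G.H (trm C) \<cdot>\<^bsub>G.H\<^esub> eps G.H X"
      using X unit[OF B.eps_Hom[of X]] by (simp add: sel str)
    have "lunit G.H X \<in> Hom G.H (trm C \<^bold>\<times> X) X" "runit G.H X \<in> Hom G.H (X \<^bold>\<times> trm C) X"
      using B.lunit_Iso[of X] B.runit_Iso[of X] X by (auto simp: Iso_def inverse_arrows_def sel)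
    then show "map_span (lunit F.H X) \<cdot>\<^bsub>G.H\<^esub> ide G.H (unit F.H \<^bold>\<times> X) \<cdot>\<^bsub>G.H\<^esub>
        (ide G.H (trm C) \<star>\<^bsub>G.H\<^esub> ide G.H X) = lunit G.H X"
      "map_span (runit F.H X) \<cdot>\<^bsub>G.H\<^esub> ide G.H (X \<^bold>\<times> unit F.H) \<cdot>\<^bsub>G.H\<^esub> (ide G.H X \<star>\<^bsub>G.H\<^esub> ide G.H (trm C)) = runit G.H X"
      using X unit(1)[OF B.ide_Hom] by (simp_all add: sel str tid unit)
  next
    fix X Y assume "X \<in> ob F.H" "Y \<in> ob F.H"
    then have X: "X \<in> ob C" "Y \<in> ob C"
      by (simp_all add: sel)
    then show "ide G.H (X \<^bold>\<times> Y) \<in> Iso G.H (X \<odot>\<^bsub>G.H\<^esub> Y) (X \<odot>\<^bsub>F.H\<^esub> Y)"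
      using id[of "X \<^bold>\<times> Y"] by (auto simp: Iso_def sel)
    show "map_span (swap F.H X Y) \<cdot>\<^bsub>G.H\<^esub> ide G.H (X \<^bold>\<times> Y) = ide G.H (Y \<^bold>\<times> X) \<cdot>\<^bsub>G.H\<^esub> swap G.H X Y"
      using X unit[OF B.swap_Hom[of X Y]] by (simp add: sel str)
  next
    show "ide G.H (trm C) \<in> Iso G.H (unit G.H) (unit F.H)"
      using id[of "trm C"] by (auto simp: Iso_def sel)
  next
    fix S X Y assume "S \<in> Hom F.H X Y"
    then show "map_span S \<in> Hom G.H X Y"
      by (rule map_span_Hom)
  next
    fix S T X Y Z assume "S \<in> Hom F.H X Y" "T \<in> Hom F.H Y Z"
    then show "map_span (T \<cdot>\<^bsub>F.H\<^esub> S) = map_span T \<cdot>\<^bsub>G.H\<^esub> map_span S"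
      by (simp add: sel map_span_cmp)
  next
    fix S T X X' Y Y' assume st: "S \<in> Hom F.H X X'" "T \<in> Hom F.H Y Y'"
    show "ide G.H (X' \<^bold>\<times> Y') \<cdot>\<^bsub>G.H\<^esub> (map_span S \<star>\<^bsub>G.H\<^esub> map_span T) = map_span (S \<star>\<^bsub>F.H\<^esub> T) \<cdot>\<^bsub>G.H\<^esub> ide G.H (X \<^bold>\<times> Y)"
      using unit[OF G.H_tensor_Hom[OF map_span_Hom[OF st(1)] map_span_Hom[OF st(2)]]]
      by (simp add: sel map_span_tensor[OF st])
  next
    fix X Y Z assume "X \<in> ob F.H" "Y \<in> ob F.H" "Z \<in> ob F.H"
    then have X: "X \<in> ob C" "Y \<in> ob C" "Z \<in> ob C"
      by (simp_all add: sel)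
    then have "assoc G.H X Y Z \<in> Hom G.H ((X \<^bold>\<times> Y) \<^bold>\<times> Z) (X \<^bold>\<times> Y \<^bold>\<times> Z)"
      using B.assoc_Iso[of X Y Z] by (auto simp: Iso_def inverse_arrows_def sel)
    then show "map_span (assoc F.H X Y Z) \<cdot>\<^bsub>G.H\<^esub> ide G.H ((X \<odot>\<^bsub>F.H\<^esub> Y) \<^bold>\<times> Z) \<cdot>\<^bsub>G.H\<^esub> (ide G.H (X \<^bold>\<times> Y) \<star>\<^bsub>G.H\<^esub> ide G.H Z)
      = ide G.H (X \<^bold>\<times> Y \<odot>\<^bsub>F.H\<^esub> Z) \<cdot>\<^bsub>G.H\<^esub> (ide G.H X \<star>\<^bsub>G.H\<^esub> ide G.H (Y \<^bold>\<times> Z)) \<cdot>\<^bsub>G.H\<^esub> assoc G.H X Y Z"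
      using X unit(1)[OF B.ide_Hom] by (simp add: sel str tid unit)
  qed
qed

end

section \<open>Gradient descent\<close>

context optimization_domain
begin

text \<open>Additive inverses are unique, as in any monoid; this makes the description that defines \<open>neg\<close> meaningful.\<close>

lemma neg_ex1: "f \<in> ar C \<Longrightarrow> \<exists>!g. g \<in> Hom C (dm C f) (cd C f) \<and> f \<^bold>+ g = nul C (dm C f) (cd C f)"
proof -
  assume f: "f \<in> ar C"
  interpret M: comm_monoid "\<lparr>carrier = Hom C (dm C f) (cd C f), mult = pls C, one = nul C (dm C f) (cd C f)\<rparr>"
    using f by (intro comm_monoid_Hom) (auto simp: cat_simps)
  obtain g where "g \<in> Hom C (dm C f) (cd C f)" "f \<^bold>+ g = nul C (dm C f) (cd C f)"
    using additive_inverse[of f "dm C f" "cd C f"] f by (auto simp: Hom_iff)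
  then show ?thesis
    using M.inv_unique[of _ f g] M.m_comm f by (intro ex1I[of _ g]) (auto simp: Hom_iff)
qed

lemma neg_typing:
  assumes "f \<in> ar C"
  shows "neg C f \<in> ar C" "dm C (neg C f) = dm C f" "cd C (neg C f) = cd C f"
  using theI'[OF neg_ex1[OF assms]] by (auto simp: neg_def Hom_iff)

lemma plus_neg: "f \<in> ar C \<Longrightarrow> f \<^bold>+ neg C f = nul C (dm C f) (cd C f)"
  using theI'[OF neg_ex1] by (auto simp: neg_def Hom_iff)

lemma neg_eqI:
  assumes "f \<in> ar C" "g \<in> ar C" "dm C g = dm C f" "cd C g = cd C f" "f \<^bold>+ g = nul C (dm C f) (cd C f)"
  shows "neg C f = g"
  unfolding neg_def using assms by (intro the1_equality[OF neg_ex1]) (auto simp: Hom_iff)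

lemma neg_nul: "X \<in> ob C \<Longrightarrow> Y \<in> ob C \<Longrightarrow> neg C (nul C X Y) = nul C X Y"
  by (rule neg_eqI) (simp_all add: add_simps)

lemma neg_plus:
  assumes "f \<in> ar C" "g \<in> ar C" "dm C f = dm C g" "cd C f = cd C g"
  shows "neg C (f \<^bold>+ g) = neg C f \<^bold>+ neg C g"
proof (rule neg_eqI)
  have "(f \<^bold>+ g) \<^bold>+ (neg C f \<^bold>+ neg C g) = (g \<^bold>+ f) \<^bold>+ (neg C f \<^bold>+ neg C g)"
    using assms by (simp add: plus_commute[of f g])
  also have "\<dots> = g \<^bold>+ ((f \<^bold>+ neg C f) \<^bold>+ neg C g)"
    using assms by (simp add: plus_assoc plus_typing neg_typing)
  also have "\<dots> = nul C (dm C g) (cd C g)"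
    using assms by (simp add: plus_neg plus_nul neg_typing)
  finally show "(f \<^bold>+ g) \<^bold>+ (neg C f \<^bold>+ neg C g) = nul C (dm C (f \<^bold>+ g)) (cd C (f \<^bold>+ g))"
    using assms by (simp add: plus_typing)
qed (use assms in \<open>simp_all add: plus_typing neg_typing\<close>)

text \<open>Negation commutes with precomposition by left additivity, and with postcomposition by a linear map
  because linear maps are additive.\<close>

lemma neg_conjugate:
  assumes "lin_ar h" "k \<in> ar C" "v \<in> ar C" "cd C k = dm C v" "cd C v = dm C h"
  shows "neg C (h \<cdot> v \<cdot> k) = h \<cdot> neg C v \<cdot> k"
proof (rule neg_eqI)
  have "h \<cdot> v \<cdot> k \<^bold>+ h \<cdot> neg C v \<cdot> k = h \<cdot> (v \<^bold>+ neg C v) \<cdot> k"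
    using assms by (simp add: lin_plus plus_cmp cat_simps lin_ar_imp_ar neg_typing)
  also have "\<dots> = nul C (dm C k) (cd C h)"
    using assms by (simp add: plus_neg lin_at_nul nul_cmp nul_typing cat_simps lin_ar_imp_ar)
  finally show "h \<cdot> v \<cdot> k \<^bold>+ h \<cdot> neg C v \<cdot> k = nul C (dm C (h \<cdot> v \<cdot> k)) (cd C (h \<cdot> v \<cdot> k))"
    using assms by (simp add: cat_simps lin_ar_imp_ar)
qed (use assms in \<open>simp_all add: cat_simps neg_typing lin_ar_imp_ar\<close>)

lemma one_arr_typing:
  assumes "X \<in> ob C" "Y \<in> ob C"
  shows "one_arr C X Y \<in> ar C" "dm C (one_arr C X Y) = X" "cd C (one_arr C X Y) = Y"
    "f \<in> ar C \<Longrightarrow> cd C f = X \<Longrightarrow> one_arr C X Y \<cdot> f = one_arr C (dm C f) Y"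
proof -
  interpret K: cring "\<lparr>carrier = Hom C (trm C) Y, mult = mul C Y, one = uno C Y, zero = nul C (trm C) Y, add = pls C\<rparr>"
    using assms by (intro cring_points)
  have "uno C Y \<in> ar C" "dm C (uno C Y) = trm C" "cd C (uno C Y) = Y"
    using K.one_closed by (auto simp: Hom_iff)
  then show "one_arr C X Y \<in> ar C" "dm C (one_arr C X Y) = X" "cd C (one_arr C X Y) = Y"
    "f \<in> ar C \<Longrightarrow> cd C f = X \<Longrightarrow> one_arr C X Y \<cdot> f = one_arr C (dm C f) Y"
    using assms by (simp_all add: one_arr_def prd_simps)
qed

lemma gradient_typing:
  assumes "f \<in> ar C" "cd C f = robj C"
  shows "gradient C f \<in> ar C" "dm C (gradient C f) = dm C f" "cd C (gradient C f) = dm C f"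
  using assms robj_ob by (simp_all add: gradient_def rd_simps one_arr_typing)

text \<open>The chain rule makes the gradient natural in linear maps: the constant covector \<open>1\<close> is preserved by
  reindexing, and the outer reverse derivative is the dagger because \<open>h\<close> is linear.\<close>

lemma gradient_cmp_lin:
  assumes "lin_ar h" "f \<in> ar C" "cd C f = robj C" "cd C h = dm C f"
  shows "gradient C (f \<cdot> h) = h\<^bold>\<dagger> \<cdot> gradient C f \<cdot> h"
proof -
  let ?N = "dm C h"
  have h: "h \<in> ar C"
    using assms by (simp add: lin_ar_imp_ar)
  have "gradient C (f \<cdot> h) = \<R> (f \<cdot> h) \<cdot> \<langle>ide C ?N, one_arr C ?N (robj C)\<rangle>"
    using assms h by (simp add: gradient_def cat_simps)
  also have "\<dots> = \<R> h \<cdot> \<langle>ide C ?N, \<R> f \<cdot> \<langle>h \<cdot> ide C ?N, one_arr C ?N (robj C)\<rangle>\<rangle>"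
    using assms h robj_ob by (intro R_cmp_at) (simp_all add: cat_simps one_arr_typing)
  also have "\<dots> = h\<^bold>\<dagger> \<cdot> \<R> f \<cdot> \<langle>h, one_arr C ?N (robj C)\<rangle>"
    using assms h robj_ob by (simp add: R_lin_at R_typing cat_simps one_arr_typing pair_typing)
  also have "\<R> f \<cdot> \<langle>h, one_arr C ?N (robj C)\<rangle> = gradient C f \<cdot> h"
    using assms h robj_ob by (simp add: gradient_def R_typing add_simps one_arr_typing)
  finally show ?thesis .
qed

lemma gradient_plus:
  assumes "f \<in> ar C" "g \<in> ar C" "dm C f = dm C g" "cd C f = robj C" "cd C g = robj C"
  shows "gradient C (f \<^bold>+ g) = gradient C f \<^bold>+ gradient C g"
  using assms robj_ob by (simp add: gradient_def rd_simps one_arr_typing)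

lemma gradient_nul: "X \<in> ob C \<Longrightarrow> gradient C (nul C X (robj C)) = nul C X X"
  using robj_ob by (simp add: gradient_def rd_simps one_arr_typing)

lemma additive_obj_decoration:
  assumes "has_finite_limits (Lin C)"
  shows "additive_decoration C (obj_decoration C) (pls C) (\<lambda>X. nul C X (robj C))"
proof
  fix s t u X assume "s \<in> dob (obj_decoration C) X" "t \<in> dob (obj_decoration C) X" "u \<in> dob (obj_decoration C) X"
  then show "s \<^bold>+ t \<^bold>+ u = s \<^bold>+ (t \<^bold>+ u)"
    by (simp add: obj_decoration_def Hom_iff plus_assoc)
qed (use robj_ob pullback_exists[OF assms] in
    \<open>simp_all add: obj_decoration_def Hom_iff lin_ar_imp_ar add_simps plus_commute\<close>)

text \<open>The dagger is contravariantly functorial on linear maps and its values are linear, hence additive. The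
  identity of the terminal object is the zero map, as there is only one endomorphism.\<close>

lemma additive_dyn_decoration:
  assumes "has_finite_limits (Lin C)"
  shows "additive_decoration C (dyn_decoration C) (pls C) (\<lambda>X. nul C X X)"
proof
  fix s t u X assume "s \<in> dob (dyn_decoration C) X" "t \<in> dob (dyn_decoration C) X" "u \<in> dob (dyn_decoration C) X"
  then show "s \<^bold>+ t \<^bold>+ u = s \<^bold>+ (t \<^bold>+ u)"
    by (simp add: dyn_decoration_def Hom_iff plus_assoc)
next
  show "dunit (dyn_decoration C) = nul C (trm C) (trm C)"
    by (simp add: dyn_decoration_def) (rule terminal_arrows_eq; simp add: add_simps)
next
  fix f s t assume "lin_ar f" "s \<in> dob (dyn_decoration C) (cd C f)" "t \<in> dob (dyn_decoration C) (cd C f)"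
  then show "dar (dyn_decoration C) f (s \<^bold>+ t) = dar (dyn_decoration C) f s \<^bold>+ dar (dyn_decoration C) f t"
    by (simp add: dyn_decoration_def Hom_iff lin_plus dagger_lin dagger_typing lin_ar_imp_ar add_simps)
next
  fix f g s assume "lin_ar f" "lin_ar g" "cd C f = dm C g" "s \<in> dob (dyn_decoration C) (cd C g)"
  then show "dar (dyn_decoration C) f (dar (dyn_decoration C) g s) = dar (dyn_decoration C) (g \<cdot> f) s"
    by (simp add: dyn_decoration_def Hom_iff dagger_cmp dagger_typing lin_ar_imp_ar cat_simps)
qed (use pullback_exists[OF assms] in \<open>simp_all add: dyn_decoration_def Hom_iff lin_ar_imp_ar add_simps plus_commute
      dagger_typing dagger_ide dagger_lin lin_at_nul\<close>)

lemma additive_decoration_map_gradient: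
  assumes "has_finite_limits (Lin C)"
  shows "additive_decoration_map C (obj_decoration C) (pls C) (\<lambda>X. nul C X (robj C))
    (dyn_decoration C) (pls C) (\<lambda>X. nul C X X) (\<lambda>f. neg C (gradient C f))"
proof (intro additive_decoration_map.intro additive_decoration_map_axioms.intro reverse_derivative_category_axioms
    additive_obj_decoration[OF assms] additive_dyn_decoration[OF assms])
  fix f s assume "lin_ar f" "s \<in> dob (obj_decoration C) (cd C f)"
  then show "neg C (gradient C (dar (obj_decoration C) f s)) = dar (dyn_decoration C) f (neg C (gradient C s))"
    by (simp add: obj_decoration_def dyn_decoration_def Hom_iff gradient_cmp_lin neg_conjugate gradient_typing
        dagger_lin dagger_typing lin_ar_imp_ar)
qed (auto simp: obj_decoration_def dyn_decoration_def Hom_iff neg_typing gradient_typing gradient_plus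
      neg_plus gradient_nul neg_nul)

end

theorem corollary3p5p1:
  fixes C :: "('o, 'm) optdom"
  assumes "optimization_domain C"
    and "has_finite_limits (Lin C)"
  shows "\<exists>Fo Fm \<Phi> \<Phi>\<^sub>0.
    hypergraph_functor (Opt C) (Dynam C) Fo Fm \<Phi> \<Phi>\<^sub>0 \<and>
    (\<forall>X \<in> ob C. Fo X = X) \<and>
    (\<forall>X Y N l r f. l \<in> Hom (Lin C) N X \<longrightarrow> r \<in> Hom (Lin C) N Y \<longrightarrow> f \<in> Hom C N (robj C) \<longrightarrow>
       Fm (open_objective C l r f) = open_dynamical_system C l r (neg C (gradient C f)))"
proof -
  interpret optimization_domain C
    by (rule assms)
  interpret GD: additive_decoration_map C "obj_decoration C" "pls C" "\<lambda>X. nul C X (robj C)"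
    "dyn_decoration C" "pls C" "\<lambda>X. nul C X X" "\<lambda>f. neg C (gradient C f)"
    using assms(2) by (rule additive_decoration_map_gradient)
  have "GD.map_span (open_objective C l r f) = open_dynamical_system C l r (neg C (gradient C f))"
    if "l \<in> Hom (Lin C) N X" "r \<in> Hom (Lin C) N Y" "f \<in> Hom C N (robj C)" for X Y N l r f
  proof -
    have "GD.F.span l r f"
      unfolding GD.F.span_def using that by (auto simp: Hom_Lin_iff obj_decoration_def)
    then show ?thesis
      by (simp add: open_objective_def open_dynamical_system_def GD.map_span_cls)
  qed
  then show ?thesis
    using GD.hypergraph_functor_map_span unfolding Opt_def Dynam_def by blast
qed

end
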